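(* Consider the initial value problem $$y_1'=y_2-y_1,\quad y_1(0)=r_1,$$ $$y_2'=y_2(y_2-y_1),\quad y_2(0)=r_2,$$ with $r_1,r_2\in\mathbb{R}$. Let the solutions be denoted by $y_1(r_1,r_2;x)$, $y_2(r_1,r_2;x)$, defined on the maximal interval $I(r_1,r_2)$ containing $0$. Then for generic $x\in\mathbb{R}$, the functions $r_2\mapsto y_1(0,r_2;x)$ and $r_2\mapsto y_2(0,r_2;x)$ are not differentially algebraic (DA) with respect to $r_2$.
   Context: An analytic function $f(z)$ defined on an open subset of $\mathbb{K}=\mathbb{R}$ or $\mathbb{C}$ is called differentially algebraic (DA) if there exist $n\ge 0$ and a nonzero polynomial $Q$ in $n+2$ variables (with coefficients in $\mathbb{K}$) such that $Q(z,f(z),f'(z),\dots,f^{(n)}(z))=0$ for all $z$ in the domain of $f$. For fixed $x$, the functions $r_2\mapsto y_k(0,r_2;x)$, $k=1,2$, are defined on the open set of $r_2\in\mathbb{R}$ such that $x\in I(0,r_2)$. Generic: for $U\subset\mathbb{R}^N$ open and $V\subset U$, $V$ is generic in $U$ if $U\setminus V$ is both of Lebesgue measure $0$ and of first Baire category. A property holds for generic $u\in U$ if the set of $u\in U$ having it is generic in $U$. *)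

theory Defs
  imports "HOL-Analysis.Analysis" "HOL-Library.Poly_Mapping"
begin

text \<open>
  Polynomials in the variables \<open>X\<^sub>0, X\<^sub>1, \<dots>\<close> are finitely supported maps from exponent
  vectors (themselves finitely supported) to coefficients.
\<close>

definition poly_vars :: "((nat \<Rightarrow>\<^sub>0 nat) \<Rightarrow>\<^sub>0 'a::zero) \<Rightarrow> nat set" where
  "poly_vars Q = (\<Union>m\<in>Poly_Mapping.keys Q. Poly_Mapping.keys m)"

definition poly_eval :: "((nat \<Rightarrow>\<^sub>0 nat) \<Rightarrow>\<^sub>0 'a) \<Rightarrow> (nat \<Rightarrow> 'a) \<Rightarrow> 'a::comm_semiring_1" where
  "poly_eval Q v =
     (\<Sum>m\<in>Poly_Mapping.keys Q.
        Poly_Mapping.lookup Q m * (\<Prod>i\<in>Poly_Mapping.keys m. v i ^ Poly_Mapping.lookup m i))"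

text \<open>
  The function \<open>f\<close> is differentially algebraic on the open set \<open>S\<close>: the variable \<open>X\<^sub>0\<close> is
  instantiated by the argument and \<open>X\<close> with index \<open>k + 1\<close> by the \<open>k\<close>-th derivative of \<open>f\<close>.
  The notion is meant for \<open>f\<close> analytic on \<open>S\<close> and the values of \<open>f\<close> outside \<open>S\<close> are then
  irrelevant. Analyticity is deliberately not a conjunct, so that the negation
  can never hold merely because \<open>f\<close> fails to be analytic.
\<close>

definition differentially_algebraic_on ::
    "('a::real_normed_field \<Rightarrow> 'a) \<Rightarrow> 'a set \<Rightarrow> bool" where
  "differentially_algebraic_on f S \<longleftrightarrow>
     (\<exists>(n::nat) (Q :: (nat \<Rightarrow>\<^sub>0 nat) \<Rightarrow>\<^sub>0 'a).
        Q \<noteq> 0 \<and> poly_vars Q \<subseteq> {..<n + 2} \<and>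
        (\<forall>z\<in>S. poly_eval Q (case_nat z (\<lambda>k. (deriv ^^ k) f z)) = 0))"

definition nowhere_dense :: "'a::topological_space set \<Rightarrow> bool" where
  "nowhere_dense A \<longleftrightarrow> interior (closure A) = {}"

definition first_category :: "'a::topological_space set \<Rightarrow> bool" where
  "first_category A \<longleftrightarrow> (\<exists>\<F>. countable \<F> \<and> (\<forall>N\<in>\<F>. nowhere_dense N) \<and> A = \<Union>\<F>)"

text \<open>
  For subsets of an open set \<open>U\<close>, being nowhere dense relative to \<open>U\<close> and relative to the whole
  space is the same, so that the category condition need not be relativised to \<open>U\<close>.
\<close>

definition generic_in :: "'a::euclidean_space set \<Rightarrow> 'a set \<Rightarrow> bool" where
  "generic_in U V \<longleftrightarrow> open U \<and> V \<subseteq> U \<and> U - V \<in> null_sets lebesgue \<and> first_category (U - V)"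

definition ivp_solution ::
    "real \<Rightarrow> real \<Rightarrow> real set \<Rightarrow> (real \<Rightarrow> real) \<Rightarrow> (real \<Rightarrow> real) \<Rightarrow> bool" where
  "ivp_solution r\<^sub>1 r\<^sub>2 J u v \<longleftrightarrow>
     open J \<and> is_interval J \<and> 0 \<in> J \<and> u 0 = r\<^sub>1 \<and> v 0 = r\<^sub>2 \<and>
     (\<forall>t\<in>J. (u has_real_derivative v t - u t) (at t) \<and>
            (v has_real_derivative v t * (v t - u t)) (at t))"

definition maximal_ivp_solution ::
    "real \<Rightarrow> real \<Rightarrow> real set \<Rightarrow> (real \<Rightarrow> real) \<Rightarrow> (real \<Rightarrow> real) \<Rightarrow> bool" where
  "maximal_ivp_solution r\<^sub>1 r\<^sub>2 J u v \<longleftrightarrow>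
     ivp_solution r\<^sub>1 r\<^sub>2 J u v \<and>
     (\<forall>J' u' v'. ivp_solution r\<^sub>1 r\<^sub>2 J' u' v' \<and> J \<subseteq> J' \<and> (\<forall>t\<in>J. u' t = u t \<and> v' t = v t)
        \<longrightarrow> J' = J)"

end

theory Submission
  imports Defs "HOL-Complex_Analysis.Complex_Analysis"
begin

text \<open>
If \<open>y\<^sub>1 0 = 0\<close> then \<open>y\<^sub>2 = r * exp y\<^sub>1\<close>, where \<open>r = r\<^sub>2\<close>, and the system becomes the scalar
equation \<open>y' = q(y)\<close> with \<open>q(y) = r * exp y - y\<close>. For \<open>0 < r < 1/3\<close> its solution from \<open>y(0) = 0\<close>
exists for all times, because \<open>q\<close> is positive below its smallest zero, the equilibrium; this
solution is the inverse function of the travel time \<open>x = \<integral>\<^sub>0\<^sup>y du / q(u)\<close>. Only these \<open>r\<close> are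
used: a differential equation in \<open>r\<close> on the full domain restricts to them. Both components fail to
be differentially algebraic for all but countably many \<open>x\<close>.

There are three ideas.

Elimination of the coefficients. Fix \<open>r\<^sub>0\<close> and let \<open>J(x)\<close> consist of \<open>r\<^sub>0\<close> and of all derivatives
in \<open>r\<close>, at \<open>r\<^sub>0\<close>, of the component at time \<open>x\<close>. An algebraic differential equation for a given \<open>x\<close>
says that some monomials in the jet are linearly dependent with real coefficients, and
differentiating it gives such a dependence between all their iterated total derivatives, evaluated
at \<open>J(x)\<close>. The coefficients depend on \<open>x\<close> in an uncontrolled way, but Gaussian elimination removes
them: dependence for uncountably many \<open>x\<close> forces an identity with polynomial coefficients,
provided that a polynomial in \<open>J(x)\<close> with uncountably many zeros \<open>x\<close> vanishes identically.
Freezing the polynomial coefficients then yields one nonzero differential polynomial that kills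
every polynomial function with a prescribed Taylor jet at \<open>r\<^sub>0\<close>, which is absurd since the jet at
a second point is still arbitrary (\<open>countable_DA_if_jets_independent\<close>).

Triangular form of the jets. The \<open>k\<close>-th derivative of \<open>y\<close> in \<open>r\<close> is, up to a nonvanishing factor,
the integral \<open>\<integral>\<^sub>0\<^sup>y exp (k * u) / q(u) ^ (k + 1) du\<close> plus a polynomial in \<open>r\<close>, \<open>y\<close>, \<open>exp y\<close>,
\<open>1 / q\<close> and such integrals of smaller index (\<open>flow_observable.higher_derivatives\<close>). So it suffices
to know that these integrals, as functions of \<open>y\<close> for fixed \<open>r\<close>, are algebraically independent.

Independence of the integrals. They are independent even over quotients of entire functions by
powers of \<open>q\<close>. By Ostrowski's argument, a relation of minimal degree between them can be
differentiated, and yields a nontrivial constant linear combination of the integrands that is the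
derivative of a single-valued meromorphic function (\<open>primitives_alg_independent\<close>). Then its
residues vanish. By Picard's great theorem \<open>q\<close> has infinitely many complex zeros, and there the
residue of the \<open>k\<close>-th integrand is a fixed rational function of the zero whose pole at \<open>1\<close> has
order \<open>2 * k + 1\<close>. These orders are distinct, so the residues can cancel at infinitely many zeros
only if the combination is trivial (\<open>integrands_not_exact\<close>).
\<close>

section \<open>Countable exceptional sets\<close>

lemma generic_in_UNIV_if_countable_compl:
  fixes V :: "real set"
  assumes "countable (- V)"
  shows "generic_in UNIV V"
proof -
  have "UNIV - V = - V"
    by auto
  moreover have "- V \<in> null_sets lebesgue"
    using negligible_countable_Union[of "(\<lambda>x. {x}) ` (- V)"] assms
    by (auto simp flip: negligible_iff_null_sets)
  moreover have "first_category (- V)"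
    unfolding first_category_def nowhere_dense_def
    using assms by (intro exI[of _ "(\<lambda>x. {x}) ` (- V)"]) auto
  ultimately show ?thesis
    unfolding generic_in_def by simp
qed

section \<open>Polynomial functions on jets\<close>

text \<open>
The layout of the arguments of a differential equation: entry \<open>0\<close> is the independent variable and
entry \<open>k + 1\<close> the derivative of order \<open>k\<close>.
\<close>

definition jet :: "(real \<Rightarrow> real) \<Rightarrow> real \<Rightarrow> nat \<Rightarrow> real" where
  "jet f r = case_nat r (\<lambda>k. (deriv ^^ k) f r)"

definition smooth_on :: "(real \<Rightarrow> real) \<Rightarrow> real set \<Rightarrow> bool" where
  "smooth_on f U \<longleftrightarrow>
     (\<forall>k. \<forall>r\<in>U. ((deriv ^^ k) f has_real_derivative (deriv ^^ Suc k) f r) (at r))"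

text \<open>
Polynomials are treated as functions, so that closure properties replace coefficient bookkeeping.
Formal polynomials appear only where linear independence of monomials matters.
\<close>

inductive_set jet_polys :: "((nat \<Rightarrow> real) \<Rightarrow> real) set" where
  const: "(\<lambda>_. c) \<in> jet_polys"
| var: "(\<lambda>v. v i) \<in> jet_polys"
| add: "p \<in> jet_polys \<Longrightarrow> q \<in> jet_polys \<Longrightarrow> (\<lambda>v. p v + q v) \<in> jet_polys"
| mult: "p \<in> jet_polys \<Longrightarrow> q \<in> jet_polys \<Longrightarrow> (\<lambda>v. p v * q v) \<in> jet_polys"

lemma jet_polys_sum:
  "(\<And>m. m \<in> M \<Longrightarrow> p m \<in> jet_polys) \<Longrightarrow> (\<lambda>v. \<Sum>m\<in>M. p m v) \<in> jet_polys"
  by (induction M rule: infinite_finite_induct) (auto intro: jet_polys.intros)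

lemma jet_polys_prod:
  "(\<And>m. m \<in> M \<Longrightarrow> p m \<in> jet_polys) \<Longrightarrow> (\<lambda>v. \<Prod>m\<in>M. p m v) \<in> jet_polys"
  by (induction M rule: infinite_finite_induct) (auto intro: jet_polys.intros)

lemma jet_polys_power: "p \<in> jet_polys \<Longrightarrow> (\<lambda>v. p v ^ n) \<in> jet_polys"
  by (induction n) (auto intro: jet_polys.intros)

lemma jet_polys_uminus: "p \<in> jet_polys \<Longrightarrow> (\<lambda>v. - p v) \<in> jet_polys"
  using jet_polys.mult[OF jet_polys.const[of "-1"], of p] by simp

lemma jet_polys_finite_dependence:
  "p \<in> jet_polys \<Longrightarrow> \<exists>K. \<forall>v w. (\<forall>i<K. v i = w i) \<longrightarrow> p v = p w"
proof (induction rule: jet_polys.induct)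
  case (var i)
  show ?case by (rule exI[of _ "Suc i"]) auto
next
  case (add p q)
  then obtain K L where "\<forall>v w. (\<forall>i<K. v i = w i) \<longrightarrow> p v = p w"
    and "\<forall>v w. (\<forall>i<L. v i = w i) \<longrightarrow> q v = q w" by blast
  then show ?case
    by (intro exI[of _ "max K L"]) (metis less_max_iff_disj)
next
  case (mult p q)
  then obtain K L where "\<forall>v w. (\<forall>i<K. v i = w i) \<longrightarrow> p v = p w"
    and "\<forall>v w. (\<forall>i<L. v i = w i) \<longrightarrow> q v = q w" by blast
  then show ?case
    by (intro exI[of _ "max K L"]) (metis less_max_iff_disj)
qed auto

text \<open>
The derivative of a polynomial along a jet is again a polynomial in the jet, the same one for all
smooth functions. This property determines it as a function on jets, so the choice made below
picks the total derivative.
\<close>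

lemma ex_total_deriv:
  "p \<in> jet_polys \<Longrightarrow> \<exists>p'\<in>jet_polys. \<forall>f U r. smooth_on f U \<longrightarrow> r \<in> U \<longrightarrow>
     ((\<lambda>r. p (jet f r)) has_real_derivative p' (jet f r)) (at r)"
proof (induction rule: jet_polys.induct)
  case (const c)
  show ?case
    by (rule bexI[of _ "\<lambda>_. 0"]) (auto intro: jet_polys.intros)
next
  case (var i)
  show ?case
  proof (cases i)
    case 0
    then show ?thesis
      by (intro bexI[of _ "\<lambda>_. 1"]) (auto simp: jet_def intro: jet_polys.intros)
  next
    case (Suc k)
    then show ?thesis
      by (intro bexI[of _ "\<lambda>v. v (Suc i)"])
        (auto simp: jet_def smooth_on_def intro: jet_polys.intros)
  qed
next
  case (add p q)
  then obtain p' q' where "p' \<in> jet_polys" "q' \<in> jet_polys"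
    and "\<forall>f U r. smooth_on f U \<longrightarrow> r \<in> U \<longrightarrow>
     ((\<lambda>r. p (jet f r)) has_real_derivative p' (jet f r)) (at r)"
    and "\<forall>f U r. smooth_on f U \<longrightarrow> r \<in> U \<longrightarrow>
     ((\<lambda>r. q (jet f r)) has_real_derivative q' (jet f r)) (at r)" by blast
  then show ?case
    by (intro bexI[of _ "\<lambda>v. p' v + q' v"] allI impI DERIV_add jet_polys.add) auto
next
  case (mult p q)
  then obtain p' q' where *: "p' \<in> jet_polys" "q' \<in> jet_polys"
    and "\<forall>f U r. smooth_on f U \<longrightarrow> r \<in> U \<longrightarrow>
     ((\<lambda>r. p (jet f r)) has_real_derivative p' (jet f r)) (at r)"
    and "\<forall>f U r. smooth_on f U \<longrightarrow> r \<in> U \<longrightarrow>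
     ((\<lambda>r. q (jet f r)) has_real_derivative q' (jet f r)) (at r)" by blast
  moreover have "(\<lambda>v. p' v * q v + q' v * p v) \<in> jet_polys"
    using * mult.hyps by (intro jet_polys.intros)
  ultimately show ?case
    by (intro bexI[of _ "\<lambda>v. p' v * q v + q' v * p v"] allI impI DERIV_mult) auto
qed

definition total_deriv :: "((nat \<Rightarrow> real) \<Rightarrow> real) \<Rightarrow> (nat \<Rightarrow> real) \<Rightarrow> real" where
  "total_deriv p = (SOME p'. p' \<in> jet_polys \<and> (\<forall>f U r. smooth_on f U \<longrightarrow> r \<in> U \<longrightarrow>
     ((\<lambda>r. p (jet f r)) has_real_derivative p' (jet f r)) (at r)))"

lemma total_deriv:
  assumes "p \<in> jet_polys"
  shows total_deriv_in_jet_polys: "total_deriv p \<in> jet_polys"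
    and has_derivative_along_jet: "smooth_on f U \<Longrightarrow> r \<in> U \<Longrightarrow>
      ((\<lambda>r. p (jet f r)) has_real_derivative total_deriv p (jet f r)) (at r)"
proof -
  have "\<exists>p'. p' \<in> jet_polys \<and> (\<forall>f U r. smooth_on f U \<longrightarrow> r \<in> U \<longrightarrow>
     ((\<lambda>r. p (jet f r)) has_real_derivative p' (jet f r)) (at r))"
    using ex_total_deriv[OF assms] by blast
  from someI_ex[OF this] show "total_deriv p \<in> jet_polys"
    and "smooth_on f U \<Longrightarrow> r \<in> U \<Longrightarrow>
      ((\<lambda>r. p (jet f r)) has_real_derivative total_deriv p (jet f r)) (at r)"
    unfolding total_deriv_def by blast+
qed

lemma total_deriv_iterate_in_jet_polys:
  "p \<in> jet_polys \<Longrightarrow> (total_deriv ^^ j) p \<in> jet_polys"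
  by (induction j) (auto intro: total_deriv_in_jet_polys)

lemma relation_differentiated:
  fixes c :: "'m \<Rightarrow> real"
  assumes "open U" "smooth_on f U"
    and "\<And>m. m \<in> M \<Longrightarrow> p m \<in> jet_polys"
    and "\<And>r. r \<in> U \<Longrightarrow> (\<Sum>m\<in>M. c m * p m (jet f r)) = 0"
    and "r \<in> U"
  shows "(\<Sum>m\<in>M. c m * (total_deriv ^^ j) (p m) (jet f r)) = 0"
  using \<open>r \<in> U\<close>
proof (induction j arbitrary: r)
  case 0
  then show ?case using assms(4) by simp
next
  case (Suc j)
  let ?h = "\<lambda>r. \<Sum>m\<in>M. c m * (total_deriv ^^ j) (p m) (jet f r)"
  have "(?h has_real_derivative (\<Sum>m\<in>M. c m * (total_deriv ^^ Suc j) (p m) (jet f r))) (at r)"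
    using has_derivative_along_jet[OF total_deriv_iterate_in_jet_polys assms(2) \<open>r \<in> U\<close>] assms(3)
    by (auto intro!: DERIV_sum DERIV_cmult)
  moreover have "(?h has_real_derivative 0) (at r)"
    by (rule has_field_derivative_transform_within_open[of "\<lambda>_. 0" _ _ U])
      (use Suc assms(1) in auto)
  ultimately show ?case
    using DERIV_unique by blast
qed

section \<open>Elimination of constants\<close>

text \<open>
The unknown coefficients \<open>c\<close> depend on \<open>x\<close> without any regularity. Elimination trades them for
polynomial coefficients: pivot on an entry of the first column that does not vanish on \<open>W\<close>; apart
from the countably many \<open>x\<close> at which the pivot is zero, a nontrivial solution for the full system
gives one for the system with that column removed. That uncountably many zeros on the curve \<open>J\<close>
force a polynomial to vanish on \<open>W\<close> also makes the polynomials an integral domain on \<open>W\<close>, which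
keeps products with the pivot nonzero.
\<close>

lemma elimination:
  fixes B :: "nat \<Rightarrow> 'm \<Rightarrow> (nat \<Rightarrow> real) \<Rightarrow> real" and J :: "real \<Rightarrow> nat \<Rightarrow> real"
  assumes "finite M"
    and "\<And>j m. m \<in> M \<Longrightarrow> B j m \<in> jet_polys"
    and J: "range J \<subseteq> W"
    and indep: "\<And>p. p \<in> jet_polys \<Longrightarrow> uncountable {x. p (J x) = 0} \<Longrightarrow> (\<forall>v\<in>W. p v = 0)"
    and "uncountable {x. \<exists>c. (\<exists>m\<in>M. c m \<noteq> (0::real)) \<and> (\<forall>j. (\<Sum>m\<in>M. c m * B j m (J x)) = 0)}"
  shows "\<exists>a. (\<forall>m\<in>M. a m \<in> jet_polys) \<and> (\<exists>m\<in>M. \<exists>v\<in>W. a m v \<noteq> 0) \<and>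
    (\<forall>j. \<forall>v\<in>W. (\<Sum>m\<in>M. a m v * B j m v) = 0)"
  using assms(1,2,5)
proof (induction M arbitrary: B rule: finite_induct)
  case empty
  then show ?case by simp
next
  case (insert m0 M)
  have small: "countable {x. p (J x) = 0}" if "p \<in> jet_polys" "\<exists>v\<in>W. p v \<noteq> 0" for p
  proof (rule ccontr)
    assume "uncountable {x. p (J x) = 0}"
    from indep[OF that(1) this] that(2) show False by blast
  qed
  have domain: "\<exists>v\<in>W. p v * q v \<noteq> 0"
    if pq: "p \<in> jet_polys" "q \<in> jet_polys" "\<exists>v\<in>W. p v \<noteq> 0" "\<exists>v\<in>W. q v \<noteq> 0" for p q
  proof (rule ccontr)
    assume *: "\<not> (\<exists>v\<in>W. p v * q v \<noteq> 0)"
    have "countable ({x. p (J x) = 0} \<union> {x. q (J x) = 0})"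
      by (intro countable_Un small pq)
    moreover have "{x. p (J x) = 0} \<union> {x. q (J x) = 0} = UNIV"
      using * J by auto
    ultimately show False
      using uncountable_UNIV_real by simp
  qed
  show ?case
  proof (cases "\<forall>j. \<forall>v\<in>W. B j m0 v = 0")
    case True
    have "J 0 \<in> W" using J by auto
    with True insert.hyps show ?thesis
      by (intro exI[of _ "\<lambda>m. if m = m0 then (\<lambda>_. 1) else (\<lambda>_. 0)"])
        (auto intro: jet_polys.const intro!: sum.neutral)
  next
    case False
    then obtain j0 where j0: "\<exists>v\<in>W. B j0 m0 v \<noteq> 0"
      by blast
    have b: "B j m \<in> jet_polys" if "m \<in> insert m0 M" for j m
      using insert.prems that by blast
    define B' where "B' j m v = B j0 m0 v * B j m v + - (B j m0 v * B j0 m v)" for j m v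
    have B'_poly: "B' j m \<in> jet_polys" if "m \<in> M" for j m
      unfolding B'_def using that
      by (intro jet_polys.add jet_polys.mult jet_polys_uminus b) auto
    let ?S = "{x. \<exists>c. (\<exists>m\<in>insert m0 M. c m \<noteq> 0) \<and> (\<forall>j. (\<Sum>m\<in>insert m0 M. c m * B j m (J x)) = 0)}"
    let ?S' = "{x. \<exists>c. (\<exists>m\<in>M. c m \<noteq> (0::real)) \<and> (\<forall>j. (\<Sum>m\<in>M. c m * B' j m (J x)) = 0)}"
    let ?Z = "{x. B j0 m0 (J x) = 0}"
    have "?S \<subseteq> ?S' \<union> ?Z"
    proof
      fix x assume "x \<in> ?S"
      then obtain c where c: "\<exists>m\<in>insert m0 M. c m \<noteq> 0"
        "\<And>j. (\<Sum>m\<in>insert m0 M. c m * B j m (J x)) = 0" by blast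
      have s: "(\<Sum>m\<in>M. c m * B j m (J x)) = - (c m0 * B j m0 (J x))" for j
        using c(2)[of j] insert.hyps by simp
      have "(\<Sum>m\<in>M. c m * B' j m (J x)) = B j0 m0 (J x) * (\<Sum>m\<in>M. c m * B j m (J x))
        - B j m0 (J x) * (\<Sum>m\<in>M. c m * B j0 m (J x))" for j
        unfolding B'_def by (simp add: algebra_simps sum_distrib_left sum_subtractf)
      then have k: "(\<Sum>m\<in>M. c m * B' j m (J x)) = 0" for j
        by (simp add: s)
      show "x \<in> ?S' \<union> ?Z"
      proof (cases "\<exists>m\<in>M. c m \<noteq> 0")
        case True
        with k show ?thesis by blast
      next
        case False
        then have "c m0 \<noteq> 0" "(\<Sum>m\<in>M. c m * B j0 m (J x)) = 0"
          using c(1) by auto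
        then show ?thesis
          using s[of j0] by simp
      qed
    qed
    moreover have "countable ?Z"
      using j0 by (intro small b) auto
    ultimately have "uncountable ?S'"
      using insert.prems(2) by (meson countable_Un countable_subset)
    from insert.IH[OF B'_poly this] obtain a where a: "\<forall>m\<in>M. a m \<in> jet_polys"
      "\<exists>m\<in>M. \<exists>v\<in>W. a m v \<noteq> 0" "\<forall>j. \<forall>v\<in>W. (\<Sum>m\<in>M. a m v * B' j m v) = 0" by blast
    then obtain m1 where m1: "m1 \<in> M" "\<exists>v\<in>W. a m1 v \<noteq> 0" by blast
    define a' where "a' m = (if m = m0 then (\<lambda>v. - (\<Sum>m\<in>M. a m v * B j0 m v))
      else (\<lambda>v. B j0 m0 v * a m v))" for m
    have "a' m \<in> jet_polys" if "m \<in> insert m0 M" for m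
      unfolding a'_def using that a(1) b
      by (auto intro!: jet_polys.mult jet_polys_sum jet_polys_uminus)
    moreover have "\<exists>v\<in>W. a' m1 v \<noteq> 0"
      using domain[of "B j0 m0" "a m1"] b[of m0 j0] a(1) m1 insert.hyps j0
      unfolding a'_def by auto
    moreover have "(\<Sum>m\<in>insert m0 M. a' m v * B j m v) = 0" if "v \<in> W" for j v
    proof -
      have "(\<Sum>m\<in>M. a' m v * B j m v) = (\<Sum>m\<in>M. B j0 m0 v * a m v * B j m v)"
        using insert.hyps by (intro sum.cong) (auto simp: a'_def)
      then have "(\<Sum>m\<in>insert m0 M. a' m v * B j m v) =
        (\<Sum>m\<in>M. B j0 m0 v * a m v * B j m v) - (\<Sum>m\<in>M. a m v * B j0 m v) * B j m0 v"
        using insert.hyps by (simp add: a'_def)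
      also have "\<dots> = (\<Sum>m\<in>M. a m v * B' j m v)"
        unfolding B'_def by (simp add: algebra_simps sum_distrib_left sum_subtractf)
      finally show ?thesis using a(3) that by simp
    qed
    ultimately show ?thesis using m1 by blast
  qed
qed

section \<open>Polynomials with prescribed jets\<close>

text \<open>
Adding a multiple of \<open>(X - a) ^ K * g\<close> adjusts the derivative of order \<open>K\<close> at \<open>a\<close> without
disturbing the lower ones, the step by which polynomials with prescribed jets are built.
\<close>

lemma higher_pderiv_shifted_power:
  fixes g :: "real poly"
  shows "k < K \<Longrightarrow> poly ((pderiv ^^ k) ([:-a, 1:] ^ K * g)) a = 0"
    and "poly ((pderiv ^^ K) ([:-a, 1:] ^ K * g)) a = fact K * poly g a"
proof -
  have step: "pderiv ([:-a, 1:] ^ Suc K * g) =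
    [:-a, 1:] ^ K * (smult (of_nat (Suc K)) g + [:-a, 1:] * pderiv g)" for K and g :: "real poly"
    by (simp only: pderiv_mult pderiv_power_Suc) (simp add: pderiv_pCons algebra_simps)
  show "k < K \<Longrightarrow> poly ((pderiv ^^ k) ([:-a, 1:] ^ K * g)) a = 0"
  proof (induction k arbitrary: K g)
    case (Suc k)
    then obtain K' where "K = Suc K'" "k < K'" by (cases K) auto
    with Suc.IH show ?case
      by (simp only: funpow_Suc_right o_def step)
  qed auto
  show "poly ((pderiv ^^ K) ([:-a, 1:] ^ K * g)) a = fact K * poly g a"
  proof (induction K arbitrary: g)
    case (Suc K)
    show ?case
      by (simp only: funpow_Suc_right o_def step Suc.IH) (simp add: algebra_simps)
  qed simp
qed

lemma ex_poly_with_jets: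
  fixes a b :: real
  assumes "a \<noteq> b"
  shows "\<exists>f :: real poly. (\<forall>k<K. poly ((pderiv ^^ k) f) a = u k) \<and>
    (\<forall>k<L. poly ((pderiv ^^ k) f) b = w k)"
proof (induction L)
  case 0
  show ?case
  proof (induction K)
    case (Suc K)
    then obtain f where f: "\<forall>k<K. poly ((pderiv ^^ k) f) a = u k" by auto
    define c where "c = (u K - poly ((pderiv ^^ K) f) a) / fact K"
    show ?case
      by (rule exI[of _ "f + [:-a, 1:] ^ K * [:c:]"])
        (use f in \<open>auto simp: higher_pderiv_add higher_pderiv_shifted_power less_Suc_eq c_def
           simp del: mult_pCons_right\<close>)
  qed simp
next
  case (Suc L)
  then obtain f where f: "\<forall>k<K. poly ((pderiv ^^ k) f) a = u k"
    "\<forall>k<L. poly ((pderiv ^^ k) f) b = w k" by auto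
  define c where "c = (w L - poly ((pderiv ^^ L) f) b) / (fact L * (b - a) ^ K)"
  define h where "h = [:-a, 1:] ^ K * ([:-b, 1:] ^ L * [:c:])"
  have h': "h = [:-b, 1:] ^ L * ([:-a, 1:] ^ K * [:c:])"
    unfolding h_def by (simp add: mult_ac del: mult_pCons_right)
  have "poly ((pderiv ^^ k) h) a = 0" if "k < K" for k
    using higher_pderiv_shifted_power(1)[OF that] unfolding h_def .
  moreover have "poly ((pderiv ^^ k) h) b = 0" if "k < L" for k
    using higher_pderiv_shifted_power(1)[OF that] unfolding h' .
  moreover have "poly ((pderiv ^^ L) h) b = w L - poly ((pderiv ^^ L) f) b"
    unfolding h' higher_pderiv_shifted_power(2) using assms by (simp add: c_def)
  ultimately show ?case
    using f by (intro exI[of _ "f + h"]) (auto simp: higher_pderiv_add less_Suc_eq)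
qed

lemma higher_deriv_poly: "(deriv ^^ k) (poly f) = poly ((pderiv ^^ k) (f :: real poly))"
  by (induction k) (auto intro!: ext DERIV_imp_deriv poly_DERIV)

lemma smooth_on_poly: "smooth_on (poly f) U"
  unfolding smooth_on_def higher_deriv_poly by (auto intro: poly_DERIV)

lemma jet_poly_of_poly:
  "p \<in> jet_polys \<Longrightarrow> \<exists>g. \<forall>r. p (jet (poly f) r) = poly g r"
proof (induction rule: jet_polys.induct)
  case (const c)
  show ?case by (rule exI[of _ "[:c:]"]) simp
next
  case (var i)
  show ?case
  proof (cases i)
    case 0
    then show ?thesis by (intro exI[of _ "[:0, 1:]"]) (simp add: jet_def)
  next
    case (Suc k)
    then show ?thesis by (auto simp add: jet_def higher_deriv_poly)
  qed
next
  case (add p q)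
  then show ?case by (metis poly_add)
next
  case (mult p q)
  then show ?case by (metis poly_mult)
qed

text \<open>
This is where polynomials, instead of arbitrary smooth functions, are needed as test functions: a
relation that holds to infinite order at one point holds everywhere.
\<close>

lemma poly_eq_0_if_derivs_vanish:
  fixes g :: "real poly"
  assumes "\<And>k. poly ((pderiv ^^ k) g) a = 0"
  shows "g = 0"
  using assms
proof (induction "degree g" arbitrary: g)
  case 0
  then show ?case
    by (metis funpow_0 degree_eq_zeroE poly_0 poly_pCons add.right_neutral mult_zero_right pCons_0_0)
next
  case (Suc n)
  have "pderiv g = 0"
  proof (rule Suc.hyps(1))
    show "n = degree (pderiv g)"
      using Suc.hyps(2) by (simp add: degree_pderiv)
    show "poly ((pderiv ^^ k) (pderiv g)) a = 0" for k
      using Suc.prems[of "Suc k"] by (simp add: funpow_swap1)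
  qed
  then have "degree g = 0"
    by (simp add: pderiv_eq_0_iff)
  then show ?case
    using Suc.hyps(2) by simp
qed

section \<open>Linear independence of monomials\<close>

definition monomial_val :: "(nat \<Rightarrow>\<^sub>0 nat) \<Rightarrow> (nat \<Rightarrow> 'a) \<Rightarrow> 'a::comm_semiring_1" where
  "monomial_val m v = (\<Prod>i\<in>Poly_Mapping.keys m. v i ^ Poly_Mapping.lookup m i)"

lemma monomial_val_in_jet_polys: "monomial_val m \<in> jet_polys"
  unfolding monomial_val_def[abs_def]
  by (intro jet_polys_prod jet_polys_power jet_polys.var)

lemma monomial_val_cong:
  "(\<And>i. i \<in> Poly_Mapping.keys m \<Longrightarrow> v i = w i) \<Longrightarrow> monomial_val m v = monomial_val m w"
  unfolding monomial_val_def by (intro prod.cong) auto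

lemma monomial_val_superset:
  assumes "finite A" "Poly_Mapping.keys m \<subseteq> A"
  shows "monomial_val m v = (\<Prod>i\<in>A. v i ^ Poly_Mapping.lookup m i)"
  unfolding monomial_val_def using assms
  by (intro prod.mono_neutral_left) (auto simp: in_keys_iff)

lemma base_expansion_inj:
  fixes B :: nat
  assumes "\<And>i. d i < B" "\<And>i. e i < B" "(\<Sum>i<N. d i * B ^ i) = (\<Sum>i<N. e i * B ^ i)" "i < N"
  shows "d i = e i"
  using assms
proof (induction N arbitrary: d e i)
  case (Suc N)
  have shift: "(\<Sum>i<Suc N. d i * B ^ i) = d 0 + B * (\<Sum>i<N. d (Suc i) * B ^ i)" for d :: "nat \<Rightarrow> nat"
    by (simp add: sum.lessThan_Suc_shift sum_distrib_left mult_ac del: sum.lessThan_Suc)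
  have eq: "d 0 + B * (\<Sum>i<N. d (Suc i) * B ^ i) = e 0 + B * (\<Sum>i<N. e (Suc i) * B ^ i)"
    using Suc.prems(3) by (simp only: shift)
  have "d 0 = e 0"
    using arg_cong[OF eq, of "\<lambda>n. n mod B"] Suc.prems(1,2) by simp
  moreover have "B > 0" using Suc.prems(1)[of 0] by simp
  ultimately have "(\<Sum>i<N. d (Suc i) * B ^ i) = (\<Sum>i<N. e (Suc i) * B ^ i)"
    using eq by simp
  then have "j < N \<Longrightarrow> d (Suc j) = e (Suc j)" for j
    using Suc.IH[of "d \<circ> Suc" "e \<circ> Suc" j] Suc.prems(1,2) by simp
  with \<open>d 0 = e 0\<close> Suc.prems(4) show ?case by (cases i) auto
qed simp

text \<open>
Kronecker's substitution \<open>v i = t ^ (B ^ i)\<close> turns distinct monomials with exponents below \<open>B\<close>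
into distinct powers of the single variable \<open>t\<close>, by uniqueness of expansions in base \<open>B\<close>. As
\<open>v 0 = t\<close>, the excluded value of \<open>v 0\<close> costs only one \<open>t\<close>.
\<close>

lemma monomials_lin_indep:
  fixes c :: "(nat \<Rightarrow>\<^sub>0 nat) \<Rightarrow> real"
  assumes "finite M" "\<And>m. m \<in> M \<Longrightarrow> Poly_Mapping.keys m \<subseteq> {..<N}"
    and zero: "\<And>v. v 0 \<noteq> a \<Longrightarrow> (\<Sum>m\<in>M. c m * monomial_val m v) = 0"
    and "m \<in> M"
  shows "c m = 0"
proof -
  define B where "B = Suc (Max (insert 0 (\<Union>m\<in>M. Poly_Mapping.lookup m ` {..<N})))"
  have B: "Poly_Mapping.lookup m i < B" if "m \<in> M" for m i
  proof (cases "i < N")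
    case True
    then show ?thesis unfolding B_def less_Suc_eq_le
      using that assms(1) by (intro Max_ge) auto
  next
    case False
    then have "i \<notin> Poly_Mapping.keys m" using assms(2)[OF that] by auto
    then show ?thesis by (simp add: in_keys_iff B_def)
  qed
  define e where "e m = (\<Sum>i<N. Poly_Mapping.lookup m i * B ^ i)" for m
  have inj: "m = m'" if "m \<in> M" "m' \<in> M" "e m = e m'" for m m'
  proof (rule poly_mapping_eqI)
    fix i
    show "Poly_Mapping.lookup m i = Poly_Mapping.lookup m' i"
    proof (cases "i < N")
      case True
      then show ?thesis
        using base_expansion_inj[of "Poly_Mapping.lookup m" B "Poly_Mapping.lookup m'" N i]
          B that unfolding e_def by blast
    next
      case False
      then have "i \<notin> Poly_Mapping.keys m" "i \<notin> Poly_Mapping.keys m'"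
        using assms(2) that by auto
      then show ?thesis by (simp add: in_keys_iff)
    qed
  qed
  define P where "P = (\<Sum>m\<in>M. monom (c m) (e m))"
  have "poly P t = 0" if "t \<noteq> a" for t
  proof -
    have "monomial_val m (\<lambda>i. t ^ B ^ i) = t ^ e m" if "m \<in> M" for m
      using assms(2)[OF that]
      by (simp add: monomial_val_superset[of "{..<N}"] e_def power_sum flip: power_mult)
         (simp add: mult.commute)
    then have "poly P t = (\<Sum>m\<in>M. c m * monomial_val m (\<lambda>i. t ^ B ^ i))"
      unfolding P_def by (simp add: poly_sum poly_monom)
    also have "\<dots> = 0"
      using that by (intro zero) simp
    finally show ?thesis .
  qed
  then have "- {a} \<subseteq> {t. poly P t = 0}" by auto
  moreover have "infinite (- {a})"
    by (simp add: infinite_UNIV_char_0)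
  ultimately have "P = 0"
    using poly_roots_finite[of P] finite_subset by blast
  moreover have "coeff P (e m) = (\<Sum>m'\<in>M. if m' = m then c m else 0)"
    unfolding P_def coeff_sum using inj \<open>m \<in> M\<close> by (intro sum.cong) auto
  ultimately show ?thesis
    using assms(1) \<open>m \<in> M\<close> by simp
qed

lemma finite_bounded_monomials:
  "finite {m :: nat \<Rightarrow>\<^sub>0 nat. Poly_Mapping.keys m \<subseteq> {..<N} \<and> (\<forall>i. Poly_Mapping.lookup m i \<le> d)}"
  (is "finite ?M")
proof (rule finite_imageD)
  show "finite (Poly_Mapping.lookup ` ?M)"
  proof (rule finite_subset)
    show "Poly_Mapping.lookup ` ?M \<subseteq> {g. \<forall>i. (i \<in> {..<N} \<longrightarrow> g i \<in> {..d}) \<and> (i \<notin> {..<N} \<longrightarrow> g i = 0)}"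
      by (force simp: in_keys_iff)
    show "finite {g. \<forall>i. (i \<in> {..<N} \<longrightarrow> g i \<in> {..d}) \<and> (i \<notin> {..<N} \<longrightarrow> g i = (0::nat))}"
      by (rule finite_set_of_finite_funs) auto
  qed
  show "inj_on Poly_Mapping.lookup ?M"
    by (simp add: inj_on_def lookup_inject)
qed

section \<open>Families with algebraically independent jets\<close>

text \<open>
For each bound on order and degree, the equation is a linear dependence among finitely many
monomials. If it occurred for uncountably many \<open>x\<close>, elimination would give coefficients \<open>a m\<close>,
polynomials in the jet, such that \<open>\<Sum>m. a m v * B j m v = 0\<close> for all \<open>j\<close> and for every \<open>v\<close> over
\<open>r\<^sub>0\<close>. They see only finitely many entries of \<open>v\<close>. Fix those so that some \<open>a m v\<close> is nonzero; then
the differential polynomial with the frozen coefficients \<open>c m = a m v\<close> annihilates to infinite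
order at \<open>r\<^sub>0\<close>, hence identically, each polynomial function with this initial jet. Since its jet
at another point is arbitrary, all \<open>c m\<close> are zero.
\<close>

theorem countable_DA_if_jets_independent:
  fixes f :: "real \<Rightarrow> real \<Rightarrow> real"
  assumes U: "open U" "r\<^sub>0 \<in> U" and smooth: "\<And>x. smooth_on (f x) U"
    and indep: "\<And>p. p \<in> jet_polys \<Longrightarrow> uncountable {x. p (jet (f x) r\<^sub>0) = 0} \<Longrightarrow>
      (\<forall>v. v 0 = r\<^sub>0 \<longrightarrow> p v = 0)"
  shows "countable {x. differentially_algebraic_on (f x) U}"
proof -
  define Mon :: "nat \<Rightarrow> nat \<Rightarrow> (nat \<Rightarrow>\<^sub>0 nat) set" where
    "Mon n d = {m. Poly_Mapping.keys m \<subseteq> {..<n + 2} \<and> (\<forall>i. Poly_Mapping.lookup m i \<le> d)}" for n d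
  have fin: "finite (Mon n d)" for n d
    unfolding Mon_def by (rule finite_bounded_monomials)
  define W where "W = {v :: nat \<Rightarrow> real. v 0 = r\<^sub>0}"
  define J where "J x = jet (f x) r\<^sub>0" for x
  define B :: "nat \<Rightarrow> (nat \<Rightarrow>\<^sub>0 nat) \<Rightarrow> (nat \<Rightarrow> real) \<Rightarrow> real" where
    "B j m = (total_deriv ^^ j) (monomial_val m)" for j m
  have B: "B j m \<in> jet_polys" for j m
    unfolding B_def by (intro total_deriv_iterate_in_jet_polys monomial_val_in_jet_polys)
  define S where "S n d = {x. \<exists>c. (\<exists>m\<in>Mon n d. c m \<noteq> (0::real)) \<and>
    (\<forall>j. (\<Sum>m\<in>Mon n d. c m * B j m (J x)) = 0)}" for n d
  have "countable (S n d)" for n d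
  proof (rule ccontr)
    assume "uncountable (S n d)"
    have "range J \<subseteq> W"
      by (auto simp: J_def W_def jet_def)
    from elimination[OF fin B this _ \<open>uncountable (S n d)\<close>[unfolded S_def]] indep
    obtain a m0 v where a: "\<forall>m\<in>Mon n d. a m \<in> jet_polys" "m0 \<in> Mon n d" "v \<in> W" "a m0 v \<noteq> 0"
      "\<forall>j. \<forall>v\<in>W. (\<Sum>m\<in>Mon n d. a m v * B j m v) = 0"
      unfolding J_def W_def by blast
    define c where "c m = a m v" for m
    have "\<forall>m\<in>Mon n d. \<exists>K. \<forall>v w. (\<forall>i<K. v i = w i) \<longrightarrow> a m v = a m w"
      using a(1) jet_polys_finite_dependence by blast
    then obtain L where L: "\<forall>m\<in>Mon n d. \<forall>v w. (\<forall>i<L m. v i = w i) \<longrightarrow> a m v = a m w"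
      by metis
    define K where "K = Max (insert 0 (L ` Mon n d))"
    have K: "a m v = a m w" if "m \<in> Mon n d" "\<forall>i<K. v i = w i" for m v w
    proof -
      have "L m \<le> K" unfolding K_def using that fin by (intro Max_ge) auto
      with that L show ?thesis by (meson order_less_le_trans)
    qed
    have "(\<Sum>m\<in>Mon n d. c m * monomial_val m w) = 0" if w: "w 0 \<noteq> r\<^sub>0" for w
    proof -
      obtain F :: "real poly" where F: "\<forall>k<K. poly ((pderiv ^^ k) F) r\<^sub>0 = v (Suc k)"
        "\<forall>k<Suc n. poly ((pderiv ^^ k) F) (w 0) = w (Suc k)"
        using ex_poly_with_jets[OF w[symmetric], of K "\<lambda>k. v (Suc k)" "Suc n" "\<lambda>k. w (Suc k)"]
        by blast
      let ?h = "\<lambda>r. \<Sum>m\<in>Mon n d. c m * monomial_val m (jet (poly F) r)"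
      have "(\<lambda>v. \<Sum>m\<in>Mon n d. c m * monomial_val m v) \<in> jet_polys"
        by (intro jet_polys_sum jet_polys.mult jet_polys.const monomial_val_in_jet_polys)
      from jet_poly_of_poly[OF this] obtain g where g: "\<And>r. ?h r = poly g r" by blast
      have derivs: "poly ((pderiv ^^ j) g) r = (\<Sum>m\<in>Mon n d. c m * B j m (jet (poly F) r))" for j r
      proof (induction j arbitrary: r)
        case 0
        then show ?case using g by (simp add: B_def)
      next
        case (Suc j)
        have "((\<lambda>r. \<Sum>m\<in>Mon n d. c m * B j m (jet (poly F) r)) has_real_derivative
          (\<Sum>m\<in>Mon n d. c m * B (Suc j) m (jet (poly F) r))) (at r)"
          using has_derivative_along_jet[OF B smooth_on_poly[of F UNIV]]
          unfolding B_def by (auto intro!: DERIV_sum DERIV_cmult)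
        then have "((\<lambda>r. poly ((pderiv ^^ j) g) r) has_real_derivative
          (\<Sum>m\<in>Mon n d. c m * B (Suc j) m (jet (poly F) r))) (at r)"
          by (simp only: Suc.IH)
        from DERIV_unique[OF poly_DERIV this] show ?case by simp
      qed
      have "v i = jet (poly F) r\<^sub>0 i" if "i < K" for i
        using F(1) \<open>v \<in> W\<close> that by (cases i) (auto simp: jet_def W_def higher_deriv_poly)
      then have "a m (jet (poly F) r\<^sub>0) = c m" if "m \<in> Mon n d" for m
        unfolding c_def using K[OF that] by metis
      moreover have "jet (poly F) r\<^sub>0 \<in> W"
        by (simp add: W_def jet_def)
      ultimately have "poly ((pderiv ^^ j) g) r\<^sub>0 = 0" for j
        unfolding derivs using a(5) by (metis (no_types, lifting) sum.cong)
      then have "g = 0" by (rule poly_eq_0_if_derivs_vanish)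
      moreover have "monomial_val m w = monomial_val m (jet (poly F) (w 0))" if "m \<in> Mon n d" for m
      proof (rule monomial_val_cong)
        fix i assume "i \<in> Poly_Mapping.keys m"
        then have "i < n + 2" using that by (auto simp: Mon_def)
        then show "w i = jet (poly F) (w 0) i"
          using F(2) by (cases i) (auto simp: jet_def higher_deriv_poly)
      qed
      ultimately show ?thesis using g[of "w 0"] by simp
    qed
    then have "c m0 = 0"
      using monomials_lin_indep[OF fin, of n d "n + 2" r\<^sub>0 c m0] a(2) by (auto simp: Mon_def)
    with a(4) show False by (simp add: c_def)
  qed
  then have "countable (\<Union>n d. S n d)" by blast
  moreover have "{x. differentially_algebraic_on (f x) U} \<subseteq> (\<Union>n d. S n d)"
  proof
    fix x assume "x \<in> {x. differentially_algebraic_on (f x) U}"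
    then obtain n Q where Q: "Q \<noteq> 0" "poly_vars Q \<subseteq> {..<n + 2}"
      "\<forall>r\<in>U. poly_eval Q (jet (f x) r) = 0"
      unfolding differentially_algebraic_on_def jet_def by blast
    define d where "d = Max (insert 0 (\<Union>m\<in>Poly_Mapping.keys Q.
      Poly_Mapping.lookup m ` Poly_Mapping.keys m))"
    have "Poly_Mapping.lookup m i \<le> d" if "m \<in> Poly_Mapping.keys Q" for m i
    proof (cases "i \<in> Poly_Mapping.keys m")
      case True
      then show ?thesis unfolding d_def using that by (intro Max_ge) auto
    qed (simp add: in_keys_iff)
    then have sub: "Poly_Mapping.keys Q \<subseteq> Mon n d"
      using Q(2) by (auto simp: Mon_def poly_vars_def)
    have "(\<Sum>m\<in>Mon n d. Poly_Mapping.lookup Q m * monomial_val m v) = poly_eval Q v" for v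
      unfolding poly_eval_def monomial_val_def[symmetric]
      by (rule sum.mono_neutral_right[OF fin sub]) (auto simp: in_keys_iff)
    then have "(\<Sum>m\<in>Mon n d. Poly_Mapping.lookup Q m * B j m (J x)) = 0" for j
      unfolding B_def J_def using Q(3)
      by (intro relation_differentiated[OF U(1) smooth monomial_val_in_jet_polys _ U(2)]) auto
    moreover have "\<exists>m\<in>Mon n d. Poly_Mapping.lookup Q m \<noteq> 0"
      using Q(1) sub by (metis in_keys_iff keys_eq_empty subset_eq ex_in_conv)
    ultimately show "x \<in> (\<Union>n d. S n d)"
      unfolding S_def by blast
  qed
  ultimately show ?thesis by (rule countable_subset[rotated])
qed

section \<open>The roots of the transcendental equation\<close>

definition cspeed :: "real \<Rightarrow> complex \<Rightarrow> complex" where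
  "cspeed r z = of_real r * exp z - z"

lemma cspeed_holomorphic [holomorphic_intros]: "cspeed r holomorphic_on A"
  unfolding cspeed_def[abs_def] by (intro holomorphic_intros)

lemma cspeed_derivative: "(cspeed r has_field_derivative of_real r * exp z - 1) (at z)"
  unfolding cspeed_def[abs_def] by (auto intro!: derivative_eq_intros)

lemma continuous_cspeed: "continuous_on A (cspeed r)"
  unfolding cspeed_def[abs_def] by (intro continuous_intros)

lemma open_cspeed_nonzero: "open {z. cspeed r z \<noteq> 0}"
proof -
  have "closed {z. cspeed r z = 0}"
    using continuous_closed_preimage_constant[of UNIV "cspeed r" 0] continuous_cspeed[of UNIV r] by simp
  moreover have "{z. cspeed r z \<noteq> 0} = - {z. cspeed r z = 0}" by auto
  ultimately show ?thesis by (simp add: open_Compl)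
qed

text \<open>
The roots of \<open>r * exp z = z\<close> are the solutions of \<open>z * exp (- z) = r\<close>. After \<open>z = 1 / w\<close> the
left-hand side has an essential singularity at \<open>w = 0\<close>.
\<close>

lemma infinite_cspeed_roots:
  assumes "r \<noteq> 0"
  shows "infinite {z. cspeed r z = 0}"
proof -
  define f :: "complex \<Rightarrow> complex" where "f z = inverse z * exp (- inverse z)" for z
  have hol: "f holomorphic_on (UNIV - {0})"
    unfolding f_def by (intro holomorphic_intros) auto
  have no_limit: "\<not> (g \<longlongrightarrow> l) (at 0)"
    if g: "\<And>n. norm (g (of_real (e * inverse (real (Suc n))))) \<ge> real (Suc n) / 2"
    and e: "\<bar>e\<bar> = 1" for g :: "complex \<Rightarrow> complex" and e l
  proof
    assume "(g \<longlongrightarrow> l) (at 0)"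
    have "(\<lambda>n. complex_of_real (e * inverse (real (Suc n)))) \<longlonglongrightarrow> of_real (e * 0)"
      by (intro tendsto_of_real tendsto_mult tendsto_const LIMSEQ_inverse_real_of_nat)
    then have "filterlim (\<lambda>n. complex_of_real (e * inverse (real (Suc n)))) (at 0) sequentially"
      using e by (auto simp: filterlim_at simp del: of_nat_Suc)
    from filterlim_compose[OF \<open>(g \<longlongrightarrow> l) (at 0)\<close> this]
    have "(\<lambda>n. norm (g (of_real (e * inverse (real (Suc n)))))) \<longlonglongrightarrow> norm l"
      by (rule tendsto_norm)
    moreover have "filterlim (\<lambda>n. real (Suc n) * (1/2)) at_top sequentially"
      by (intro filterlim_at_top_mult_tendsto_pos[OF tendsto_const] 
          filterlim_compose[OF filterlim_real_sequentially filterlim_Suc]) auto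
    then have "filterlim (\<lambda>n. norm (g (of_real (e * inverse (real (Suc n)))))) at_top sequentially"
      by (rule filterlim_at_top_mono) (use g in \<open>auto intro!: always_eventually simp: field_simps\<close>)
    ultimately show False
      using not_tendsto_and_filterlim_at_infinity[of sequentially]
        filterlim_at_top_imp_at_infinity by (metis trivial_limit_sequentially)
  qed
  have "\<not> (f \<longlongrightarrow> l) (at 0)" for l
  proof (rule no_limit[of _ "-1"])
    fix n
    have "norm (f (of_real (- 1 * inverse (real (Suc n))))) = real (Suc n) * exp (real (Suc n))"
      unfolding f_def by (simp add: norm_mult norm_inverse del: of_nat_Suc)
    also have "\<dots> \<ge> real (Suc n) * 1"
      by (intro mult_left_mono) auto
    finally show "norm (f (of_real (- 1 * inverse (real (Suc n))))) \<ge> real (Suc n) / 2"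
      by simp
  qed simp
  moreover have "\<not> ((inverse \<circ> f) \<longlongrightarrow> l) (at 0)" for l
  proof (rule no_limit[of _ 1])
    fix n
    let ?x = "real (Suc n)"
    have "norm ((inverse \<circ> f) (of_real (1 * inverse ?x))) = exp ?x / ?x"
      unfolding f_def by (simp add: norm_mult norm_inverse norm_divide field_simps exp_minus del: of_nat_Suc)
    moreover have "?x * (?x / 2) \<le> exp ?x"
      using exp_lower_Taylor_quadratic[of ?x] by (simp add: power2_eq_square del: of_nat_Suc)
    ultimately show "norm ((inverse \<circ> f) (of_real (1 * inverse ?x))) \<ge> ?x / 2"
      by (simp add: pos_le_divide_eq mult.commute del: of_nat_Suc)
  qed simp
  ultimately obtain a where a: "\<And>w. w \<noteq> a \<Longrightarrow> infinite {x. x \<in> UNIV - {0} \<and> f x = w}"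
    using great_Picard_infinite[OF open_UNIV UNIV_I hol] by blast
  have "{x. x \<in> UNIV - {0} \<and> f x = 0} = {}"
    unfolding f_def by auto
  \<comment> \<open>The value 0 is the one that Picard's theorem excepts.\<close>
  then have "a = 0"
    using a[of 0] by (metis finite.emptyI)
  then have "infinite {x. x \<in> UNIV - {0} \<and> f x = of_real r}"
    using a assms by simp
  then have "infinite (inverse ` {x. x \<in> UNIV - {0} \<and> f x = of_real r})"
    by (subst finite_image_iff) (auto simp: inj_on_def)
  moreover have "inverse ` {x. x \<in> UNIV - {0} \<and> f x = of_real r} \<subseteq> {z. cspeed r z = 0}"
    by (auto simp: f_def cspeed_def exp_minus field_simps)
  ultimately show ?thesis using finite_subset by blast
qed

lemma cspeed_root_ne_1:
  assumes "r * exp 1 < 1" "cspeed r z = 0"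
  shows "z \<noteq> 1"
proof
  assume "z = 1"
  then have "complex_of_real (r * exp 1) = of_real 1"
    using assms(2) by (simp add: cspeed_def exp_of_real[symmetric])
  then show False using assms(1) by (simp only: of_real_eq_iff)
qed

section \<open>Residues of the integrands\<close>

lemma residue_derivative:
  assumes "open S" "z \<in> S" "\<And>w. w \<in> S - {z} \<Longrightarrow> (h has_field_derivative h' w) (at w)"
  shows "residue h' z = 0"
proof -
  obtain e where e: "e > 0" "cball z e \<subseteq> S"
    using assms(1,2) open_contains_cball_eq by blast
  have op: "open (S - {z})" using assms(1) by blast
  have "h holomorphic_on (S - {z})"
    using assms(3) op by (auto simp: holomorphic_on_open)
  then have "deriv h holomorphic_on (S - {z})"
    using op by (rule holomorphic_deriv)
  then have "h' holomorphic_on (S - {z})"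
    by (rule holomorphic_transform) (use assms(3) in \<open>auto intro: DERIV_imp_deriv\<close>)
  from base_residue[OF assms(1,2) e(1) this e(2)]
  have "(h' has_contour_integral 2 * pi * \<i> * residue h' z) (circlepath z e)" .
  moreover have "(h' has_contour_integral 0) (circlepath z e)"
  proof (rule Cauchy_theorem_primitive[of "S - {z}" h])
    show "path_image (circlepath z e) \<subseteq> S - {z}"
      using e by (auto simp: sphere_def)
  qed (use assms(3) in \<open>auto intro: has_field_derivative_at_within\<close>)
  ultimately show ?thesis
    using has_contour_integral_unique by fastforce
qed

text \<open>
Let \<open>D\<close> have a simple zero at \<open>T\<close>. Integration by parts lowers the exponent in
\<open>s i * D' / D ^ (j + 1)\<close> by one and replaces \<open>s i\<close>, up to a constant factor, by its derivative
with respect to \<open>- D\<close>, which is \<open>s (i + 1)\<close>; at the end the pole is simple.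
\<close>

lemma residue_by_parts:
  fixes s :: "nat \<Rightarrow> complex \<Rightarrow> complex" and D D' :: "complex \<Rightarrow> complex"
  assumes S: "open S" "T \<in> S"
    and D: "\<And>z. z \<in> S \<Longrightarrow> (D has_field_derivative D' z) (at z)"
    and D0: "D T = 0" "D' T \<noteq> 0" "\<And>z. z \<in> S - {T} \<Longrightarrow> D z \<noteq> 0"
    and s: "\<And>i z. z \<in> S \<Longrightarrow> (s i has_field_derivative - (s (Suc i) z * D' z)) (at z)"
  shows "residue (\<lambda>z. s i z * D' z / D z ^ Suc j) T = (- 1) ^ j / fact j * s (i + j) T"
proof -
  have "D holomorphic_on S"
    using D S by (auto simp: holomorphic_on_open)
  moreover have "D' holomorphic_on S"
  proof (rule holomorphic_transform)
    show "deriv D holomorphic_on S" using \<open>D holomorphic_on S\<close> S by (intro holomorphic_deriv)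
  qed (use D in \<open>auto intro: DERIV_imp_deriv\<close>)
  moreover have "s i holomorphic_on S" for i
    using s S unfolding holomorphic_on_open[OF S(1)] by blast
  ultimately have hol: "D holomorphic_on A" "D' holomorphic_on A" "s i holomorphic_on A"
    if "A \<subseteq> S" for i A
    using that holomorphic_on_subset by blast+
  show ?thesis
  proof (induction j arbitrary: i)
    case 0
    show ?case
    proof (simp, rule residue_simple'[OF S])
      show "(\<lambda>z. s i z * D' z / D z) holomorphic_on S - {T}"
        using D0 hol[of "S - {T}"] by (intro holomorphic_intros) auto
      have "((\<lambda>z. D z / (z - T)) \<longlongrightarrow> D' T) (at T)"
        using D[OF S(2)] D0 by (simp add: has_field_derivative_iff)
      moreover have "isCont (s i) T" "isCont D' T"
        using hol[OF order_refl] S continuous_on_eq_continuous_at holomorphic_on_imp_continuous_on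
        by metis+
      ultimately have "((\<lambda>z. s i z * D' z / (D z / (z - T))) \<longlongrightarrow> s i T * D' T / D' T) (at T)"
        using D0 unfolding isCont_def by (intro tendsto_intros)
      then show "((\<lambda>z. s i z * D' z / D z * (z - T)) \<longlongrightarrow> s i T) (at T)"
        using D0 by (simp add: field_simps)
    qed
  next
    case (Suc j)
    let ?h = "\<lambda>z. - s i z / (of_nat (Suc j) * D z ^ Suc j)"
    let ?h' = "\<lambda>z. s i z * D' z / D z ^ Suc (Suc j) +
      1 / of_nat (Suc j) * (s (Suc i) z * D' z / D z ^ Suc j)"
    have "(?h has_field_derivative ?h' z) (at z)" if "z \<in> S - {T}" for z
      using that D0(3)[OF that] of_nat_neq_0[of j, where ?'a=complex]
      by (auto intro!: derivative_eq_intros D s simp del: of_nat_Suc power_Suc)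
        (simp add: field_simps power_Suc del: of_nat_Suc)
    then have "residue ?h' T = 0"
      by (rule residue_derivative[OF S])
    moreover have hol': "(\<lambda>z. s k z * D' z / D z ^ m) holomorphic_on S - {T}" for k m
      using D0 hol[of "S - {T}"] by (intro holomorphic_intros) auto
    have "residue ?h' T = residue (\<lambda>z. s i z * D' z / D z ^ Suc (Suc j)) T +
      1 / of_nat (Suc j) * residue (\<lambda>z. s (Suc i) z * D' z / D z ^ Suc j) T"
      by (subst residue_add[OF S hol'], intro holomorphic_intros hol', subst residue_lmul[OF S hol'], rule refl)
    ultimately have "residue (\<lambda>z. s i z * D' z / D z ^ Suc (Suc j)) T =
      - (1 / of_nat (Suc j) * ((- 1) ^ j / fact j * s (Suc i + j) T))"
      unfolding Suc.IH by (metis eq_neg_iff_add_eq_0)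
    then show ?case
      by (simp add: field_simps)
  qed
qed

definition integrand :: "real \<Rightarrow> nat \<Rightarrow> complex \<Rightarrow> complex" where
  "integrand r j z = exp (of_nat j * z) / cspeed r z ^ Suc j"

text \<open>
The functions \<open>s j = exp (j * z) * p j / (1 - z) ^ (2 * j + 1)\<close> that arise from
\<open>s 0 = 1 / (1 - z)\<close> by repeatedly applying \<open>exp z / (1 - z) * d/dz\<close> have these polynomials \<open>p j\<close>
as numerators.
\<close>

fun residue_poly :: "nat \<Rightarrow> complex poly" where
  "residue_poly 0 = 1"
| "residue_poly (Suc j) =
     (of_nat j * residue_poly j + pderiv (residue_poly j)) * [:1, -1:] + of_nat (2 * j + 1) * residue_poly j"

lemma residue_poly_1_nonzero: "poly (residue_poly j) 1 \<noteq> 0"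
proof (induction j)
  case (Suc j)
  have "of_nat (2 * j + 1) \<noteq> (0 :: complex)"
    by (simp only: of_nat_eq_0_iff)
  with Suc show ?case
    by (simp only: residue_poly.simps poly_add poly_mult poly_pCons of_nat_poly) simp
qed simp

text \<open>
With \<open>D = r - z * exp (- z) = exp (- z) * cspeed r z\<close> the integrand becomes
\<open>- D' / ((1 - z) * D ^ (j + 1))\<close>, to which integration by parts applies. At a root,
\<open>exp T = T / r\<close>, so the residue is a rational function of the root that does not depend on the
choice of the root.
\<close>

lemma residue_integrand:
  assumes r: "r * exp 1 < 1" "r \<noteq> 0" and T: "cspeed r T = 0"
  shows "residue (integrand r j) T =
    - ((- 1) ^ j / fact j) * ((T / of_real r) ^ j * poly (residue_poly j) T / (1 - T) ^ (2 * j + 1))"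
proof -
  define s where "s j z = exp (of_nat j * z) * poly (residue_poly j) z / (1 - z) ^ (2 * j + 1)" for j z
  define D where "D z = of_real r - z * exp (- z)" for z :: complex
  define D' where "D' z = (z - 1) * exp (- z)" for z :: complex
  have Dq: "D z = exp (- z) * cspeed r z" for z
    by (simp add: D_def cspeed_def exp_minus field_simps)
  have "T \<noteq> 1" using cspeed_root_ne_1 r T by blast
  have "(of_real r * exp 1 - 1 :: complex) \<noteq> 0"
    using cspeed_root_ne_1[OF r(1), of 1] by (auto simp: cspeed_def)
  then obtain e where e: "e > 0" "\<And>z. z \<in> ball T e - {T} \<Longrightarrow> cspeed r z \<noteq> 0"
    using isolated_zeros[OF cspeed_holomorphic open_UNIV connected_UNIV UNIV_I T UNIV_I, of 1]
    by (auto simp: cspeed_def)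
  define S where "S = ball T e - {1}"
  have S: "open S" "T \<in> S"
    using e \<open>T \<noteq> 1\<close> by (auto simp: S_def)
  have "residue (\<lambda>z. s 0 z * D' z / D z ^ Suc j) T = (- 1) ^ j / fact j * s (0 + j) T"
  proof (rule residue_by_parts[OF S])
    show "(D has_field_derivative D' z) (at z)" for z
      unfolding D_def[abs_def] D'_def by (auto intro!: derivative_eq_intros simp: algebra_simps)
    show "D T = 0" "D' T \<noteq> 0"
      using T \<open>T \<noteq> 1\<close> by (auto simp: Dq D'_def)
    show "D z \<noteq> 0" if "z \<in> S - {T}" for z
      using that e by (auto simp: Dq S_def)
    show "(s i has_field_derivative - (s (Suc i) z * D' z)) (at z)" if "z \<in> S" for i z
    proof -
      have z: "1 - z \<noteq> 0" using that by (auto simp: S_def)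
      define P where "P = poly (residue_poly i) z"
      define P' where "P' = poly (pderiv (residue_poly i)) z"
      define E where "E = exp (of_nat i * z)"
      define w where "w = 1 - z"
      have "w \<noteq> 0" using z by (simp add: w_def)
      have "(s i has_field_derivative
        ((E * of_nat i * P + E * P') * w ^ (2 * i + 1) + E * P * (of_nat (2 * i + 1) * w ^ (2 * i)))
          / (w ^ (2 * i + 1) * w ^ (2 * i + 1))) (at z)"
        unfolding s_def[abs_def]
        by (rule derivative_eq_intros poly_DERIV | use z in \<open>simp del: power_Suc of_nat_Suc add: E_def P_def P'_def w_def\<close>)+
      also have "((E * of_nat i * P + E * P') * w ^ (2 * i + 1) + E * P * (of_nat (2 * i + 1) * w ^ (2 * i)))
          / (w ^ (2 * i + 1) * w ^ (2 * i + 1)) =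
          E * ((of_nat i * P + P') * w + of_nat (2 * i + 1) * P) / w ^ (2 * i + 2)"
        using \<open>w \<noteq> 0\<close> by (simp add: field_simps power_add)
      also have "\<dots> = - (s (Suc i) z * D' z)"
      proof -
        define K where "K = (of_nat i * P + P') * w + of_nat (2 * i + 1) * P"
        have "s (Suc i) z = E * exp z * K / w ^ (2 * i + 3)"
          unfolding K_def s_def E_def P_def P'_def w_def
          by (simp add: of_nat_poly algebra_simps exp_add numeral_3_eq_3)
        moreover have "D' z = - w * exp (- z)"
          by (simp add: D'_def w_def algebra_simps)
        ultimately have "- (s (Suc i) z * D' z) = (exp z * exp (- z)) * (E * K / w ^ (2 * i + 2))"
          using \<open>w \<noteq> 0\<close> by (simp add: numeral_3_eq_3)
        also have "exp z * exp (- z) = 1"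
          by (simp flip: exp_add)
        finally show ?thesis unfolding K_def by simp
      qed
      finally show ?thesis .
    qed
  qed
  moreover have "residue (\<lambda>z. s 0 z * D' z / D z ^ Suc j) T = residue (\<lambda>z. - 1 * integrand r j z) T"
  proof (rule residue_cong)
    have "s 0 z * D' z / D z ^ Suc j = - 1 * integrand r j z" if "z \<in> S" for z
    proof -
      have "1 - z \<noteq> 0" using that by (auto simp: S_def)
      then have "s 0 z * D' z = - exp (- z)"
        by (simp add: s_def D'_def field_simps)
      moreover have "D z ^ Suc j = exp (- z) * exp (- (of_nat j * z)) * cspeed r z ^ Suc j"
        unfolding Dq by (simp add: power_mult_distrib exp_of_nat_mult[symmetric])
      ultimately have "s 0 z * D' z / D z ^ Suc j =
        (- exp (- z)) / (exp (- z) * exp (- (of_nat j * z)) * cspeed r z ^ Suc j)"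
        by (simp only:)
      also have "\<dots> = - 1 * integrand r j z"
        unfolding integrand_def by (simp add: exp_minus inverse_eq_divide del: power_Suc)
      finally show ?thesis .
    qed
    then show "\<forall>\<^sub>F z in at T. s 0 z * D' z / D z ^ Suc j = - 1 * integrand r j z"
      by (rule eventually_mono[OF eventually_at_in_open'[OF S]])
  qed simp
  moreover have "residue (\<lambda>z. - 1 * integrand r j z) T = - 1 * residue (integrand r j) T"
  proof (rule residue_lmul[OF S])
    show "integrand r j holomorphic_on S - {T}"
      unfolding integrand_def[abs_def] using e by (intro holomorphic_intros) (auto simp: S_def)
  qed
  moreover have "exp (of_nat j * T) = (T / of_real r) ^ j"
  proof -
    have "exp T = T / of_real r"
      using T r(2) by (simp add: cspeed_def field_simps)
    then show ?thesis by (simp add: exp_of_nat_mult)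
  qed
  ultimately show ?thesis
    by (simp add: s_def)
qed

text \<open>
Clearing denominators in the vanishing of the residues gives a polynomial that is zero at all
roots, hence identically. Evaluated at \<open>1\<close>, it retains only the term of the largest index present,
the one with the pole of highest order.
\<close>

lemma integrands_not_exact:
  assumes r: "r * exp 1 < 1" "r \<noteq> 0" and "finite J"
    and exact: "\<And>T. cspeed r T = 0 \<Longrightarrow> \<exists>S f. open S \<and> T \<in> S \<and>
      (\<forall>z\<in>S - {T}. cspeed r z \<noteq> 0 \<and> (f has_field_derivative (\<Sum>j\<in>J. c j * integrand r j z)) (at z))"
    and "j \<in> J"
  shows "c j = 0"
proof (rule ccontr)
  assume "c j \<noteq> 0"
  define N where "N = Max {j\<in>J. c j \<noteq> 0}"
  have "N \<in> {j\<in>J. c j \<noteq> 0}"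
    unfolding N_def using \<open>finite J\<close> \<open>j \<in> J\<close> \<open>c j \<noteq> 0\<close> by (intro Max_in) auto
  then have N: "N \<in> J" "c N \<noteq> 0" by auto
  have N_max: "i \<le> N" if "i \<in> J" "c i \<noteq> 0" for i
    unfolding N_def using \<open>finite J\<close> that by (intro Max_ge) auto
  define b where "b i = c i * (- ((- 1) ^ i / fact i) / of_real r ^ i)" for i
  define P where "P = (\<Sum>i\<in>{i\<in>J. c i \<noteq> 0}. smult (b i) (monom 1 i * residue_poly i * [:1, -1:] ^ (2 * (N - i))))"
  have "poly P T = 0" if T: "cspeed r T = 0" for T
  proof -
    obtain S f where S: "open S" "T \<in> S" and f: "\<And>z. z \<in> S - {T} \<Longrightarrow> cspeed r z \<noteq> 0"
      "\<And>z. z \<in> S - {T} \<Longrightarrow> (f has_field_derivative (\<Sum>j\<in>J. c j * integrand r j z)) (at z)"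
      using exact[OF T] by blast
    have hol: "integrand r i holomorphic_on S - {T}" for i
      unfolding integrand_def[abs_def] using f(1) by (intro holomorphic_intros) auto
    have "residue (\<lambda>z. \<Sum>i\<in>I. c i * integrand r i z) T = (\<Sum>i\<in>I. c i * residue (integrand r i) T)"
      if "finite I" for I
      using that
    proof (induction I rule: finite_induct)
      case (insert i I)
      have "residue (\<lambda>z. c i * integrand r i z + (\<Sum>i\<in>I. c i * integrand r i z)) T =
        residue (\<lambda>z. c i * integrand r i z) T + residue (\<lambda>z. \<Sum>i\<in>I. c i * integrand r i z) T"
        by (rule residue_add[OF S]) (intro holomorphic_intros hol)+
      then show ?case
        using insert by (simp add: residue_lmul[OF S hol])
    qed (simp add: residue_const)
    then have "(\<Sum>i\<in>J. c i * residue (integrand r i) T) = 0"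
      using residue_derivative[OF S f(2)] \<open>finite J\<close> by metis
    also have "(\<Sum>i\<in>J. c i * residue (integrand r i) T) =
      (\<Sum>i\<in>{i\<in>J. c i \<noteq> 0}. c i * residue (integrand r i) T)"
      using \<open>finite J\<close> by (intro sum.mono_neutral_right) auto
    finally have "(1 - T) ^ (2 * N + 1) * (\<Sum>i\<in>{i\<in>J. c i \<noteq> 0}. c i * residue (integrand r i) T) = 0"
      by simp
    moreover have "(1 - T) ^ (2 * N + 1) * (c i * residue (integrand r i) T) =
      poly (smult (b i) (monom 1 i * residue_poly i * [:1, -1:] ^ (2 * (N - i)))) T"
      if "i \<in> {i\<in>J. c i \<noteq> 0}" for i
    proof -
      have "i \<le> N" using N_max that by auto
      then have "2 * N + 1 = 2 * (N - i) + (2 * i + 1)" by simp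
      then have "(1 - T) ^ (2 * N + 1) = (1 - T) ^ (2 * (N - i)) * (1 - T) ^ (2 * i + 1)"
        by (simp only: power_add)
      moreover have "(1 - T) ^ (2 * i + 1) \<noteq> 0"
        using cspeed_root_ne_1[OF r(1) T] by simp
      moreover have "v * u * (c i * (- k * (t * p / u))) = v * (c i * (- k) * t * p)"
        if "u \<noteq> 0" for u v k t p :: complex
        using that by simp
      ultimately show ?thesis
        unfolding residue_integrand[OF r T] b_def
        by (simp add: poly_monom power_divide mult_ac)
    qed
    ultimately show ?thesis
      unfolding P_def poly_sum by (simp add: sum_distrib_left)
  qed
  then have "{z. cspeed r z = 0} \<subseteq> {z. poly P z = 0}" by auto
  then have "P = 0"
    using poly_roots_finite[of P] infinite_cspeed_roots[OF r(2)] finite_subset by blast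
  then have "0 = poly P 1" by simp
  also have "\<dots> = (\<Sum>i\<in>{i\<in>J. c i \<noteq> 0}. if i = N then b N * poly (residue_poly N) 1 else 0)"
    unfolding P_def poly_sum
  proof (intro sum.cong refl)
    fix i assume "i \<in> {i\<in>J. c i \<noteq> 0}"
    then have "i \<le> N" using N_max by auto
    then show "poly (smult (b i) (monom 1 i * residue_poly i * [:1, -1:] ^ (2 * (N - i)))) 1 =
      (if i = N then b N * poly (residue_poly N) 1 else 0)"
      by (auto simp: poly_monom)
  qed
  also have "\<dots> = b N * poly (residue_poly N) 1"
    using N \<open>finite J\<close> by simp
  finally show False
    using N residue_poly_1_nonzero[of N] r(2) by (simp add: b_def)
qed

section \<open>Algebraic independence of the primitives\<close>

text \<open>
The coefficient ring. It is closed under differentiation and contains the integrands, and its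
elements are holomorphic off the roots and at worst meromorphic at them. The last point is what
excludes essential singularities in the residue argument.
\<close>

definition merom :: "real \<Rightarrow> (complex \<Rightarrow> complex) set" where
  "merom r = {a. \<exists>L h. h holomorphic_on UNIV \<and> (\<forall>z. cspeed r z \<noteq> 0 \<longrightarrow> a z = h z / cspeed r z ^ L)}"

lemma meromI:
  "h holomorphic_on UNIV \<Longrightarrow> (\<And>z. cspeed r z \<noteq> 0 \<Longrightarrow> a z = h z / cspeed r z ^ L) \<Longrightarrow> a \<in> merom r"
  unfolding merom_def by blast

lemma meromE:
  assumes "a \<in> merom r"
  obtains L h where "h holomorphic_on UNIV" "\<And>z. cspeed r z \<noteq> 0 \<Longrightarrow> a z = h z / cspeed r z ^ L"
  using assms unfolding merom_def by blast

lemma merom_entire: "h holomorphic_on UNIV \<Longrightarrow> h \<in> merom r"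
  by (rule meromI[of h _ _ 0]) auto

lemma merom_integrand: "integrand r j \<in> merom r"
  unfolding integrand_def
  by (rule meromI[of "\<lambda>z. exp (of_nat j * z)" _ _ "Suc j"]) (auto intro!: holomorphic_intros)

lemma merom_inverse: "(\<lambda>z. inverse (cspeed r z)) \<in> merom r"
  by (rule meromI[of "\<lambda>_. 1" _ _ 1]) (auto simp: field_simps)

lemma merom_add:
  assumes "a \<in> merom r" "b \<in> merom r"
  shows "(\<lambda>z. a z + b z) \<in> merom r"
proof -
  obtain K g where g: "g holomorphic_on UNIV" "\<And>z. cspeed r z \<noteq> 0 \<Longrightarrow> a z = g z / cspeed r z ^ K"
    by (rule meromE[OF assms(1)]) blast
  obtain L h where h: "h holomorphic_on UNIV" "\<And>z. cspeed r z \<noteq> 0 \<Longrightarrow> b z = h z / cspeed r z ^ L"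
    by (rule meromE[OF assms(2)]) blast
  show ?thesis
    by (rule meromI[of "\<lambda>z. g z * cspeed r z ^ L + h z * cspeed r z ^ K" _ _ "K + L"])
      (use g(1) h(1) in \<open>auto intro!: holomorphic_intros simp: g(2) h(2) field_simps power_add\<close>)
qed

lemma merom_mult:
  assumes "a \<in> merom r" "b \<in> merom r"
  shows "(\<lambda>z. a z * b z) \<in> merom r"
proof -
  obtain K g where g: "g holomorphic_on UNIV" "\<And>z. cspeed r z \<noteq> 0 \<Longrightarrow> a z = g z / cspeed r z ^ K"
    by (rule meromE[OF assms(1)]) blast
  obtain L h where h: "h holomorphic_on UNIV" "\<And>z. cspeed r z \<noteq> 0 \<Longrightarrow> b z = h z / cspeed r z ^ L"
    by (rule meromE[OF assms(2)]) blast
  show ?thesis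
    by (rule meromI[of "\<lambda>z. g z * h z" _ _ "K + L"])
      (use g(1) h(1) in \<open>auto intro!: holomorphic_intros simp: g(2) h(2) field_simps power_add\<close>)
qed

lemma merom_const: "(\<lambda>_. c) \<in> merom r"
  by (rule merom_entire) (rule holomorphic_intros)

lemma merom_uminus: "a \<in> merom r \<Longrightarrow> (\<lambda>z. - a z) \<in> merom r"
  using merom_mult[OF merom_const[of "-1"], of a] by simp

lemma merom_diff: "a \<in> merom r \<Longrightarrow> b \<in> merom r \<Longrightarrow> (\<lambda>z. a z - b z) \<in> merom r"
  using merom_add[of a r "\<lambda>z. - b z"] merom_uminus by simp

lemma merom_sum:
  "(\<And>m. m \<in> M \<Longrightarrow> a m \<in> merom r) \<Longrightarrow> (\<lambda>v. \<Sum>m\<in>M. a m v) \<in> merom r"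
  by (induction M rule: infinite_finite_induct) (auto intro: merom_add merom_const)

lemma merom_holomorphic:
  assumes "a \<in> merom r" "\<And>z. z \<in> A \<Longrightarrow> cspeed r z \<noteq> 0"
  shows "a holomorphic_on A"
proof -
  obtain L h where h: "h holomorphic_on UNIV" "\<And>z. cspeed r z \<noteq> 0 \<Longrightarrow> a z = h z / cspeed r z ^ L"
    by (rule meromE[OF assms(1)]) blast
  have "(\<lambda>z. h z / cspeed r z ^ L) holomorphic_on A"
    using assms h by (intro holomorphic_intros holomorphic_on_subset[OF h(1)]) auto
  then show ?thesis
    by (rule holomorphic_transform) (use assms h in auto)
qed

lemma merom_has_derivative:
  assumes "a \<in> merom r" "cspeed r z \<noteq> 0"
  shows "(a has_field_derivative deriv a z) (at z)"
  using merom_holomorphic[OF assms(1), of "{z. cspeed r z \<noteq> 0}"] open_cspeed_nonzero[of r] assms(2)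
  by (intro holomorphic_derivI[of _ "{z. cspeed r z \<noteq> 0}"]) auto

lemma merom_deriv:
  assumes "a \<in> merom r"
  shows "deriv a \<in> merom r"
proof -
  obtain L h where h: "h holomorphic_on UNIV" "\<And>z. cspeed r z \<noteq> 0 \<Longrightarrow> a z = h z / cspeed r z ^ L"
    by (rule meromE[OF assms(1)]) blast
  show ?thesis
  proof (rule meromI[of "\<lambda>z. deriv h z * cspeed r z - h z * of_nat L * (of_real r * exp z - 1)" _ _ "Suc L"])
    show "(\<lambda>z. deriv h z * cspeed r z - h z * of_nat L * (of_real r * exp z - 1)) holomorphic_on UNIV"
      using h(1) by (intro holomorphic_intros holomorphic_deriv) auto
    fix z assume z: "cspeed r z \<noteq> 0"
    have "(h has_field_derivative deriv h z) (at z)"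
      using h(1) by (intro holomorphic_derivI[of _ UNIV]) auto
    then have "((\<lambda>z. h z / cspeed r z ^ L) has_field_derivative
      (deriv h z * cspeed r z ^ L - h z * (of_nat L * (of_real r * exp z - 1) * cspeed r z ^ (L - 1))) /
        (cspeed r z ^ L * cspeed r z ^ L)) (at z)"
      using z by (auto intro!: derivative_eq_intros cspeed_derivative simp: mult_ac)
    then have "(a has_field_derivative
      (deriv h z * cspeed r z ^ L - h z * (of_nat L * (of_real r * exp z - 1) * cspeed r z ^ (L - 1))) /
        (cspeed r z ^ L * cspeed r z ^ L)) (at z)"
      by (rule has_field_derivative_transform_within_open[OF _ open_cspeed_nonzero[of r]])
        (use h z in auto)
    then have "deriv a z = (deriv h z * cspeed r z ^ L - h z * (of_nat L * (of_real r * exp z - 1) * cspeed r z ^ (L - 1))) /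
        (cspeed r z ^ L * cspeed r z ^ L)"
      by (rule DERIV_imp_deriv)
    also have "\<dots> = (deriv h z * cspeed r z - h z * of_nat L * (of_real r * exp z - 1)) / cspeed r z ^ Suc L"
      using z by (cases L) (auto simp: field_simps)
    finally show "deriv a z = \<dots>" .
  qed
qed

lemma merom_eq_0_if_locally_0:
  assumes "a \<in> merom r" "open V" "V \<noteq> {}" "\<And>z. z \<in> V \<Longrightarrow> cspeed r z \<noteq> 0" "\<And>z. z \<in> V \<Longrightarrow> a z = 0"
    and "cspeed r z \<noteq> 0"
  shows "a z = 0"
proof -
  obtain L h where h: "h holomorphic_on UNIV" "\<And>z. cspeed r z \<noteq> 0 \<Longrightarrow> a z = h z / cspeed r z ^ L"
    by (rule meromE[OF assms(1)]) blast
  have "h w = 0" if "w \<in> V" for w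
    using assms(4,5)[OF that] h(2)[of w] by simp
  then have "h z = 0"
    using analytic_continuation_open[of V UNIV h "\<lambda>_. 0" z] assms(2,3) h(1) by auto
  then show ?thesis using h(2) assms(6) by simp
qed

lemma merom_nonzero_near:
  assumes "a \<in> merom r" "cspeed r z1 \<noteq> 0" "a z1 \<noteq> 0"
  shows "\<exists>S. open S \<and> T \<in> S \<and> (\<forall>z\<in>S - {T}. cspeed r z \<noteq> 0 \<and> a z \<noteq> 0)"
proof -
  obtain L h where h: "h holomorphic_on UNIV" "\<And>z. cspeed r z \<noteq> 0 \<Longrightarrow> a z = h z / cspeed r z ^ L"
    by (rule meromE[OF assms(1)]) blast
  have "\<forall>\<^sub>F z in at T. h z \<noteq> 0 \<and> z \<in> UNIV"
    using assms h(2)[of z1] by (intro non_zero_neighbour_alt[OF h(1), of _ z1]) auto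
  moreover have "\<forall>\<^sub>F z in at T. cspeed r z \<noteq> 0 \<and> z \<in> UNIV"
    using assms by (intro non_zero_neighbour_alt[of _ _ _ z1] cspeed_holomorphic) auto
  ultimately have "\<forall>\<^sub>F z in at T. cspeed r z \<noteq> 0 \<and> a z \<noteq> 0"
    by eventually_elim (simp add: h(2))
  then show ?thesis
    unfolding eventually_at_topological by blast
qed

text \<open>
A quotient with zero derivative is constant near a point, and hence wherever it is defined, by
analytic continuation of the entire numerators.
\<close>

lemma merom_proportional:
  assumes a: "a \<in> merom r" and b: "b \<in> merom r" and z1: "cspeed r z1 \<noteq> 0" "b z1 \<noteq> 0"
    and eq: "\<And>z. cspeed r z \<noteq> 0 \<Longrightarrow> b z * deriv a z = deriv b z * a z"
  shows "\<exists>c. \<forall>z. cspeed r z \<noteq> 0 \<longrightarrow> a z = c * b z"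
proof -
  obtain S where S: "open S" "z1 \<in> S" "\<And>z. z \<in> S - {z1} \<Longrightarrow> cspeed r z \<noteq> 0 \<and> b z \<noteq> 0"
    using merom_nonzero_near[OF b z1, of z1] by blast
  then obtain e where e: "e > 0" "ball z1 e \<subseteq> S"
    using open_contains_ball_eq by blast
  have nz: "cspeed r z \<noteq> 0" "b z \<noteq> 0" if "z \<in> ball z1 e" for z
    using S(3) e z1 that by (cases "z = z1"; blast)+
  have "\<exists>c. \<forall>z\<in>ball z1 e. a z / b z = c"
  proof (rule has_field_derivative_zero_constant)
    fix z assume z: "z \<in> ball z1 e"
    have "((\<lambda>z. a z / b z) has_field_derivative (deriv a z * b z - a z * deriv b z) / (b z * b z)) (at z)"
      using nz[OF z] a b by (intro DERIV_divide merom_has_derivative) auto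
    also have "deriv a z * b z - a z * deriv b z = 0"
      using eq[of z] nz[OF z] by (simp add: mult.commute)
    finally show "((\<lambda>z. a z / b z) has_field_derivative 0) (at z within ball z1 e)"
      by (simp add: has_field_derivative_at_within)
  qed simp
  then obtain c where c: "\<And>z. z \<in> ball z1 e \<Longrightarrow> a z / b z = c" by blast
  have "a z - c * b z = 0" if "cspeed r z \<noteq> 0" for z
  proof (rule merom_eq_0_if_locally_0[of "\<lambda>z. a z - c * b z" r "ball z1 e"])
    show "(\<lambda>z. a z - c * b z) \<in> merom r"
      by (intro merom_diff merom_mult merom_const a b)
    show "a w - c * b w = 0" if "w \<in> ball z1 e" for w
      using c[OF that] nz[OF that] by (auto simp: field_simps)
  qed (use e nz that in auto)
  then show ?thesis by (intro exI[of _ c]) auto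
qed

text \<open>
Exponent vectors are multisets here: multiplication by a variable and division by it are then
\<open>add_mset\<close> and \<open>-\<close>, and induction over multisets proves the product rule.
\<close>

definition mset_monomial :: "(nat \<Rightarrow> 'a) \<Rightarrow> nat multiset \<Rightarrow> 'a::comm_semiring_1" where
  "mset_monomial w m = prod_mset (image_mset w m)"

lemma mset_monomial_simps [simp]:
  "mset_monomial w {#} = 1"
  "mset_monomial w (add_mset i m) = w i * mset_monomial w m"
  "mset_monomial w (m + n) = mset_monomial w m * mset_monomial w n"
  by (simp_all add: mset_monomial_def)

lemma mset_monomial_derivative:
  fixes \<Phi> :: "nat \<Rightarrow> complex \<Rightarrow> complex"
  assumes "\<And>i. (\<Phi> i has_field_derivative g i) (at z)"
  shows "((\<lambda>z. mset_monomial (\<lambda>i. \<Phi> i z) m) has_field_derivative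
    (\<Sum>i\<in>set_mset m. of_nat (count m i) * g i * mset_monomial (\<lambda>i. \<Phi> i z) (m - {#i#}))) (at z)"
proof (induction m)
  case (add j m)
  define v where "v = mset_monomial (\<lambda>i. \<Phi> i z)"
  have v_add: "v (add_mset i n) = \<Phi> i z * v n" for i n
    by (simp add: v_def)
  let ?t = "\<lambda>m i. of_nat (count m i) * g i * v (m - {#i#})"
  have t: "?t (add_mset j m) i = (if i = j then g j * v m else 0) + \<Phi> j z * ?t m i" for i
  proof (cases "i \<in># m")
    case True
    show ?thesis
    proof (cases "i = j")
      case True
      have "v m = \<Phi> j z * v (m - {#j#})"
        using \<open>i \<in># m\<close> True by (metis v_add insert_DiffM)
      then show ?thesis using True by (simp add: algebra_simps)
    next
      case False
      then have "add_mset j m - {#i#} = add_mset j (m - {#i#})"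
        by (simp add: diff_add_mset_swap)
      then show ?thesis using False by (simp add: v_add)
    qed
  next
    case False
    then show ?thesis by (auto simp: not_in_iff)
  qed
  have "(\<Sum>i\<in>set_mset m. ?t m i) = (\<Sum>i\<in>insert j (set_mset m). ?t m i)"
    by (rule sum.mono_neutral_left) (auto simp: not_in_iff)
  then have "(\<Sum>i\<in>set_mset (add_mset j m). ?t (add_mset j m) i) =
    g j * v m + \<Phi> j z * (\<Sum>i\<in>set_mset m. ?t m i)"
    unfolding t by (simp add: sum.distrib sum_distrib_left del: sum.insert)
      (simp add: insert_absorb)?
  moreover have "((\<lambda>z. \<Phi> j z * mset_monomial (\<lambda>i. \<Phi> i z) m) has_field_derivative
    g j * v m + (\<Sum>i\<in>set_mset m. ?t m i) * \<Phi> j z) (at z)"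
    using DERIV_mult[OF assms[of j] add.IH] by (simp add: v_def)
  ultimately show ?case
    by (simp add: v_def mult.commute)
qed simp

text \<open>
The part of the derivative of \<open>\<Sum>m. a m * v m\<close> that comes from the monomials, sorted by monomials
again: \<open>v m\<close> receives a contribution from the coefficient of each \<open>add_mset i m\<close>.
\<close>

lemma sum_derivative_reindex:
  fixes a :: "nat multiset \<Rightarrow> 'a::comm_semiring_1" and v :: "nat multiset \<Rightarrow> 'a" and g :: "nat \<Rightarrow> 'a"
  assumes "finite M" "finite I" "\<And>m. m \<in> M \<Longrightarrow> set_mset m \<subseteq> I"
  defines "M' \<equiv> M \<union> (\<lambda>(m, i). m - {#i#}) ` (M \<times> I)"
  shows "(\<Sum>m\<in>M. a m * (\<Sum>i\<in>set_mset m. of_nat (count m i) * g i * v (m - {#i#}))) =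
    (\<Sum>m\<in>M'. (\<Sum>i\<in>I. of_nat (count m i + 1) * g i * (if add_mset i m \<in> M then a (add_mset i m) else 0)) * v m)"
proof -
  have fin: "finite M'" unfolding M'_def using assms(1,2) by simp
  have "(\<Sum>m\<in>M. a m * (\<Sum>i\<in>set_mset m. of_nat (count m i) * g i * v (m - {#i#}))) =
    (\<Sum>m\<in>M. \<Sum>i\<in>I. a m * (of_nat (count m i) * g i * v (m - {#i#})))"
  proof (intro sum.cong refl)
    fix m assume "m \<in> M"
    then have "(\<Sum>i\<in>set_mset m. of_nat (count m i) * g i * v (m - {#i#})) =
      (\<Sum>i\<in>I. of_nat (count m i) * g i * v (m - {#i#}))"
      using assms(2,3) by (intro sum.mono_neutral_left) (auto simp: not_in_iff)
    then show "a m * (\<Sum>i\<in>set_mset m. of_nat (count m i) * g i * v (m - {#i#})) =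
      (\<Sum>i\<in>I. a m * (of_nat (count m i) * g i * v (m - {#i#})))"
      by (simp add: sum_distrib_left)
  qed
  also have "\<dots> = (\<Sum>i\<in>I. \<Sum>m\<in>M. a m * (of_nat (count m i) * g i * v (m - {#i#})))"
    by (rule sum.swap)
  also have "\<dots> = (\<Sum>i\<in>I. \<Sum>m\<in>M'. of_nat (count m i + 1) * g i * (if add_mset i m \<in> M then a (add_mset i m) else 0) * v m)"
  proof (rule sum.cong[OF refl])
    fix i assume "i \<in> I"
    have "(\<Sum>m\<in>M. a m * (of_nat (count m i) * g i * v (m - {#i#}))) =
      (\<Sum>m\<in>{m\<in>M. i \<in># m}. a m * (of_nat (count m i) * g i * v (m - {#i#})))"
      using assms(1) by (intro sum.mono_neutral_right) (auto simp: not_in_iff)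
    also have "\<dots> = (\<Sum>m\<in>{m\<in>M'. add_mset i m \<in> M}. of_nat (count m i + 1) * g i * a (add_mset i m) * v m)"
    proof (rule sum.reindex_bij_witness[of _ "add_mset i" "\<lambda>m. m - {#i#}"])
      show "m - {#i#} \<in> {m\<in>M'. add_mset i m \<in> M}" if "m \<in> {m\<in>M. i \<in># m}" for m
        using that \<open>i \<in> I\<close> by (force simp: M'_def)
      show "of_nat (count (m - {#i#}) i + 1) * g i * a (add_mset i (m - {#i#})) * v (m - {#i#}) =
        a m * (of_nat (count m i) * g i * v (m - {#i#}))" if "m \<in> {m\<in>M. i \<in># m}" for m
      proof -
        have "count (m - {#i#}) i + 1 = count m i"
          using that by simp
        then show ?thesis using that by (simp add: mult_ac del: of_nat_add)
      qed
    qed auto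
    also have "\<dots> = (\<Sum>m\<in>M'. of_nat (count m i + 1) * g i * (if add_mset i m \<in> M then a (add_mset i m) else 0) * v m)"
      using fin by (intro sum.mono_neutral_cong_left) auto
    finally show "(\<Sum>m\<in>M. a m * (of_nat (count m i) * g i * v (m - {#i#}))) =
      (\<Sum>m\<in>M'. of_nat (count m i + 1) * g i * (if add_mset i m \<in> M then a (add_mset i m) else 0) * v m)" .
  qed
  also have "\<dots> = (\<Sum>m\<in>M'. (\<Sum>i\<in>I. of_nat (count m i + 1) * g i * (if add_mset i m \<in> M then a (add_mset i m) else 0)) * v m)"
    by (subst sum.swap) (simp add: sum_distrib_right)
  finally show ?thesis .
qed

text \<open>
Ostrowski's theorem for these primitives. The induction is on the total degree \<open>d\<close> and, inside, on
the number of terms of degree \<open>d\<close>. Let \<open>a m0\<close> be a nonzero coefficient of top degree. Multiply the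
derivative of the relation by \<open>a m0\<close> and subtract the relation times the derivative of \<open>a m0\<close>: the
term of \<open>m0\<close> cancels, so the new relation, with coefficients \<open>b m\<close>, is trivial by induction. In
top degree this says that all coefficients are constant multiples of \<open>a m0\<close>. In the next degree,
at a monomial \<open>m1\<close> with \<open>m0 = add_mset i0 m1\<close>, it says that the quotient of the coefficients of
\<open>m1\<close> and \<open>m0\<close> has as derivative a constant combination of the integrands, in which the integrand
of index \<open>i0\<close> occurs, contrary to \<open>integrands_not_exact\<close>.
\<close>

theorem primitives_alg_independent:
  fixes \<Phi> :: "nat \<Rightarrow> complex \<Rightarrow> complex"
  assumes r: "r * exp 1 < 1" "r \<noteq> 0"
    and V: "open V" "V \<noteq> {}" "\<And>z. z \<in> V \<Longrightarrow> cspeed r z \<noteq> 0"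
    and \<Phi>: "\<And>i z. z \<in> V \<Longrightarrow> (\<Phi> i has_field_derivative integrand r i z) (at z)"
    and "finite M" "\<And>m. m \<in> M \<Longrightarrow> a m \<in> merom r"
    and "\<And>z. z \<in> V \<Longrightarrow> (\<Sum>m\<in>M. a m z * mset_monomial (\<lambda>i. \<Phi> i z) m) = 0"
    and "m \<in> M" "cspeed r z \<noteq> 0"
  shows "a m z = 0"
proof -
  define rel where "rel M a \<longleftrightarrow> finite M \<and> (\<forall>m\<in>M. a m \<in> merom r) \<and>
    (\<forall>z\<in>V. (\<Sum>m\<in>M. a m z * mset_monomial (\<lambda>i. \<Phi> i z) m) = 0)" for M a
  have "\<forall>m\<in>M. \<forall>z. cspeed r z \<noteq> 0 \<longrightarrow> a m z = 0" if "rel M a" "\<forall>m\<in>M. size m < d" for M a d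
    using that
  proof (induction d arbitrary: M a)
    case (Suc d)
    note deg_IH = Suc.IH
    show ?case
      using Suc.prems
    proof (induction "card {m\<in>M. size m = d}" arbitrary: M a)
      case 0
      have "finite {m\<in>M. size m = d}"
        using 0(2) by (simp add: rel_def)
      then have "\<forall>m\<in>M. size m \<noteq> d" using 0(1) by auto
      then have "\<forall>m\<in>M. size m < d" using 0(3) by (auto simp: less_Suc_eq)
      then show ?case using deg_IH 0(2) by blast
    next
      case (Suc n)
      note IH = Suc.hyps(1)
      have fin: "finite M" and a: "\<And>m. m \<in> M \<Longrightarrow> a m \<in> merom r"
        and rel: "\<And>z. z \<in> V \<Longrightarrow> (\<Sum>m\<in>M. a m z * mset_monomial (\<lambda>i. \<Phi> i z) m) = 0"
        using Suc.prems(1) by (auto simp: rel_def)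
      have "{m\<in>M. size m = d} \<noteq> {}"
        using Suc.hyps(2) by (metis card.empty nat.distinct(1))
      then obtain m0 where m0: "m0 \<in> M" "size m0 = d" by blast
      have card: "n = card ({m\<in>M. size m = d} - {m0})"
        using Suc.hyps(2) m0 fin by simp
      show ?case
      proof (cases "\<forall>z. cspeed r z \<noteq> 0 \<longrightarrow> a m0 z = 0")
        case True
        have "(\<Sum>m\<in>M - {m0}. a m z * mset_monomial (\<lambda>i. \<Phi> i z) m) = 0" if "z \<in> V" for z
          using rel[OF that] True V(3)[OF that] m0 fin by (simp add: sum.remove)
        then have "rel (M - {m0}) a"
          unfolding rel_def using fin a by auto
        moreover have "{m\<in>M - {m0}. size m = d} = {m\<in>M. size m = d} - {m0}" by auto
        ultimately have "\<forall>m\<in>M - {m0}. \<forall>z. cspeed r z \<noteq> 0 \<longrightarrow> a m z = 0"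
          using IH[of "M - {m0}" a] card Suc.prems(2) by simp
        with True show ?thesis by blast
      next
        case False
        then obtain z1 where z1: "cspeed r z1 \<noteq> 0" "a m0 z1 \<noteq> 0" by blast
        define I where "I = (\<Union>m\<in>M. set_mset m)"
        have I: "finite I" "\<And>m. m \<in> M \<Longrightarrow> set_mset m \<subseteq> I"
          unfolding I_def using fin by auto
        define M' where "M' = M \<union> (\<lambda>(m, i). m - {#i#}) ` (M \<times> I)"
        have M': "finite M'" "M \<subseteq> M'"
          unfolding M'_def using fin I by auto
        define a' where "a' m = (if m \<in> M then a m else (\<lambda>_. 0))" for m
        have a': "a' m \<in> merom r" for m
          unfolding a'_def using a merom_const by auto
        define g where "g = integrand r"
        define S where "S m z = (\<Sum>i\<in>I. of_nat (count m i + 1) * g i z * a' (add_mset i m) z)" for m z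
        have S: "S m \<in> merom r" for m
          unfolding S_def[abs_def] g_def
          by (intro merom_sum merom_mult merom_const merom_integrand a')
        define b where "b m z = a m0 z * (deriv (a' m) z + S m z) - deriv (a m0) z * a' m z" for m z
        have b: "b m \<in> merom r" for m
          unfolding b_def[abs_def]
          by (intro merom_diff merom_mult merom_add merom_deriv a' a m0 S)
        have a'_top: "a' (add_mset i m) = (\<lambda>_. 0)" if "size m = d" for i m
          using Suc.prems(2) that by (auto simp: a'_def)
        have S_top: "S m z = 0" if "size m = d" for m z
          unfolding S_def using a'_top[OF that] by simp
        have b_m0: "b m0 z = 0" for z
          unfolding b_def using S_top[OF m0(2)] m0(1) by (simp add: a'_def)
        have "(\<Sum>m\<in>M'. b m z * mset_monomial (\<lambda>i. \<Phi> i z) m) = 0" if z: "z \<in> V" for z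
        proof -
          define v where "v = mset_monomial (\<lambda>i. \<Phi> i z)"
          have ext: "(\<Sum>m\<in>M'. f (a' m) * v m) = (\<Sum>m\<in>M. f (a m) * v m)" if "f (\<lambda>_. 0) = 0"
            for f :: "(complex \<Rightarrow> complex) \<Rightarrow> complex"
            using M' that by (intro sum.mono_neutral_cong_right) (auto simp: a'_def)
          let ?D = "\<lambda>m. \<Sum>i\<in>set_mset m. of_nat (count m i) * g i z * v (m - {#i#})"
          have "((\<lambda>z. \<Sum>m\<in>M. a m z * mset_monomial (\<lambda>i. \<Phi> i z) m) has_field_derivative
            (\<Sum>m\<in>M. deriv (a m) z * v m + ?D m * a m z)) (at z)"
            unfolding v_def g_def using V(3)[OF z] \<Phi>[OF z]
            by (intro DERIV_sum DERIV_mult merom_has_derivative mset_monomial_derivative) (auto intro: a)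
          moreover have "((\<lambda>z. \<Sum>m\<in>M. a m z * mset_monomial (\<lambda>i. \<Phi> i z) m) has_field_derivative 0) (at z)"
            by (rule has_field_derivative_transform_within_open[of "\<lambda>_. 0" _ _ V])
              (use rel V z in auto)
          ultimately have "(\<Sum>m\<in>M. deriv (a m) z * v m + ?D m * a m z) = 0"
            by (rule DERIV_unique)
          moreover have "(\<Sum>m\<in>M. a m z * ?D m) = (\<Sum>m\<in>M'. S m z * v m)"
            using sum_derivative_reindex[OF fin I, of "\<lambda>m. a m z" "\<lambda>i. g i z" v]
            unfolding M'_def[symmetric] S_def a'_def by (simp add: if_distrib[of "\<lambda>f. f z"])
          moreover have "(\<Sum>m\<in>M'. deriv (a' m) z * v m) = (\<Sum>m\<in>M. deriv (a m) z * v m)"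
            by (rule ext[of "\<lambda>f. deriv f z"]) simp
          moreover have "(\<Sum>m\<in>M'. a' m z * v m) = 0"
            using ext[of "\<lambda>f. f z"] rel[OF z] by (simp add: v_def)
          moreover have "(\<Sum>m\<in>M'. b m z * v m) = a m0 z * ((\<Sum>m\<in>M'. deriv (a' m) z * v m)
            + (\<Sum>m\<in>M'. S m z * v m)) - deriv (a m0) z * (\<Sum>m\<in>M'. a' m z * v m)"
            by (simp add: b_def algebra_simps sum.distrib sum_distrib_left sum_subtractf)
          ultimately show ?thesis
            by (simp add: v_def sum.distrib mult.commute)
        qed
        moreover have "(\<Sum>m\<in>M' - {m0}. b m z * mset_monomial (\<lambda>i. \<Phi> i z) m) =
          (\<Sum>m\<in>M'. b m z * mset_monomial (\<lambda>i. \<Phi> i z) m)" for z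
          using M' b_m0 by (intro sum.mono_neutral_left) auto
        ultimately have "rel (M' - {m0}) b"
          unfolding rel_def using M' b by auto
        moreover have "{m\<in>M' - {m0}. size m = d} = {m\<in>M. size m = d} - {m0}"
        proof -
          have "m - {#i#} \<in> M" if "m \<in> M" "size (m - {#i#}) = d" for m i
          proof (cases "i \<in># m")
            case True
            then have "size m = Suc d" using that(2) by (simp add: size_Suc_Diff1 flip: that(2))
            then show ?thesis using Suc.prems(2) that(1) by auto
          next
            case False
            then show ?thesis using that(1) by (simp add: diff_single_trivial)
          qed
          then show ?thesis unfolding M'_def by auto
        qed
        moreover have "\<forall>m\<in>M' - {m0}. size m < Suc d"
        proof -
          have "size (m - {#i#}) < Suc d" if "m \<in> M" for m i
          proof -
            have "size (m - {#i#}) \<le> size m" by (simp add: size_mset_mono)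
            then show ?thesis using Suc.prems(2) that by fastforce
          qed
          then show ?thesis unfolding M'_def using Suc.prems(2) by auto
        qed
        ultimately have b_0: "b m z = 0" if "m \<in> M'" "cspeed r z \<noteq> 0" for m z
          using IH[of "M' - {m0}" b] card that b_m0 by (cases "m = m0") auto
        show ?thesis
        proof (cases d)
          case 0
          then have "m = {#}" if "m \<in> M" for m
            using Suc.prems(2) that by auto
          then have "M = {{#}}" using m0(1) by auto
          then have "a m0 z = 0" if "z \<in> V" for z
            using rel[OF that] m0(1) by simp
          then have "a m0 z1 = 0"
            using merom_eq_0_if_locally_0[OF a[OF m0(1)] V] z1(1) by blast
          with z1 show ?thesis by simp
        next
          case (Suc d')
          have "\<exists>c. \<forall>z. cspeed r z \<noteq> 0 \<longrightarrow> a m z = c * a m0 z" if "m \<in> M" "size m = d" for m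
            using b_0[of m] S_top[OF that(2)] M' that
            by (intro merom_proportional[OF a[OF that(1)] a[OF m0(1)] z1])
              (auto simp: b_def a'_def)
          then obtain c where c: "\<And>m z. m \<in> M \<Longrightarrow> size m = d \<Longrightarrow> cspeed r z \<noteq> 0 \<Longrightarrow> a m z = c m * a m0 z"
            by metis
          have "c m0 = 1" using c[OF m0 z1(1)] z1(2) by simp
          obtain i0 where i0: "i0 \<in># m0"
            using m0(2) Suc by (metis multiset_nonemptyE size_empty nat.distinct(1))
          then have "i0 \<in> I" using I m0(1) by blast
          define m1 where "m1 = m0 - {#i0#}"
          have m1: "m1 \<in> M'" "size m1 = d'" "add_mset i0 m1 = m0"
            using m0 i0 Suc \<open>i0 \<in> I\<close> by (force simp: M'_def m1_def size_Diff_singleton)+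
          define k where "k i = - (of_nat (count m1 i + 1) * (if add_mset i m1 \<in> M then c (add_mset i m1) else 0))" for i
          have S_m1: "S m1 z = - (\<Sum>i\<in>I. k i * g i z) * a m0 z" if "cspeed r z \<noteq> 0" for z
          proof -
            have "of_nat (count m1 i + 1) * g i z * a' (add_mset i m1) z = - (k i * g i z) * a m0 z" for i
              using c[of "add_mset i m1" z] that m1(2) Suc by (simp add: k_def a'_def)
            then show ?thesis
              unfolding S_def by (simp add: sum_distrib_right sum_negf)
          qed
          have quot: "((\<lambda>z. a' m1 z / a m0 z) has_field_derivative (\<Sum>i\<in>I. k i * integrand r i z)) (at z)"
            if "cspeed r z \<noteq> 0" "a m0 z \<noteq> 0" for z
          proof -
            have "((\<lambda>z. a' m1 z / a m0 z) has_field_derivative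
              (deriv (a' m1) z * a m0 z - a' m1 z * deriv (a m0) z) / (a m0 z * a m0 z)) (at z)"
              using that by (intro DERIV_divide merom_has_derivative) (auto intro: a a' m0)
            also have "deriv (a' m1) z * a m0 z - a' m1 z * deriv (a m0) z =
              (\<Sum>i\<in>I. k i * integrand r i z) * (a m0 z * a m0 z)"
            proof -
              define K where "K = (\<Sum>i\<in>I. k i * integrand r i z)"
              have "a m0 z * (deriv (a' m1) z + - K * a m0 z) - deriv (a m0) z * a' m1 z = 0"
                using b_0[OF m1(1) that(1)] unfolding b_def S_m1[OF that(1)] g_def K_def .
              then show ?thesis
                unfolding K_def[symmetric] by (simp add: algebra_simps)
            qed
            finally show ?thesis using that(2) by simp
          qed
          have "k i0 = 0"
          proof (rule integrands_not_exact[OF r I(1) _ \<open>i0 \<in> I\<close>])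
            fix T assume "cspeed r T = 0"
            obtain S where "open S" "T \<in> S" "\<forall>z\<in>S - {T}. cspeed r z \<noteq> 0 \<and> a m0 z \<noteq> 0"
              using merom_nonzero_near[OF a[OF m0(1)] z1] by blast
            then show "\<exists>S f. open S \<and> T \<in> S \<and> (\<forall>z\<in>S - {T}. cspeed r z \<noteq> 0 \<and>
              (f has_field_derivative (\<Sum>j\<in>I. k j * integrand r j z)) (at z))"
              using quot by blast
          qed
          moreover have "k i0 \<noteq> 0"
          proof -
            have "k i0 = - of_nat (count m1 i0 + 1)"
              unfolding k_def m1(3) using m0(1) \<open>c m0 = 1\<close> by simp
            moreover have "of_nat (count m1 i0 + 1) \<noteq> (0 :: complex)"
              by (simp only: of_nat_eq_0_iff)
            ultimately show ?thesis
              by (simp only: neg_equal_0_iff_equal not_False_eq_True)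
          qed
          ultimately show ?thesis by simp
        qed
      qed
    qed
  qed simp
  note zero = this
  have "rel M a"
    unfolding rel_def by (intro conjI ballI assms)
  moreover have "\<forall>m\<in>M. size m < Suc (Max (size ` M))"
    using assms(7) by (simp add: less_Suc_eq_le)
  ultimately show ?thesis
    using zero[of M a "Suc (Max (size ` M))"] assms(10,11) by metis
qed

section \<open>The equilibrium and the half-plane to its left\<close>

definition speed :: "real \<Rightarrow> real \<Rightarrow> real" where
  "speed r y = r * exp y - y"

text \<open>
For \<open>0 < r\<close> and \<open>r * exp 1 < 1\<close> the speed has two real zeros, one on each side of \<open>1\<close>; the bound
by \<open>1\<close> selects the smaller.
\<close>

definition equilibrium :: "real \<Rightarrow> real" where
  "equilibrium r = (SOME T. 0 < T \<and> T < 1 \<and> r * exp T = T)"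

lemma equilibrium:
  assumes "0 < r" "r * exp 1 < 1"
  shows "0 < equilibrium r" "equilibrium r < 1" "r * exp (equilibrium r) = equilibrium r"
proof -
  have "\<exists>T. 0 \<le> T \<and> T \<le> 1 \<and> speed r T = 0"
    unfolding speed_def by (rule IVT2) (use assms in \<open>auto intro!: continuous_intros\<close>)
  then obtain T where T: "0 \<le> T" "T \<le> 1" "r * exp T = T"
    by (auto simp: speed_def)
  moreover have "T \<noteq> 0" "T \<noteq> 1"
    using T assms by auto
  ultimately have "0 < T \<and> T < 1 \<and> r * exp T = T" by auto
  from someI[of "\<lambda>T. 0 < T \<and> T < 1 \<and> r * exp T = T", OF this]
  show "0 < equilibrium r" "equilibrium r < 1" "r * exp (equilibrium r) = equilibrium r"
    unfolding equilibrium_def by auto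
qed

lemma speed_pos:
  assumes "0 < r" "r * exp 1 < 1" "y < equilibrium r"
  shows "0 < speed r y"
proof -
  define T where "T = equilibrium r"
  have T: "0 < T" "T < 1" "r * exp T = T"
    unfolding T_def using equilibrium assms by auto
  have "T * (1 + (y - T)) \<le> T * exp (y - T)"
    using T by (intro mult_left_mono exp_ge_add_one_self) auto
  also have "\<dots> = r * exp y"
    using T by (metis (no_types, opaque_lifting) exp_diff times_divide_eq_right mult.assoc
        nonzero_mult_div_cancel_left exp_not_eq_zero mult.commute times_divide_eq_left)
  finally have "(1 - T) * (T - y) \<le> speed r y"
    by (simp add: speed_def algebra_simps)
  moreover have "0 < (1 - T) * (T - y)"
    using T assms(3) by (simp add: T_def)
  ultimately show ?thesis by linarith
qed

lemma less_equilibrium_iff: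
  assumes "0 < r" "r * exp 1 < 1"
  shows "y < equilibrium r \<longleftrightarrow> y < 1 \<and> 0 < speed r y"
proof
  assume "y < equilibrium r"
  then show "y < 1 \<and> 0 < speed r y"
    using speed_pos[OF assms] equilibrium[OF assms] by auto
next
  assume y: "y < 1 \<and> 0 < speed r y"
  define T where "T = equilibrium r"
  have T: "0 < T" "T < 1" "r * exp T = T"
    unfolding T_def using equilibrium assms by auto
  show "y < equilibrium r"
  proof (rule ccontr)
    assume "\<not> y < equilibrium r"
    then have "T \<le> y" by (simp add: T_def)
    have "r * exp y * (1 + (T - y)) \<le> r * exp y * exp (T - y)"
      using assms(1) by (intro mult_left_mono exp_ge_add_one_self) auto
    also have "\<dots> = T"
      using T by (simp add: exp_diff)
    finally have 1: "r * exp y * (1 + (T - y)) \<le> T" .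
    have "y * (1 + (T - y)) < r * exp y * (1 + (T - y))"
      using y T by (intro mult_strict_right_mono) (auto simp: speed_def)
    with 1 have "y * (1 + (T - y)) < T" by linarith
    then have "(y - T) * (1 - y) < 0" by (simp add: algebra_simps)
    moreover have "0 \<le> (y - T) * (1 - y)"
      using y \<open>T \<le> y\<close> by simp
    ultimately show False by linarith
  qed
qed

lemma cspeed_of_real: "cspeed r (of_real y) = of_real (speed r y)"
  by (simp add: cspeed_def speed_def exp_of_real)

text \<open>
At a non-real root the imaginary parts give \<open>r * exp (Re z) \<ge> 1\<close>, because \<open>\<bar>sin b\<bar> \<le> \<bar>b\<bar>\<close>. This
fails for \<open>Re z < 1\<close>, and real roots below the equilibrium are excluded by positivity of the
speed. So the half-plane to the left of the equilibrium contains no root. It is convex, whence the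
primitives of the integrands are holomorphic there, and it contains the whole real range of the
solution.
\<close>

lemma cspeed_nonzero_left_of_equilibrium:
  assumes "0 < r" "r * exp 1 < 1" "Re z < equilibrium r"
  shows "cspeed r z \<noteq> 0"
proof
  assume "cspeed r z = 0"
  then have eq: "of_real r * exp z = z" by (simp add: cspeed_def)
  have Im: "r * (exp (Re z) * sin (Im z)) = Im z"
    using arg_cong[OF eq, of Im] by (simp add: Im_exp)
  have "Re z < 1" using assms equilibrium(2)[of r] by auto
  then have small: "r * exp (Re z) < 1"
    using assms(1,2) by (meson exp_less_mono mult_strict_left_mono order_less_trans)
  have "Im z = 0"
  proof (rule ccontr)
    assume "Im z \<noteq> 0"
    have "\<bar>Im z\<bar> = r * exp (Re z) * \<bar>sin (Im z)\<bar>"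
      using Im assms(1) by (metis abs_mult abs_of_pos exp_gt_zero mult.assoc)
    also have "\<dots> \<le> r * exp (Re z) * \<bar>Im z\<bar>"
      using assms(1) by (intro mult_left_mono abs_sin_x_le_abs_x) auto
    also have "\<dots> < 1 * \<bar>Im z\<bar>"
      using small \<open>Im z \<noteq> 0\<close> by (intro mult_strict_right_mono) auto
    finally show False by simp
  qed
  then have "z = of_real (Re z)"
    by (simp add: complex_eq_iff)
  then have "speed r (Re z) = 0"
    using \<open>cspeed r z = 0\<close> cspeed_of_real[of r "Re z"] by simp
  then show False using speed_pos[OF assms] by simp
qed

section \<open>Polynomials in the real primitives\<close>

text \<open>
The coefficients come from the ring over which the primitives are algebraically independent. At
zeros of the speed, where the coefficients carry no information, nothing is required.
\<close>

definition primitive_polys :: "real \<Rightarrow> (real \<Rightarrow> (nat \<Rightarrow> real) \<Rightarrow> real) set" where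
  "primitive_polys r = {h. \<exists>M a. finite M \<and> (\<forall>m\<in>M. a m \<in> merom r) \<and>
     (\<forall>y w. speed r y \<noteq> 0 \<longrightarrow>
        of_real (h y w) = (\<Sum>m\<in>M. a m (of_real y) * mset_monomial (\<lambda>i. of_real (w i)) m))}"

lemma primitive_polysI:
  assumes "finite M" "\<And>m. m \<in> M \<Longrightarrow> a m \<in> merom r"
    "\<And>y w. speed r y \<noteq> 0 \<Longrightarrow>
        of_real (h y w) = (\<Sum>m\<in>M. a m (of_real y) * mset_monomial (\<lambda>i. of_real (w i)) m)"
  shows "h \<in> primitive_polys r"
  unfolding primitive_polys_def using assms by blast

lemma primitive_polysE:
  assumes "h \<in> primitive_polys r"
  obtains M a where "finite M" "\<And>m. m \<in> M \<Longrightarrow> a m \<in> merom r"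
    "\<And>y w. speed r y \<noteq> 0 \<Longrightarrow>
        of_real (h y w) = (\<Sum>m\<in>M. a m (of_real y) * mset_monomial (\<lambda>i. of_real (w i)) m)"
  using assms unfolding primitive_polys_def by blast

lemma primitive_polys_coeff:
  "a \<in> merom r \<Longrightarrow> (\<And>y. speed r y \<noteq> 0 \<Longrightarrow> a (of_real y) = of_real (h y)) \<Longrightarrow>
    (\<lambda>y w. h y) \<in> primitive_polys r"
  by (rule primitive_polysI[of "{{#}}" "\<lambda>_. a"]) auto

lemma primitive_polys_var: "(\<lambda>y w. w i) \<in> primitive_polys r"
  by (rule primitive_polysI[of "{{#i#}}" "\<lambda>_ _. 1"]) (auto intro: merom_const)

lemma primitive_polys_add:
  assumes "h \<in> primitive_polys r" "k \<in> primitive_polys r"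
  shows "(\<lambda>y w. h y w + k y w) \<in> primitive_polys r"
proof -
  obtain M a where a: "finite M" "\<And>m. m \<in> M \<Longrightarrow> a m \<in> merom r"
    "\<And>y w. speed r y \<noteq> 0 \<Longrightarrow>
        of_real (h y w) = (\<Sum>m\<in>M. a m (of_real y) * mset_monomial (\<lambda>i. of_real (w i)) m)"
    by (rule primitive_polysE[OF assms(1)]) blast
  obtain N b where b: "finite N" "\<And>m. m \<in> N \<Longrightarrow> b m \<in> merom r"
    "\<And>y w. speed r y \<noteq> 0 \<Longrightarrow>
        of_real (k y w) = (\<Sum>m\<in>N. b m (of_real y) * mset_monomial (\<lambda>i. of_real (w i)) m)"
    by (rule primitive_polysE[OF assms(2)]) blast
  define a' where "a' m = (if m \<in> M then a m else (\<lambda>_. 0))" for m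
  define b' where "b' m = (if m \<in> N then b m else (\<lambda>_. 0))" for m
  show ?thesis
  proof (rule primitive_polysI[of "M \<union> N" "\<lambda>m z. a' m z + b' m z"])
    show "(\<lambda>z. a' m z + b' m z) \<in> merom r" for m
      unfolding a'_def b'_def by (intro merom_add) (auto intro: a b merom_const)
    fix y w assume "speed r y \<noteq> 0"
    let ?v = "mset_monomial (\<lambda>i. complex_of_real (w i))"
    have "(\<Sum>m\<in>M. a m (of_real y) * ?v m) = (\<Sum>m\<in>M \<union> N. a' m (of_real y) * ?v m)"
      using a(1) b(1) by (intro sum.mono_neutral_cong_left) (auto simp: a'_def)
    moreover have "(\<Sum>m\<in>N. b m (of_real y) * ?v m) = (\<Sum>m\<in>M \<union> N. b' m (of_real y) * ?v m)"
      using a(1) b(1) by (intro sum.mono_neutral_cong_left) (auto simp: b'_def)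
    ultimately show "of_real (h y w + k y w) = (\<Sum>m\<in>M \<union> N. (a' m (of_real y) + b' m (of_real y)) * ?v m)"
      using a(3) b(3) \<open>speed r y \<noteq> 0\<close> by (simp add: sum.distrib algebra_simps)
  qed (use a b in auto)
qed

lemma primitive_polys_mult:
  assumes "h \<in> primitive_polys r" "k \<in> primitive_polys r"
  shows "(\<lambda>y w. h y w * k y w) \<in> primitive_polys r"
proof -
  obtain M a where a: "finite M" "\<And>m. m \<in> M \<Longrightarrow> a m \<in> merom r"
    "\<And>y w. speed r y \<noteq> 0 \<Longrightarrow>
        of_real (h y w) = (\<Sum>m\<in>M. a m (of_real y) * mset_monomial (\<lambda>i. of_real (w i)) m)"
    by (rule primitive_polysE[OF assms(1)]) blast
  obtain N b where b: "finite N" "\<And>m. m \<in> N \<Longrightarrow> b m \<in> merom r"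
    "\<And>y w. speed r y \<noteq> 0 \<Longrightarrow>
        of_real (k y w) = (\<Sum>m\<in>N. b m (of_real y) * mset_monomial (\<lambda>i. of_real (w i)) m)"
    by (rule primitive_polysE[OF assms(2)]) blast
  define P where "P = (\<lambda>(m, n). m + n) ` (M \<times> N)"
  define c where "c l z = (\<Sum>(m, n)\<in>{p\<in>M \<times> N. (case p of (m, n) \<Rightarrow> m + n) = l}. a m z * b n z)" for l z
  show ?thesis
  proof (rule primitive_polysI[of P c])
    show "finite P" unfolding P_def using a b by simp
    show "c l \<in> merom r" for l
      unfolding c_def[abs_def] case_prod_unfold by (intro merom_sum merom_mult a b) auto
    fix y w assume y: "speed r y \<noteq> 0"
    let ?v = "mset_monomial (\<lambda>i. complex_of_real (w i))"
    have "of_real (h y w * k y w) = (\<Sum>(m, n)\<in>M \<times> N. (a m (of_real y) * ?v m) * (b n (of_real y) * ?v n))"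
      using a(3)[OF y] b(3)[OF y] by (simp add: sum_product sum.cartesian_product)
    also have "\<dots> = (\<Sum>(m, n)\<in>M \<times> N. a m (of_real y) * b n (of_real y) * ?v (m + n))"
      by (intro sum.cong) auto
    also have "\<dots> = (\<Sum>l\<in>P. \<Sum>p\<in>{p\<in>M \<times> N. (case p of (m, n) \<Rightarrow> m + n) = l}.
      case p of (m, n) \<Rightarrow> a m (of_real y) * b n (of_real y) * ?v (m + n))"
      using a(1) b(1) unfolding P_def by (intro sum.group[symmetric]) auto
    also have "\<dots> = (\<Sum>l\<in>P. c l (of_real y) * ?v l)"
      unfolding c_def sum_distrib_right by (intro sum.cong) auto
    finally show "of_real (h y w * k y w) = (\<Sum>l\<in>P. c l (of_real y) * ?v l)" .
  qed
qed

text \<open>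
The passage back from complex to real functions. Substituting holomorphic primitives for the
variables \<open>w i\<close> gives a holomorphic function on a half-plane; if it has uncountably many zeros, it
vanishes, and then algebraic independence makes all its coefficients zero.
\<close>

theorem primitive_poly_vanishes:
  assumes r: "0 < r" "r * exp 1 < 1"
    and \<phi>: "\<And>i y. y < equilibrium r \<Longrightarrow>
      (\<phi> i has_real_derivative exp y ^ i / speed r y ^ Suc i) (at y)"
    and h: "h \<in> primitive_polys r"
    and unc: "uncountable {y. y < equilibrium r \<and> h y (\<lambda>i. \<phi> i y) = 0}"
    and y: "y < equilibrium r"
  shows "h y w = 0"
proof -
  define T where "T = equilibrium r"
  define V where "V = {z. Re z < T}"
  have V: "open V" "convex V" "V \<noteq> {}" "\<And>z. z \<in> V \<Longrightarrow> cspeed r z \<noteq> 0"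
    unfolding V_def T_def using cspeed_nonzero_left_of_equilibrium[OF r]
    by (auto simp: open_halfspace_Re_lt convex_halfspace_Re_lt intro!: exI[of _ "of_real (equilibrium r - 1)"])
  have T0: "0 < T" unfolding T_def using equilibrium[OF r] by auto
  have "\<exists>\<Phi>. \<forall>z\<in>V. (\<Phi> has_field_derivative integrand r i z) (at z)" for i
  proof -
    have "integrand r i holomorphic_on V"
      using V(4) merom_holomorphic[OF merom_integrand] by blast
    from holomorphic_convex_primitive'[OF V(2) V(1) this]
    obtain g where "\<And>z. z \<in> V \<Longrightarrow> (g has_field_derivative integrand r i z) (at z within V)" by blast
    then show ?thesis using V(1) by (metis at_within_open)
  qed
  then obtain \<Psi> where \<Psi>: "\<And>i z. z \<in> V \<Longrightarrow> (\<Psi> i has_field_derivative integrand r i z) (at z)"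
    by metis
  define \<Phi> where "\<Phi> i z = \<Psi> i z + (of_real (\<phi> i 0) - \<Psi> i 0)" for i z
  have \<Phi>: "(\<Phi> i has_field_derivative integrand r i z) (at z)" if "z \<in> V" for i z
    unfolding \<Phi>_def[abs_def] using \<Psi>[OF that] by (auto intro!: derivative_eq_intros)
  have real: "\<Phi> i (of_real t) = of_real (\<phi> i t)" if "t < T" for i t
  proof -
    have "\<exists>c. \<forall>t\<in>{..<T}. \<Phi> i (of_real t) - of_real (\<phi> i t) = c"
    proof (rule has_vector_derivative_zero_constant)
      fix t assume "t \<in> {..<T}"
      then have t: "t < T" "of_real t \<in> V" by (auto simp: V_def)
      have "((\<lambda>t. \<Phi> i (of_real t)) has_vector_derivative integrand r i (of_real t)) (at t)"
        using has_vector_derivative_real_field[OF \<Phi>[OF t(2)]] by simp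
      moreover have "((\<lambda>t. of_real (\<phi> i t)) has_vector_derivative (of_real (exp t ^ i / speed r t ^ Suc i) :: complex)) (at t)"
        using \<phi>[of t i] t(1) unfolding T_def by (intro has_vector_derivative_of_real)
      moreover have "integrand r i (of_real t) = of_real (exp t ^ i / speed r t ^ Suc i)"
        by (simp add: integrand_def cspeed_of_real exp_of_nat_mult exp_of_real)
      ultimately have "((\<lambda>t. \<Phi> i (of_real t) - of_real (\<phi> i t)) has_vector_derivative 0) (at t)"
        using has_vector_derivative_diff by fastforce
      then show "((\<lambda>t. \<Phi> i (of_real t) - of_real (\<phi> i t)) has_vector_derivative 0) (at t within {..<T})"
        by (rule has_vector_derivative_at_within)
    qed (simp, blast)
    then obtain c where c: "\<And>t. t < T \<Longrightarrow> \<Phi> i (of_real t) - of_real (\<phi> i t) = c" by auto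
    from c[OF T0] have "c = 0" by (simp add: \<Phi>_def)
    with c[OF that] show ?thesis by simp
  qed
  obtain M a where a: "finite M" "\<And>m. m \<in> M \<Longrightarrow> a m \<in> merom r"
    "\<And>y w. speed r y \<noteq> 0 \<Longrightarrow>
        of_real (h y w) = (\<Sum>m\<in>M. a m (of_real y) * mset_monomial (\<lambda>i. of_real (w i)) m)"
    by (rule primitive_polysE[OF h]) blast
  define F where "F z = (\<Sum>m\<in>M. a m z * mset_monomial (\<lambda>i. \<Phi> i z) m)" for z
  have hol_mono: "(\<lambda>z. mset_monomial (\<lambda>i. \<Phi> i z) m) holomorphic_on V" for m
    unfolding holomorphic_on_open[OF V(1)]
  proof
    fix z assume "z \<in> V"
    from mset_monomial_derivative[of \<Phi> "\<lambda>i. integrand r i z" z m, OF \<Phi>[OF this]]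
    show "\<exists>f'. ((\<lambda>z. mset_monomial (\<lambda>i. \<Phi> i z) m) has_field_derivative f') (at z)" by blast
  qed
  have "F holomorphic_on V"
    unfolding F_def[abs_def] using V(4) a(2)
    by (intro holomorphic_on_sum holomorphic_on_mult hol_mono merom_holomorphic) auto
  have F_real: "F (of_real t) = of_real (h t (\<lambda>i. \<phi> i t))" if "t < T" for t
  proof -
    have "speed r t \<noteq> 0" using speed_pos[OF r, of t] that by (simp add: T_def)
    then show ?thesis
      unfolding F_def a(3)[OF \<open>speed r t \<noteq> 0\<close>] using real[OF that] by simp
  qed
  have zeros: "uncountable {z\<in>V. F z = 0}"
  proof
    assume "countable {z\<in>V. F z = 0}"
    then have "countable (Re ` {z\<in>V. F z = 0})" by blast
    moreover have "{y. y < equilibrium r \<and> h y (\<lambda>i. \<phi> i y) = 0} \<subseteq> Re ` {z\<in>V. F z = 0}"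
    proof
      fix t assume "t \<in> {y. y < equilibrium r \<and> h y (\<lambda>i. \<phi> i y) = 0}"
      then have "of_real t \<in> {z\<in>V. F z = 0}" using F_real by (auto simp: V_def T_def)
      then show "t \<in> Re ` {z\<in>V. F z = 0}" by force
    qed
    ultimately show False using unc countable_subset by blast
  qed
  have "V = (\<Union>n. {z. Re z \<le> T - inverse (real (Suc n))})"
  proof (intro equalityI subsetI)
    fix z assume "z \<in> V"
    then obtain n where "inverse (real (Suc n)) < T - Re z"
      using reals_Archimedean[of "T - Re z"] by (auto simp: V_def)
    then show "z \<in> (\<Union>n. {z. Re z \<le> T - inverse (real (Suc n))})"
      by (intro UN_I[of n]) auto
  next
    fix z assume "z \<in> (\<Union>n. {z. Re z \<le> T - inverse (real (Suc n))})"
    then obtain n where "Re z \<le> T - inverse (real (Suc n))" by blast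
    moreover have "0 < inverse (real (Suc n))" by simp
    ultimately show "z \<in> V" unfolding V_def mem_Collect_eq by linarith
  qed
  moreover have "fsigma (\<Union>n. {z. Re z \<le> T - inverse (real (Suc n))})"
    by (intro fsigma.intros closed_halfspace_Re_le)
  ultimately have "fsigma V" by simp
  have "F constant_on V"
    using holomorphic_countable_zeros[OF \<open>F holomorphic_on V\<close> V(1) convex_connected[OF V(2)] \<open>fsigma V\<close>] zeros by blast
  moreover obtain z0 where "z0 \<in> V" "F z0 = 0"
    using zeros by (metis (mono_tags, lifting) countable_empty empty_Collect_eq)
  ultimately have F0: "F z = 0" if "z \<in> V" for z
    using that unfolding constant_on_def by metis
  have "speed r y \<noteq> 0" using speed_pos[OF r y] by simp
  have "a m (of_real y) = 0" if "m \<in> M" for m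
  proof (rule primitives_alg_independent[OF r(2) _ V(1,3,4) \<Phi> a(1,2) _ that])
    show "r \<noteq> 0" using r by simp
    show "(\<Sum>m\<in>M. a m z * mset_monomial (\<lambda>i. \<Phi> i z) m) = 0" if "z \<in> V" for z
      using F0[OF that] unfolding F_def .
    show "cspeed r (of_real y) \<noteq> 0"
      using \<open>speed r y \<noteq> 0\<close> by (simp add: cspeed_of_real)
  qed
  then show ?thesis
    using a(3)[OF \<open>speed r y \<noteq> 0\<close>, of w] by simp
qed

section \<open>Travel time and its derivatives in the parameter\<close>

definition real_integrand :: "nat \<Rightarrow> real \<Rightarrow> real \<Rightarrow> real" where
  "real_integrand k r u = exp u ^ k / speed r u ^ Suc k"

text \<open>
The integral from \<open>0\<close> to \<open>y\<close>, rescaled to a fixed interval so that both signs of \<open>y\<close> are covered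
and differentiation under the integral sign applies to \<open>y\<close> as well as to \<open>r\<close>.
\<close>

definition prim :: "nat \<Rightarrow> real \<Rightarrow> real \<Rightarrow> real" where
  "prim k r y = integral {0..1} (\<lambda>s. y * real_integrand k r (y * s))"

lemma prim_0 [simp]: "prim k r 0 = 0"
  by (simp add: prim_def)

text \<open>
Since \<open>exp 1 \<le> 3\<close>, these parameters satisfy \<open>r * exp 1 < 1\<close>.
\<close>

definition param_range :: "real set" where
  "param_range = {0<..<1/3}"

lemma param_range: "r \<in> param_range \<Longrightarrow> 0 < r" "r \<in> param_range \<Longrightarrow> r * exp 1 < 1"
proof -
  assume r: "r \<in> param_range"
  then show "0 < r" by (simp add: param_range_def)
  have "r * exp 1 \<le> r * 3"
    using r exp_le by (intro mult_left_mono) (auto simp: param_range_def)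
  also have "\<dots> < 1" using r by (simp add: param_range_def)
  finally show "r * exp 1 < 1" .
qed

lemma open_param_range: "open param_range"
  by (simp add: param_range_def)

lemma
  assumes "r \<in> param_range"
  shows equilibrium_pos: "0 < equilibrium r"
    and equilibrium_less_1: "equilibrium r < 1"
    and equilibrium_eq: "r * exp (equilibrium r) = equilibrium r"
    and speed_pos_below: "y < equilibrium r \<Longrightarrow> 0 < speed r y"
    and below_equilibrium_iff: "y < equilibrium r \<longleftrightarrow> y < 1 \<and> 0 < speed r y"
  using equilibrium[of r] speed_pos[of r y] less_equilibrium_iff[of r y] param_range[OF assms] by auto

lemma scaled_less_equilibrium:
  assumes "r \<in> param_range" "y < equilibrium r" "s \<in> {0..1}"
  shows "y * s < equilibrium r"
proof (cases "0 \<le> y")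
  case True
  then have "y * s \<le> y" using assms(3) by (simp add: mult_left_le)
  then show ?thesis using assms(2) by linarith
next
  case False
  then have "y * s \<le> 0" using assms(3) by (simp add: mult_nonpos_nonneg)
  then show ?thesis using equilibrium_pos[OF assms(1)] by linarith
qed

lemma continuous_on_speed [continuous_intros]:
  "continuous_on A f \<Longrightarrow> continuous_on A g \<Longrightarrow> continuous_on A (\<lambda>x. speed (f x) (g x))"
  unfolding speed_def by (intro continuous_intros)

lemma continuous_on_real_integrand:
  "continuous_on A f \<Longrightarrow> continuous_on A g \<Longrightarrow> (\<And>x. x \<in> A \<Longrightarrow> speed (f x) (g x) \<noteq> 0) \<Longrightarrow>
    continuous_on A (\<lambda>x. real_integrand k (f x) (g x))"
  unfolding real_integrand_def by (intro continuous_intros) auto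

lemma real_integrand_integrable:
  assumes "r \<in> param_range" "y < equilibrium r"
  shows "(\<lambda>s. y * real_integrand k r (y * s)) integrable_on cbox 0 1"
proof -
  have "speed r (y * s) \<noteq> 0" if "s \<in> {0..1}" for s
    using speed_pos_below[OF assms(1) scaled_less_equilibrium[OF assms that]] by simp
  then show ?thesis
    by (intro integrable_continuous continuous_on_mult continuous_on_real_integrand continuous_intros) auto
qed

definition real_integrand' :: "nat \<Rightarrow> real \<Rightarrow> real \<Rightarrow> real" where
  "real_integrand' k r u = (of_nat k * exp u ^ k * speed r u - exp u ^ k * of_nat (Suc k) * (r * exp u - 1)) / speed r u ^ (k + 2)"

lemma real_integrand_derivative:
  assumes "speed r u \<noteq> 0"
  shows "(real_integrand k r has_real_derivative real_integrand' k r u) (at u)"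
proof -
  have "((\<lambda>u. exp u ^ k) has_real_derivative of_nat k * exp u ^ k) (at u)"
  proof -
    have "((\<lambda>u. exp (of_nat k * u)) has_real_derivative of_nat k * exp (of_nat k * u)) (at u)"
      by (auto intro!: derivative_eq_intros)
    then show ?thesis by (simp add: exp_of_nat_mult)
  qed
  moreover have "((\<lambda>u. speed r u ^ Suc k) has_real_derivative of_nat (Suc k) * (r * exp u - 1) * speed r u ^ k) (at u)"
    unfolding speed_def by (auto intro!: derivative_eq_intros simp del: power_Suc)
  ultimately have "((\<lambda>u. exp u ^ k / speed r u ^ Suc k) has_real_derivative
    (of_nat k * exp u ^ k * speed r u ^ Suc k - exp u ^ k * (of_nat (Suc k) * (r * exp u - 1) * speed r u ^ k))
      / (speed r u ^ Suc k * speed r u ^ Suc k)) (at u)"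
    by (intro DERIV_divide) (use assms in auto)
  also have "(of_nat k * exp u ^ k * speed r u ^ Suc k - exp u ^ k * (of_nat (Suc k) * (r * exp u - 1) * speed r u ^ k))
      / (speed r u ^ Suc k * speed r u ^ Suc k) = speed r u ^ k * (of_nat k * exp u ^ k * speed r u - exp u ^ k * of_nat (Suc k) * (r * exp u - 1)) / (speed r u ^ k * speed r u ^ (k + 2))"
    by (simp add: algebra_simps)
  also have "\<dots> = real_integrand' k r u"
    unfolding real_integrand'_def using assms by simp
  finally show ?thesis unfolding real_integrand_def[abs_def] .
qed

lemma prim_derivative_y:
  assumes r: "r \<in> param_range" and y: "y < equilibrium r"
  shows "(prim k r has_real_derivative real_integrand k r y) (at y)"
proof -
  define T where "T = equilibrium r"
  have nz: "speed r u \<noteq> 0" if "u < T" for u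
    using speed_pos_below[OF r] that by (force simp: T_def)
  have scaled: "z * s < T" if "z < T" "s \<in> {0..1}" for z s
    using scaled_less_equilibrium[OF r] that unfolding T_def by blast
  let ?d = "\<lambda>z s. real_integrand k r (z * s) + z * (real_integrand' k r (z * s) * s)"
  have "((\<lambda>z. integral (cbox 0 1) (\<lambda>s. z * real_integrand k r (z * s))) has_real_derivative
    integral (cbox 0 1) (?d y)) (at y within {..<T})"
  proof (rule leibniz_rule_field_derivative)
    fix z s :: real assume zs: "z \<in> {..<T}" "s \<in> cbox 0 1"
    have "((\<lambda>z. real_integrand k r (z * s)) has_real_derivative real_integrand' k r (z * s) * s) (at z)"
      using scaled[of z s] zs by (intro DERIV_chain2[OF real_integrand_derivative] nz) (auto intro!: derivative_eq_intros)
    from DERIV_mult[OF DERIV_ident this]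
    show "((\<lambda>z. z * real_integrand k r (z * s)) has_real_derivative ?d z s) (at z within {..<T})"
      by (auto simp: algebra_simps intro: has_field_derivative_at_within)
  next
    fix z assume "z \<in> {..<T}"
    then show "(\<lambda>s. z * real_integrand k r (z * s)) integrable_on cbox 0 1"
      using real_integrand_integrable[OF r] by (simp add: T_def)
  next
    have c: "continuous_on ({..<T} \<times> cbox 0 1) (\<lambda>x. real_integrand k r (fst x * snd x))"
      by (intro continuous_on_real_integrand continuous_intros) (use scaled nz in auto)
    have c': "continuous_on ({..<T} \<times> cbox 0 1) (\<lambda>x. real_integrand' k r (fst x * snd x))"
      unfolding real_integrand'_def by (intro continuous_intros) (use scaled nz in auto)
    show "continuous_on ({..<T} \<times> cbox 0 1) (\<lambda>(z, s). ?d z s)"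
      unfolding case_prod_unfold by (intro continuous_intros c c')
  qed (use y T_def in auto)
  moreover have "(?d y has_integral 1 * real_integrand k r (y * 1) - 0 * real_integrand k r (y * 0)) {0..1}"
  proof (rule fundamental_theorem_of_calculus)
    fix s :: real assume s: "s \<in> {0..1}"
    have "((\<lambda>s. real_integrand k r (y * s)) has_real_derivative real_integrand' k r (y * s) * y) (at s)"
      using scaled[of y s] s y by (intro DERIV_chain2[OF real_integrand_derivative] nz) (auto intro!: derivative_eq_intros simp: T_def)
    from DERIV_mult[OF DERIV_ident this]
    have "((\<lambda>s. s * real_integrand k r (y * s)) has_real_derivative ?d y s) (at s)"
      by (simp add: algebra_simps)
    then show "((\<lambda>s. s * real_integrand k r (y * s)) has_vector_derivative ?d y s) (at s within {0..1})"
      by (simp add: has_real_derivative_iff_has_vector_derivative has_vector_derivative_at_within)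
  qed simp
  then have "integral (cbox 0 1) (?d y) = real_integrand k r y"
    by (simp add: integral_unique)
  ultimately have "((\<lambda>z. integral (cbox 0 1) (\<lambda>s. z * real_integrand k r (z * s))) has_real_derivative
    real_integrand k r y) (at y within {..<T})"
    by (simp only:)
  moreover have "at y within {..<T} = at y"
    using y by (intro at_within_open) (auto simp: T_def)
  ultimately show ?thesis
    unfolding prim_def[abs_def] by (simp only: box_real)
qed

text \<open>
Each differentiation in \<open>r\<close> raises the index, which is why the derivatives of the solution involve
all the primitives.
\<close>

lemma prim_derivative_r:
  assumes r: "r \<in> param_range" and y: "y < equilibrium r"
  shows "((\<lambda>r. prim k r y) has_real_derivative - (of_nat (Suc k) * prim (Suc k) r y)) (at r)"
proof -
  define U where "U = {\<rho>\<in>param_range. 0 < speed \<rho> y}"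
  have y1: "y < 1" using y equilibrium_less_1[OF r] by linarith
  have U_iff: "\<rho> \<in> U \<longleftrightarrow> \<rho> \<in> param_range \<and> y < equilibrium \<rho>" for \<rho>
    using below_equilibrium_iff[of \<rho> y] y1 by (auto simp: U_def)
  have "U = {0<..<1/3} \<inter> {y * exp (- y)<..}"
    by (auto simp: U_def param_range_def speed_def exp_minus field_simps)
  then have U: "open U" "convex U"
    by (auto intro!: convex_Int)
  have "r \<in> U" using r y U_iff by blast
  have pos: "speed \<rho> (y * s) \<noteq> 0" if "\<rho> \<in> U" "s \<in> {0..1}" for \<rho> s
    using speed_pos_below[of \<rho>] scaled_less_equilibrium[of \<rho> y s] that U_iff[of \<rho>] by force
  let ?d = "\<lambda>\<rho> s. - of_nat (Suc k) * (y * real_integrand (Suc k) \<rho> (y * s))"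
  have "((\<lambda>\<rho>. integral (cbox 0 1) (\<lambda>s. y * real_integrand k \<rho> (y * s))) has_real_derivative
    integral (cbox 0 1) (?d r)) (at r within U)"
  proof (rule leibniz_rule_field_derivative)
    fix \<rho> s :: real assume rs: "\<rho> \<in> U" "s \<in> cbox 0 1"
    define u where "u = y * s"
    have q: "speed \<rho> u \<noteq> 0" using pos rs by (simp add: u_def)
    have "((\<lambda>\<rho>. speed \<rho> u ^ Suc k) has_real_derivative of_nat (Suc k) * exp u * speed \<rho> u ^ k) (at \<rho>)"
      unfolding speed_def by (auto intro!: derivative_eq_intros simp del: power_Suc)
    then have "((\<lambda>\<rho>. y * (exp u ^ k / speed \<rho> u ^ Suc k)) has_real_derivative
      y * ((0 * speed \<rho> u ^ Suc k - exp u ^ k * (of_nat (Suc k) * exp u * speed \<rho> u ^ k)) / (speed \<rho> u ^ Suc k * speed \<rho> u ^ Suc k))) (at \<rho>)"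
      by (intro DERIV_cmult DERIV_divide DERIV_const) (use q in auto)
    also have "y * ((0 * speed \<rho> u ^ Suc k - exp u ^ k * (of_nat (Suc k) * exp u * speed \<rho> u ^ k)) / (speed \<rho> u ^ Suc k * speed \<rho> u ^ Suc k)) =
      - of_nat (Suc k) * (y * real_integrand (Suc k) \<rho> u)"
      using q by (simp add: real_integrand_def del: of_nat_Suc)
    finally show "((\<lambda>\<rho>. y * real_integrand k \<rho> (y * s)) has_real_derivative ?d \<rho> s) (at \<rho> within U)"
      unfolding real_integrand_def u_def by (rule has_field_derivative_at_within)
  next
    fix \<rho> assume "\<rho> \<in> U"
    then show "(\<lambda>s. y * real_integrand k \<rho> (y * s)) integrable_on cbox 0 1"
      using real_integrand_integrable U_iff by blast
  next
    show "continuous_on (U \<times> cbox 0 1) (\<lambda>(\<rho>, s). ?d \<rho> s)"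
      unfolding case_prod_unfold by (intro continuous_intros continuous_on_real_integrand) (use pos in auto)
  qed (use \<open>r \<in> U\<close> U in auto)
  moreover have "integral (cbox 0 1) (?d r) = - (of_nat (Suc k) * prim (Suc k) r y)"
    unfolding prim_def by (simp del: of_nat_Suc)
  moreover have "at r within U = at r"
    using \<open>r \<in> U\<close> U(1) by (rule at_within_open)
  ultimately show ?thesis
    unfolding prim_def[of k] by (simp only: box_real)
qed

section \<open>The solution as the inverse of the travel time\<close>

lemma real_integrand_pos: "r \<in> param_range \<Longrightarrow> y < equilibrium r \<Longrightarrow> 0 < real_integrand k r y"
  unfolding real_integrand_def by (intro divide_pos_pos zero_less_power speed_pos_below) auto

lemma prim_strict_mono:
  assumes "r \<in> param_range" "y < z" "z < equilibrium r"
  shows "prim k r y < prim k r z"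
proof (rule DERIV_pos_imp_increasing[OF assms(2)])
  fix u assume "y \<le> u" "u \<le> z"
  then have "u < equilibrium r" using assms(3) by simp
  then show "\<exists>d. (prim k r has_real_derivative d) (at u) \<and> 0 < d"
    using prim_derivative_y[OF assms(1)] real_integrand_pos[OF assms(1)] by blast
qed

lemma prim_less_iff:
  assumes "r \<in> param_range" "y < equilibrium r" "z < equilibrium r"
  shows "prim k r y < prim k r z \<longleftrightarrow> y < z"
  using prim_strict_mono[OF assms(1), of y z] prim_strict_mono[OF assms(1), of z y] assms
  by (metis linorder_neqE_linordered_idom order_less_asym order_less_irrefl)

text \<open>
The speed below the equilibrium \<open>T\<close> is at most \<open>T - y\<close>, so in absolute value the travel time
dominates that of the linear equation \<open>y' = T - y\<close>, namely \<open>- ln ((T - y) / T)\<close>. The equilibrium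
is therefore never reached in finite time, and going backwards no blow-up occurs.
\<close>

lemma prim_surj:
  assumes r: "r \<in> param_range"
  shows "\<exists>y<equilibrium r. prim 0 r y = x"
proof -
  define T where "T = equilibrium r"
  have T: "0 < T" "T < 1" "r * exp T = T"
    using equilibrium_pos[OF r] equilibrium_less_1[OF r] equilibrium_eq[OF r] by (auto simp: T_def)
  define F where "F y = prim 0 r y + ln ((T - y) / T)" for y
  have F0: "F 0 = 0" using T by (simp add: F_def)
  have dF: "\<exists>d\<ge>0. (F has_real_derivative d) (at y)" if y: "y < T" for y
  proof -
    have "speed r y \<le> T - y"
    proof -
      have "r * exp y \<le> r * exp T" using param_range(1)[OF r] y by simp
      then show ?thesis using T by (simp add: speed_def)
    qed
    moreover have "0 < speed r y" using speed_pos_below[OF r] y by (simp add: T_def)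
    ultimately have "0 \<le> 1 / speed r y - 1 / (T - y)"
      using y by (simp add: frac_le)
    moreover have "(F has_real_derivative 1 / speed r y - 1 / (T - y)) (at y)"
      unfolding F_def[abs_def] using prim_derivative_y[OF r, of y 0] y T
      by (auto intro!: derivative_eq_intros simp: T_def real_integrand_def field_simps)
    ultimately show ?thesis by blast
  qed
  have F_mono: "F y \<le> F z" if "y \<le> z" "z < T" for y z
    by (rule DERIV_nonneg_imp_nondecreasing[OF that(1)]) (use dF that in \<open>meson le_less_trans\<close>)
  have cont: "continuous_on {a..b} (prim 0 r)" if "b < T" for a b
    using prim_derivative_y[OF r, THEN DERIV_isCont] that
    by (intro continuous_at_imp_continuous_on ballI) (auto simp: T_def)
  \<comment> \<open>This is the state at time \<open>x\<close> of the linear comparison equation.\<close>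
  define y where "y = T * (1 - exp (- x))"
  have yT: "y < T" using T by (simp add: y_def)
  have ln_y: "ln ((T - y) / T) = - x"
    using T by (simp add: y_def right_diff_distrib)
  show ?thesis
  proof (cases "0 \<le> x")
    case True
    then have "0 \<le> y" using T by (simp add: y_def)
    then have "x \<le> prim 0 r y"
      using F_mono[of 0 y] yT F0 ln_y by (simp add: F_def)
    then have "\<exists>z\<ge>0. z \<le> y \<and> prim 0 r z = x"
      using True \<open>0 \<le> y\<close> cont[OF yT] by (intro IVT') auto
    then show ?thesis using yT T_def by (metis le_less_trans)
  next
    case False
    then have "y \<le> 0" using T by (simp add: y_def mult_nonneg_nonpos)
    then have "prim 0 r y \<le> x"
      using F_mono[of y 0] T F0 ln_y by (simp add: F_def)
    then have "\<exists>z\<ge>y. z \<le> 0 \<and> prim 0 r z = x"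
      using False \<open>y \<le> 0\<close> cont[OF T(1)] by (intro IVT') auto
    then show ?thesis using T T_def by (metis le_less_trans)
  qed
qed

text \<open>
The state at time \<open>x\<close> of the solution that starts at \<open>0\<close>.
\<close>

definition flow :: "real \<Rightarrow> real \<Rightarrow> real" where
  "flow r x = (SOME y. y < equilibrium r \<and> prim 0 r y = x)"

lemma flow:
  assumes "r \<in> param_range"
  shows flow_less: "flow r x < equilibrium r" and prim_flow: "prim 0 r (flow r x) = x"
proof -
  have "\<exists>y. y < equilibrium r \<and> prim 0 r y = x"
    using prim_surj[OF assms] by blast
  from someI_ex[OF this]
  show "flow r x < equilibrium r" "prim 0 r (flow r x) = x"
    unfolding flow_def by auto
qed

lemma flow_prim:
  assumes "r \<in> param_range" "y < equilibrium r"
  shows "flow r (prim 0 r y) = y"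
  using prim_strict_mono[OF assms(1), of "flow r (prim 0 r y)" y 0]
    prim_strict_mono[OF assms(1), of y "flow r (prim 0 r y)" 0]
    flow[OF assms(1), of "prim 0 r y"] assms(2)
  by (metis less_irrefl linorder_neqE_linordered_idom)

lemma flow_0: "r \<in> param_range \<Longrightarrow> flow r 0 = 0"
  using flow_prim[of r 0] equilibrium_pos[of r] by simp

lemma isCont_flow_x:
  assumes "r \<in> param_range"
  shows "isCont (flow r) x"
proof -
  define y where "y = flow r x"
  have y: "y < equilibrium r" "prim 0 r y = x"
    using flow[OF assms] by (auto simp: y_def)
  show ?thesis
    unfolding isCont_def tendsto_iff
  proof (intro allI impI)
    fix e :: real assume "e > 0"
    define d where "d = min (e / 2) ((equilibrium r - y) / 2)"
    have d: "d > 0" "d < e" "y + d < equilibrium r"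
      using \<open>e > 0\<close> y by (auto simp: d_def min_def field_simps)
    have "prim 0 r (y - d) < x" "x < prim 0 r (y + d)"
      using prim_less_iff[OF assms, of "y - d" y 0] prim_less_iff[OF assms, of y "y + d" 0] d y by auto
    then have "\<forall>\<^sub>F x' in at x. prim 0 r (y - d) < x'" "\<forall>\<^sub>F x' in at x. x' < prim 0 r (y + d)"
      using order_tendstoD[OF tendsto_ident_at] by blast+
    then show "\<forall>\<^sub>F x' in at x. dist (flow r x') (flow r x) < e"
    proof eventually_elim
      case (elim x')
      then have "prim 0 r (y - d) < prim 0 r (flow r x')" "prim 0 r (flow r x') < prim 0 r (y + d)"
        using prim_flow[OF assms] by auto
      then have "y - d < flow r x'" "flow r x' < y + d"
        using prim_less_iff[OF assms, of "y - d" "flow r x'" 0]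
          prim_less_iff[OF assms, of "flow r x'" "y + d" 0] flow_less[OF assms, of x'] d by auto
      then show ?case using d by (auto simp: dist_real_def y_def)
    qed
  qed
qed

lemma flow_derivative_x:
  assumes "r \<in> param_range"
  shows "(flow r has_real_derivative speed r (flow r x)) (at x)"
proof -
  have "(flow r has_real_derivative inverse (real_integrand 0 r (flow r x))) (at x)"
  proof (rule DERIV_inverse_function[where a = "x - 1" and b = "x + 1"])
    show "(prim 0 r has_real_derivative real_integrand 0 r (flow r x)) (at (flow r x))"
      using prim_derivative_y flow_less assms by blast
    show "real_integrand 0 r (flow r x) \<noteq> 0"
      using real_integrand_pos[OF assms flow_less[OF assms]] by (metis less_irrefl)
    show "isCont (flow r) x" by (rule isCont_flow_x[OF assms])
  qed (use prim_flow[OF assms] in auto)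
  then show ?thesis by (simp add: real_integrand_def)
qed

section \<open>Dependence on the parameter\<close>

lemma eventually_below_equilibrium:
  assumes "r \<in> param_range" "y < equilibrium r"
  shows "\<exists>d>0. \<forall>\<rho> z. \<bar>\<rho> - r\<bar> < d \<longrightarrow> \<bar>z - y\<bar> < d \<longrightarrow> \<rho> \<in> param_range \<and> z < equilibrium \<rho>"
proof -
  define O' where "O' = {p::real \<times> real. 0 < fst p \<and> fst p < 1/3 \<and> snd p < 1 \<and> 0 < speed (fst p) (snd p)}"
  have "open O'"
    unfolding O'_def by (intro open_Collect_conj open_Collect_less continuous_intros)
  moreover have O'_iff: "(\<rho>, z) \<in> O' \<longleftrightarrow> \<rho> \<in> param_range \<and> z < equilibrium \<rho>" for \<rho> z
    using below_equilibrium_iff[of \<rho> z] by (auto simp: O'_def param_range_def)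
  ultimately obtain A B where AB: "open A" "open B" "(r, y) \<in> A \<times> B" "A \<times> B \<subseteq> O'"
    using assms open_prod_elim by metis
  obtain d1 where d1: "d1 > 0" "ball r d1 \<subseteq> A" using AB open_contains_ball_eq by blast
  obtain d2 where d2: "d2 > 0" "ball y d2 \<subseteq> B" using AB open_contains_ball_eq by blast
  have "\<rho> \<in> param_range \<and> z < equilibrium \<rho>" if "\<bar>\<rho> - r\<bar> < min d1 d2" "\<bar>z - y\<bar> < min d1 d2" for \<rho> z
  proof -
    have "\<rho> \<in> ball r d1" "z \<in> ball y d2" using that by (auto simp: dist_real_def)
    then have "(\<rho>, z) \<in> O'" using AB d1 d2 by blast
    then show ?thesis using O'_iff by blast
  qed
  then show ?thesis using d1 d2 by (intro exI[of _ "min d1 d2"]) auto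
qed

lemma isCont_flow_r:
  assumes "r \<in> param_range"
  shows "isCont (\<lambda>r. flow r x) r"
proof -
  define y where "y = flow r x"
  have y: "y < equilibrium r" "prim 0 r y = x"
    using flow[OF assms] by (auto simp: y_def)
  obtain d0 where d0: "d0 > 0" "\<And>\<rho> z. \<bar>\<rho> - r\<bar> < d0 \<Longrightarrow> \<bar>z - y\<bar> < d0 \<Longrightarrow> \<rho> \<in> param_range \<and> z < equilibrium \<rho>"
    using eventually_below_equilibrium[OF assms y(1)] by blast
  show ?thesis
    unfolding isCont_def tendsto_iff
  proof (intro allI impI)
    fix e :: real assume "e > 0"
    define d where "d = min (e / 2) (d0 / 2)"
    have d: "d > 0" "d < e" "d < d0"
      using \<open>e > 0\<close> d0 by (auto simp: d_def min_def field_simps)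
    have dom: "y + d < equilibrium \<rho>" "y - d < equilibrium \<rho>" "\<rho> \<in> param_range" if "\<bar>\<rho> - r\<bar> < d0" for \<rho>
      using d0(2)[OF that, of "y + d"] d0(2)[OF that, of "y - d"] d by auto
    have "prim 0 r (y - d) < x" "x < prim 0 r (y + d)"
      using prim_less_iff[OF assms, of "y - d" y 0] prim_less_iff[OF assms, of y "y + d" 0] d y dom[of r] d0(1)
      by auto
    moreover have "isCont (\<lambda>\<rho>. prim 0 \<rho> (y - d)) r" "isCont (\<lambda>\<rho>. prim 0 \<rho> (y + d)) r"
      using prim_derivative_r[OF assms] dom[of r] d0(1) by (auto intro: DERIV_isCont)
    ultimately have "\<forall>\<^sub>F \<rho> in at r. prim 0 \<rho> (y - d) < x" "\<forall>\<^sub>F \<rho> in at r. x < prim 0 \<rho> (y + d)"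
      unfolding isCont_def using order_tendstoD by blast+
    moreover have "\<forall>\<^sub>F \<rho> in at r. \<bar>\<rho> - r\<bar> < d0"
      using d0(1) unfolding eventually_at by (auto simp: dist_real_def)
    ultimately show "\<forall>\<^sub>F \<rho> in at r. dist (flow \<rho> x) (flow r x) < e"
    proof eventually_elim
      case (elim \<rho>)
      note \<rho> = dom[OF elim(3)]
      have "prim 0 \<rho> (y - d) < prim 0 \<rho> (flow \<rho> x)" "prim 0 \<rho> (flow \<rho> x) < prim 0 \<rho> (y + d)"
        using elim prim_flow[OF \<rho>(3)] by auto
      then have "y - d < flow \<rho> x" "flow \<rho> x < y + d"
        using prim_less_iff[OF \<rho>(3), of "y - d" "flow \<rho> x" 0]
          prim_less_iff[OF \<rho>(3), of "flow \<rho> x" "y + d" 0] flow_less[OF \<rho>(3), of x] \<rho> by auto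
      then show ?case using d by (auto simp: dist_real_def y_def)
    qed
  qed
qed

text \<open>
The mean value theorem in the state variable alone. Together with the partial derivative in \<open>r\<close> it
yields the implicit differentiation of the flow (for \<open>k = 0\<close>, where \<open>prim 0\<close> is constant along the
flow) and then the chain rule for the other primitives.
\<close>

lemma prim_increment_along_flow:
  assumes r: "r \<in> param_range"
  obtains h where "(h \<longlongrightarrow> real_integrand k r (flow r x)) (at r)"
    "\<forall>\<^sub>F \<rho> in at r. prim k \<rho> (flow \<rho> x) - prim k \<rho> (flow r x) = h \<rho> * (flow \<rho> x - flow r x)"
proof -
  define y where "y = flow r x"
  have y: "y < equilibrium r" using flow_less[OF r] by (simp add: y_def)
  obtain d where d: "d > 0" "\<And>\<rho> z. \<bar>\<rho> - r\<bar> < d \<Longrightarrow> \<bar>z - y\<bar> < d \<Longrightarrow> \<rho> \<in> param_range \<and> z < equilibrium \<rho>"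
    using eventually_below_equilibrium[OF r y] by blast
  have "\<exists>\<xi>. \<bar>\<xi> - y\<bar> \<le> \<bar>flow \<rho> x - y\<bar> \<and>
    prim k \<rho> (flow \<rho> x) - prim k \<rho> y = real_integrand k \<rho> \<xi> * (flow \<rho> x - y)"
    if \<rho>: "\<bar>\<rho> - r\<bar> < d" "\<bar>flow \<rho> x - y\<bar> < d" for \<rho>
  proof -
    have D: "(prim k \<rho> has_real_derivative real_integrand k \<rho> z) (at z)" if "\<bar>z - y\<bar> \<le> \<bar>flow \<rho> x - y\<bar>" for z
      using d(2)[OF \<rho>(1), of z] that \<rho>(2) prim_derivative_y by auto
    consider "flow \<rho> x < y" | "flow \<rho> x = y" | "y < flow \<rho> x" by linarith
    then show ?thesis
    proof cases
      case 1
      have "\<exists>z. flow \<rho> x < z \<and> z < y \<and> prim k \<rho> y - prim k \<rho> (flow \<rho> x) = (y - flow \<rho> x) * real_integrand k \<rho> z"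
        by (rule MVT2[OF 1]) (use D 1 in auto)
      then obtain z where "flow \<rho> x < z" "z < y"
        "prim k \<rho> y - prim k \<rho> (flow \<rho> x) = (y - flow \<rho> x) * real_integrand k \<rho> z" by blast
      then show ?thesis using 1 by (intro exI[of _ z]) (auto simp: algebra_simps)
    next
      case 2
      then show ?thesis by (intro exI[of _ y]) auto
    next
      case 3
      have "\<exists>z. y < z \<and> z < flow \<rho> x \<and> prim k \<rho> (flow \<rho> x) - prim k \<rho> y = (flow \<rho> x - y) * real_integrand k \<rho> z"
        by (rule MVT2[OF 3]) (use D 3 in auto)
      then obtain z where "y < z" "z < flow \<rho> x"
        "prim k \<rho> (flow \<rho> x) - prim k \<rho> y = (flow \<rho> x - y) * real_integrand k \<rho> z" by blast
      then show ?thesis using 3 by (intro exI[of _ z]) (auto simp: algebra_simps)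
    qed
  qed
  then have "\<exists>\<xi>. \<forall>\<rho>. \<bar>\<rho> - r\<bar> < d \<longrightarrow> \<bar>flow \<rho> x - y\<bar> < d \<longrightarrow> \<bar>\<xi> \<rho> - y\<bar> \<le> \<bar>flow \<rho> x - y\<bar> \<and>
    prim k \<rho> (flow \<rho> x) - prim k \<rho> y = real_integrand k \<rho> (\<xi> \<rho>) * (flow \<rho> x - y)"
    by (intro choice) blast
  then obtain \<xi> where \<xi>: "\<And>\<rho>. \<bar>\<rho> - r\<bar> < d \<Longrightarrow> \<bar>flow \<rho> x - y\<bar> < d \<Longrightarrow> \<bar>\<xi> \<rho> - y\<bar> \<le> \<bar>flow \<rho> x - y\<bar>"
    "\<And>\<rho>. \<bar>\<rho> - r\<bar> < d \<Longrightarrow> \<bar>flow \<rho> x - y\<bar> < d \<Longrightarrow>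
    prim k \<rho> (flow \<rho> x) - prim k \<rho> y = real_integrand k \<rho> (\<xi> \<rho>) * (flow \<rho> x - y)" by blast
  have flow_lim: "((\<lambda>\<rho>. flow \<rho> x) \<longlongrightarrow> y) (at r)"
    using isCont_flow_r[OF r] by (simp add: isCont_def y_def)
  have "\<forall>\<^sub>F \<rho> in at r. \<bar>\<rho> - r\<bar> < d"
    using d(1) unfolding eventually_at by (auto simp: dist_real_def)
  moreover have "\<forall>\<^sub>F \<rho> in at r. \<bar>flow \<rho> x - y\<bar> < d"
    using tendstoD[OF flow_lim d(1)] by (simp add: dist_real_def)
  ultimately have near: "\<forall>\<^sub>F \<rho> in at r. \<bar>\<rho> - r\<bar> < d \<and> \<bar>flow \<rho> x - y\<bar> < d"
    by eventually_elim simp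
  have "((\<lambda>\<rho>. \<xi> \<rho> - y) \<longlongrightarrow> 0) (at r)"
  proof (rule tendsto_rabs_zero_cancel, rule tendsto_sandwich)
    show "\<forall>\<^sub>F \<rho> in at r. 0 \<le> \<bar>\<xi> \<rho> - y\<bar>" by simp
    show "\<forall>\<^sub>F \<rho> in at r. \<bar>\<xi> \<rho> - y\<bar> \<le> \<bar>flow \<rho> x - y\<bar>"
      using near by eventually_elim (use \<xi> in blast)
    show "((\<lambda>\<rho>. \<bar>flow \<rho> x - y\<bar>) \<longlongrightarrow> 0) (at r)"
      using flow_lim by (intro tendsto_rabs_zero) (simp add: LIM_zero_iff)
  qed simp
  then have \<xi>_lim: "(\<xi> \<longlongrightarrow> y) (at r)"
    by (simp add: LIM_zero_iff)
  have "speed r y \<noteq> 0" using speed_pos_below[OF r y] by simp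
  then have "((\<lambda>\<rho>. real_integrand k \<rho> (\<xi> \<rho>)) \<longlongrightarrow> real_integrand k r y) (at r)"
    unfolding real_integrand_def speed_def by (intro tendsto_intros \<xi>_lim) auto
  moreover have "\<forall>\<^sub>F \<rho> in at r. prim k \<rho> (flow \<rho> x) - prim k \<rho> y = real_integrand k \<rho> (\<xi> \<rho>) * (flow \<rho> x - y)"
    using near by eventually_elim (use \<xi> in blast)
  ultimately show ?thesis
    using that unfolding y_def by blast
qed

lemma flow_derivative_r:
  assumes r: "r \<in> param_range"
  shows "((\<lambda>r. flow r x) has_real_derivative speed r (flow r x) * prim 1 r (flow r x)) (at r)"
proof -
  define y where "y = flow r x"
  have y: "y < equilibrium r" using flow_less[OF r] by (simp add: y_def)
  obtain h where h: "(h \<longlongrightarrow> real_integrand 0 r y) (at r)"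
    "\<forall>\<^sub>F \<rho> in at r. prim 0 \<rho> (flow \<rho> x) - prim 0 \<rho> y = h \<rho> * (flow \<rho> x - y)"
    using prim_increment_along_flow[OF r] unfolding y_def by blast
  have pos: "0 < real_integrand 0 r y" by (rule real_integrand_pos[OF r y])
  have "((\<lambda>\<rho>. (prim 0 \<rho> y - prim 0 r y) / (\<rho> - r)) \<longlongrightarrow> - prim 1 r y) (at r)"
    using prim_derivative_r[OF r y, of 0] by (simp add: has_field_derivative_iff)
  then have "((\<lambda>\<rho>. - ((prim 0 \<rho> y - prim 0 r y) / (\<rho> - r)) / h \<rho>) \<longlongrightarrow> - (- prim 1 r y) / real_integrand 0 r y) (at r)"
    using h(1) pos by (intro tendsto_intros) auto
  moreover have "\<forall>\<^sub>F \<rho> in at r. - ((prim 0 \<rho> y - prim 0 r y) / (\<rho> - r)) / h \<rho> = (flow \<rho> x - y) / (\<rho> - r)"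
  proof -
    have "\<forall>\<^sub>F \<rho> in at r. \<rho> \<in> param_range"
      using open_param_range r by (rule eventually_at_in_open')
    moreover have "\<forall>\<^sub>F \<rho> in at r. 0 < h \<rho>"
      using order_tendstoD(1)[OF h(1) pos] .
    ultimately show ?thesis using h(2)
    proof eventually_elim
      case (elim \<rho>)
      have "prim 0 \<rho> y - prim 0 r y = - (h \<rho> * (flow \<rho> x - y))"
        using elim prim_flow[OF r, of x] prim_flow[of \<rho> x] by (simp add: y_def)
      then show ?case using elim by simp
    qed
  qed
  ultimately have "((\<lambda>\<rho>. (flow \<rho> x - y) / (\<rho> - r)) \<longlongrightarrow> - (- prim 1 r y) / real_integrand 0 r y) (at r)"
    by (rule Lim_transform_eventually)
  moreover have "- (- prim 1 r y) / real_integrand 0 r y = speed r y * prim 1 r y"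
    using speed_pos_below[OF r y] by (simp add: real_integrand_def)
  ultimately show ?thesis
    by (simp add: has_field_derivative_iff y_def)
qed

lemma prim_along_flow_derivative_r:
  assumes r: "r \<in> param_range"
  shows "((\<lambda>r. prim k r (flow r x)) has_real_derivative
    - (of_nat (Suc k) * prim (Suc k) r (flow r x)) +
    real_integrand k r (flow r x) * (speed r (flow r x) * prim 1 r (flow r x))) (at r)"
proof -
  define y where "y = flow r x"
  have y: "y < equilibrium r" using flow_less[OF r] by (simp add: y_def)
  obtain h where h: "(h \<longlongrightarrow> real_integrand k r y) (at r)"
    "\<forall>\<^sub>F \<rho> in at r. prim k \<rho> (flow \<rho> x) - prim k \<rho> y = h \<rho> * (flow \<rho> x - y)"
    using prim_increment_along_flow[OF r] unfolding y_def by blast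
  have 1: "((\<lambda>\<rho>. (prim k \<rho> y - prim k r y) / (\<rho> - r)) \<longlongrightarrow> - (of_nat (Suc k) * prim (Suc k) r y)) (at r)"
    using prim_derivative_r[OF r y] unfolding has_field_derivative_iff .
  have 2: "((\<lambda>\<rho>. (flow \<rho> x - y) / (\<rho> - r)) \<longlongrightarrow> speed r y * prim 1 r y) (at r)"
    using flow_derivative_r[OF r] unfolding has_field_derivative_iff y_def .
  have "((\<lambda>\<rho>. (prim k \<rho> y - prim k r y) / (\<rho> - r) + h \<rho> * ((flow \<rho> x - y) / (\<rho> - r))) \<longlongrightarrow>
    - (of_nat (Suc k) * prim (Suc k) r y) + real_integrand k r y * (speed r y * prim 1 r y)) (at r)"
    by (intro tendsto_add tendsto_mult 1 2 h(1))
  moreover have "\<forall>\<^sub>F \<rho> in at r. (prim k \<rho> y - prim k r y) / (\<rho> - r) + h \<rho> * ((flow \<rho> x - y) / (\<rho> - r)) =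
    (prim k \<rho> (flow \<rho> x) - prim k r y) / (\<rho> - r)"
    using h(2)
  proof eventually_elim
    case (elim \<rho>)
    have "h \<rho> * ((flow \<rho> x - y) / (\<rho> - r)) = (prim k \<rho> (flow \<rho> x) - prim k \<rho> y) / (\<rho> - r)"
      unfolding elim by simp
    then show ?case by (simp add: diff_divide_distrib)
  qed
  ultimately have "((\<lambda>\<rho>. (prim k \<rho> (flow \<rho> x) - prim k r y) / (\<rho> - r)) \<longlongrightarrow>
    - (of_nat (Suc k) * prim (Suc k) r y) + real_integrand k r y * (speed r y * prim 1 r y)) (at r)"
    by (rule Lim_transform_eventually)
  then show ?thesis
    unfolding has_field_derivative_iff y_def .
qed

section \<open>Jets of the flow in the parameter\<close>

text \<open>
The variables \<open>w j\<close> stand for the primitives. Bounding their index by \<open>k\<close> is what makes the system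
for the jets triangular; differentiation along the flow raises the bound by one.
\<close>

inductive flow_poly :: "nat \<Rightarrow> (real \<Rightarrow> real \<Rightarrow> (nat \<Rightarrow> real) \<Rightarrow> real) \<Rightarrow> bool" for k where
  const: "flow_poly k (\<lambda>_ _ _. c)"
| param: "flow_poly k (\<lambda>r _ _. r)"
| state: "flow_poly k (\<lambda>_ y _. y)"
| exp: "flow_poly k (\<lambda>_ y _. exp y)"
| inverse: "flow_poly k (\<lambda>r y _. inverse (speed r y))"
| prim: "j < k \<Longrightarrow> flow_poly k (\<lambda>_ _ w. w j)"
| add: "flow_poly k R \<Longrightarrow> flow_poly k S \<Longrightarrow> flow_poly k (\<lambda>r y w. R r y w + S r y w)"
| mult: "flow_poly k R \<Longrightarrow> flow_poly k S \<Longrightarrow> flow_poly k (\<lambda>r y w. R r y w * S r y w)"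

lemma flow_poly_mono:
  assumes "flow_poly k R" "k \<le> l"
  shows "flow_poly l R"
  using assms by (induction rule: flow_poly.induct) (auto intro: flow_poly.intros)

lemma flow_poly_cong:
  assumes "flow_poly k R" "\<And>j. j < k \<Longrightarrow> w j = w' j"
  shows "R r y w = R r y w'"
  using assms by (induction rule: flow_poly.induct) auto

lemma flow_poly_power: "flow_poly k R \<Longrightarrow> flow_poly k (\<lambda>r y w. R r y w ^ n)"
  by (induction n) (auto intro: flow_poly.intros)

lemma flow_poly_uminus: "flow_poly k R \<Longrightarrow> flow_poly k (\<lambda>r y w. - R r y w)"
  using flow_poly.mult[OF flow_poly.const[of k "-1"], of R] by simp

lemma flow_poly_diff:
  "flow_poly k R \<Longrightarrow> flow_poly k S \<Longrightarrow> flow_poly k (\<lambda>r y w. R r y w - S r y w)"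
  using flow_poly.add[of k R "\<lambda>r y w. - S r y w"] flow_poly_uminus by simp

lemma flow_poly_speed: "flow_poly k (\<lambda>r y _. speed r y)"
  unfolding speed_def by (intro flow_poly_diff flow_poly.intros)

lemmas flow_poly_intros = flow_poly_diff flow_poly_uminus flow_poly_power flow_poly_speed flow_poly.intros

lemma flow_poly_in_primitive_polys:
  "flow_poly k R \<Longrightarrow> (\<lambda>y w. R r y w) \<in> primitive_polys r"
proof (induction rule: flow_poly.induct)
  case (const c)
  show ?case by (rule primitive_polys_coeff[of "\<lambda>_. of_real c"]) (auto intro: merom_const)
next
  case param
  show ?case by (rule primitive_polys_coeff[of "\<lambda>_. of_real r"]) (auto intro: merom_const)
next
  case state
  show ?case by (rule primitive_polys_coeff[of "\<lambda>z. z"]) (auto intro: merom_entire holomorphic_intros)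
next
  case exp
  show ?case
    by (rule primitive_polys_coeff[of "exp"]) (auto intro: merom_entire holomorphic_intros simp: exp_of_real)
next
  case inverse
  show ?case
    by (rule primitive_polys_coeff[of "\<lambda>z. inverse (cspeed r z)"]) (auto intro: merom_inverse simp: cspeed_of_real)
qed (auto intro: primitive_polys_var primitive_polys_add primitive_polys_mult)

definition along_flow :: "(real \<Rightarrow> real \<Rightarrow> (nat \<Rightarrow> real) \<Rightarrow> real) \<Rightarrow> real \<Rightarrow> real \<Rightarrow> real" where
  "along_flow R x r = R r (flow r x) (\<lambda>j. prim j r (flow r x))"

lemma speed_along_flow_derivative:
  assumes "r \<in> param_range"
  shows "((\<lambda>r. speed r (flow r x)) has_real_derivative
    exp (flow r x) + (r * exp (flow r x) - 1) * (speed r (flow r x) * prim 1 r (flow r x))) (at r)"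
proof -
  define d where "d = speed r (flow r x) * prim 1 r (flow r x)"
  have "((\<lambda>r. flow r x) has_real_derivative d) (at r)"
    unfolding d_def by (rule flow_derivative_r[OF assms])
  then have "((\<lambda>r. r * exp (flow r x) - flow r x) has_real_derivative
    exp (flow r x) + (r * exp (flow r x) - 1) * d) (at r)"
    by (auto intro!: derivative_eq_intros simp: algebra_simps)
  then show ?thesis
    unfolding d_def speed_def .
qed

lemma flow_poly_derivative:
  assumes "flow_poly k R" "1 \<le> k"
  shows "\<exists>R'. flow_poly (Suc k) R' \<and>
    (\<forall>x. \<forall>r\<in>param_range. (along_flow R x has_real_derivative along_flow R' x r) (at r))"
  using assms(1)
proof (induction rule: flow_poly.induct)
  case (const c)
  show ?case
    by (rule exI[of _ "\<lambda>_ _ _. 0"]) (auto simp: along_flow_def[abs_def] intro: flow_poly.intros)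
next
  case param
  show ?case
    by (rule exI[of _ "\<lambda>_ _ _. 1"]) (auto simp: along_flow_def[abs_def] intro: flow_poly.intros)
next
  case state
  show ?case
    by (rule exI[of _ "\<lambda>r y w. speed r y * w 1"])
      (use assms(2) flow_derivative_r in \<open>auto simp: along_flow_def[abs_def] intro!: flow_poly_intros\<close>)
next
  case exp
  show ?case
    by (rule exI[of _ "\<lambda>r y w. exp y * (speed r y * w 1)"])
      (use assms(2) DERIV_fun_exp[OF flow_derivative_r] in \<open>auto simp: along_flow_def[abs_def] intro!: flow_poly_intros\<close>)
next
  case inverse
  let ?R' = "\<lambda>r y w. - (inverse (speed r y) ^ 2 * (exp y + (r * exp y - 1) * (speed r y * w 1)))"
  have "flow_poly (Suc k) ?R'"
    using assms(2) by (intro flow_poly_intros) auto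
  moreover have "(along_flow (\<lambda>r y _. inverse (speed r y)) x has_real_derivative along_flow ?R' x r) (at r)"
    if "r \<in> param_range" for x r
  proof -
    have "speed r (flow r x) \<noteq> 0"
      using speed_pos_below[OF that flow_less[OF that]] by (metis less_irrefl)
    from DERIV_inverse_fun[OF speed_along_flow_derivative[OF that] this]
    show ?thesis
      unfolding along_flow_def by (simp add: power2_eq_square algebra_simps)
  qed
  ultimately show ?case by blast
next
  case (prim j)
  let ?R' = "\<lambda>r y w. - (of_nat (Suc j) * w (Suc j)) + exp y ^ j * inverse (speed r y) ^ Suc j * (speed r y * w 1)"
  have "flow_poly (Suc k) ?R'"
    using assms(2) prim by (intro flow_poly_intros) auto
  moreover have "(along_flow (\<lambda>_ _ w. w j) x has_real_derivative along_flow ?R' x r) (at r)"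
    if "r \<in> param_range" for x r
    using prim_along_flow_derivative_r[OF that, of j x]
    unfolding along_flow_def[abs_def] real_integrand_def divide_inverse power_inverse .
  ultimately show ?case by blast
next
  case (add R S)
  then obtain R' S' where "flow_poly (Suc k) R'" "flow_poly (Suc k) S'"
    "\<forall>x. \<forall>r\<in>param_range. (along_flow R x has_real_derivative along_flow R' x r) (at r)"
    "\<forall>x. \<forall>r\<in>param_range. (along_flow S x has_real_derivative along_flow S' x r) (at r)" by blast
  then show ?case
    by (intro exI[of _ "\<lambda>r y w. R' r y w + S' r y w"])
      (auto simp: along_flow_def[abs_def] intro!: flow_poly.intros DERIV_add)
next
  case (mult R S)
  then obtain R' S' where RS: "flow_poly (Suc k) R'" "flow_poly (Suc k) S'"
    "\<forall>x. \<forall>r\<in>param_range. (along_flow R x has_real_derivative along_flow R' x r) (at r)"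
    "\<forall>x. \<forall>r\<in>param_range. (along_flow S x has_real_derivative along_flow S' x r) (at r)" by blast
  have "flow_poly (Suc k) R" "flow_poly (Suc k) S"
    using mult.hyps flow_poly_mono[of k _ "Suc k"] by auto
  with RS(1,2) have "flow_poly (Suc k) (\<lambda>r y w. R' r y w * S r y w + S' r y w * R r y w)"
    by (intro flow_poly.intros)
  moreover have "(along_flow (\<lambda>r y w. R r y w * S r y w) x has_real_derivative
      along_flow (\<lambda>r y w. R' r y w * S r y w + S' r y w * R r y w) x r) (at r)" if "r \<in> param_range" for x r
    using DERIV_mult[OF RS(3)[rule_format, OF that] RS(4)[rule_format, OF that], of x x]
    by (simp add: along_flow_def[abs_def])
  ultimately show ?case by blast
qed

text \<open>
The common properties of the two components of the solution as functions of parameter and state.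
The factor \<open>c\<close> of the first primitive reappears, up to a nonzero constant, as the factor of the
primitive of index \<open>k\<close> in the derivative of order \<open>k\<close>, so it must not vanish.
\<close>

locale flow_observable =
  fixes F c e :: "real \<Rightarrow> real \<Rightarrow> real"
  assumes derivative: "\<And>r x. r \<in> param_range \<Longrightarrow> ((\<lambda>r. F r (flow r x)) has_real_derivative
      c r (flow r x) * prim 1 r (flow r x) + e r (flow r x)) (at r)"
    and polys: "flow_poly 0 (\<lambda>r y _. F r y)" "flow_poly 0 (\<lambda>r y _. c r y)" "flow_poly 0 (\<lambda>r y _. e r y)"
    and nondegenerate: "\<And>r y. r \<in> param_range \<Longrightarrow> y < equilibrium r \<Longrightarrow> c r y \<noteq> 0"
    and nonconstant: "\<And>r. r \<in> param_range \<Longrightarrow> infinite (F r ` {..<equilibrium r})"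
begin

lemma higher_derivatives:
  "\<exists>\<kappa> R. \<kappa> \<noteq> 0 \<and> flow_poly (Suc k) R \<and> (\<forall>x. \<forall>r\<in>param_range.
    (deriv ^^ Suc k) (\<lambda>r. F r (flow r x)) r =
      \<kappa> * c r (flow r x) * prim (Suc k) r (flow r x) + along_flow R x r \<and>
    ((deriv ^^ k) (\<lambda>r. F r (flow r x)) has_real_derivative
      (deriv ^^ Suc k) (\<lambda>r. F r (flow r x)) r) (at r))"
proof (induction k)
  case 0
  have "flow_poly 1 (\<lambda>r y _. e r y)"
    using polys(3) flow_poly_mono by blast
  then show ?case
    using derivative DERIV_imp_deriv[OF derivative]
    by (intro exI[of _ 1] exI[of _ "\<lambda>r y _. e r y"]) (auto simp: along_flow_def)
next
  case (Suc k)
  then obtain \<kappa> R where \<kappa>: "\<kappa> \<noteq> 0" and R: "flow_poly (Suc k) R"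
    and eq: "\<And>x r. r \<in> param_range \<Longrightarrow> (deriv ^^ Suc k) (\<lambda>r. F r (flow r x)) r =
      \<kappa> * c r (flow r x) * prim (Suc k) r (flow r x) + along_flow R x r" by blast
  have "flow_poly 1 (\<lambda>r y _. c r y)"
    using polys(2) flow_poly_mono by blast
  from flow_poly_derivative[OF this] obtain c' where c': "flow_poly 2 c'"
    "\<And>x r. r \<in> param_range \<Longrightarrow> ((\<lambda>r. c r (flow r x)) has_real_derivative along_flow c' x r) (at r)"
    by (auto simp: along_flow_def[abs_def] numeral_2_eq_2)
  obtain R' where R': "flow_poly (Suc (Suc k)) R'"
    "\<And>x r. r \<in> param_range \<Longrightarrow> (along_flow R x has_real_derivative along_flow R' x r) (at r)"
    using flow_poly_derivative[OF R] by auto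
  define \<kappa>' where "\<kappa>' = - (\<kappa> * of_nat (Suc (Suc k)))"
  define S where "S r y w = \<kappa> * (c' r y w * w (Suc k) +
    c r y * (exp y ^ Suc k * inverse (speed r y) ^ Suc (Suc k) * (speed r y * w 1))) + R' r y w" for r y w
  have "flow_poly (Suc (Suc k)) S"
    unfolding S_def[abs_def] using R'(1) flow_poly_mono[OF c'(1)] flow_poly_mono[OF polys(2)]
    by (intro flow_poly_intros) auto
  moreover have der: "((deriv ^^ Suc k) (\<lambda>r. F r (flow r x)) has_real_derivative
      \<kappa>' * c r (flow r x) * prim (Suc (Suc k)) r (flow r x) + along_flow S x r) (at r)"
    if r: "r \<in> param_range" for x r
  proof -
    have "((\<lambda>r. \<kappa> * (c r (flow r x) * prim (Suc k) r (flow r x)) + along_flow R x r) has_real_derivative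
      \<kappa> * (along_flow c' x r * prim (Suc k) r (flow r x) +
        (- (of_nat (Suc (Suc k)) * prim (Suc (Suc k)) r (flow r x)) +
          real_integrand (Suc k) r (flow r x) * (speed r (flow r x) * prim 1 r (flow r x))) * c r (flow r x)) +
      along_flow R' x r) (at r)"
      by (intro DERIV_add DERIV_cmult DERIV_mult c' R' prim_along_flow_derivative_r r)
    also have "\<kappa> * (along_flow c' x r * prim (Suc k) r (flow r x) +
        (- (of_nat (Suc (Suc k)) * prim (Suc (Suc k)) r (flow r x)) +
          real_integrand (Suc k) r (flow r x) * (speed r (flow r x) * prim 1 r (flow r x))) * c r (flow r x)) +
      along_flow R' x r = \<kappa>' * c r (flow r x) * prim (Suc (Suc k)) r (flow r x) + along_flow S x r"
      unfolding along_flow_def S_def \<kappa>'_def real_integrand_def divide_inverse power_inverse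
      by (simp add: algebra_simps del: of_nat_Suc power_Suc)
    finally show ?thesis
      by (rule has_field_derivative_transform_within_open[OF _ open_param_range r])
        (simp only: eq mult.assoc)
  qed
  moreover have "\<kappa>' \<noteq> 0"
    unfolding \<kappa>'_def using \<kappa> by (simp del: of_nat_Suc)
  ultimately show ?case
    using DERIV_imp_deriv[OF der] by (intro exI[of _ \<kappa>'] exI[of _ S]) auto
qed

lemma smooth: "smooth_on (\<lambda>r. F r (flow r x)) param_range"
  unfolding smooth_on_def using higher_derivatives by blast

text \<open>
Substituting the triangular formulas for the derivatives turns \<open>p\<close> into a polynomial in the
primitives. It has uncountably many zeros on the curve of actual primitives, so it vanishes for
arbitrary values \<open>w\<close> of them. The triangular system can be solved for \<open>w\<close>, so the derivatives of
positive order are arbitrary too. The derivative of order \<open>0\<close> still ranges over the infinitely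
many values of \<open>F r\<close>, which is enough for a polynomial.
\<close>

lemma jets_independent:
  assumes r: "r \<in> param_range" and p: "p \<in> jet_polys"
    and unc: "uncountable {x. p (jet (\<lambda>r. F r (flow r x)) r) = 0}"
    and v: "v 0 = r"
  shows "p v = 0"
proof -
  obtain \<kappa> R where \<kappa>: "\<And>k. \<kappa> k \<noteq> 0" and R: "\<And>k. flow_poly (Suc k) (R k)"
    and der: "\<And>k x. (deriv ^^ Suc k) (\<lambda>r. F r (flow r x)) r =
      \<kappa> k * c r (flow r x) * prim (Suc k) r (flow r x) + along_flow (R k) x r"
    using higher_derivatives r by metis
  define V where "V y w = case_nat r (case_nat (F r y) (\<lambda>k. \<kappa> k * c r y * w (Suc k) + R k r y w))" for y w
  have V: "(\<lambda>y w. V y w i) \<in> primitive_polys r" for i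
  proof (cases i)
    case 0
    then show ?thesis
      using flow_poly_in_primitive_polys[OF flow_poly.param, of r] by (simp add: V_def)
  next
    case (Suc j)
    show ?thesis
    proof (cases j)
      case 0
      then show ?thesis
        using Suc flow_poly_in_primitive_polys[OF polys(1), of r] by (simp add: V_def)
    next
      case (Suc k)
      have "(\<lambda>y w. (\<kappa> k * c r y) * w (Suc k) + R k r y w) \<in> primitive_polys r"
        by (rule flow_poly_in_primitive_polys[of "Suc (Suc k)" "\<lambda>r y w. (\<kappa> k * c r y) * w (Suc k) + R k r y w"])
          (use flow_poly_mono[OF R[of k]] flow_poly_mono[OF polys(2)] in \<open>auto intro!: flow_poly_intros\<close>)
      then show ?thesis using \<open>i = Suc j\<close> Suc by (simp add: V_def)
    qed
  qed
  from p have h: "(\<lambda>y w. p (V y w)) \<in> primitive_polys r"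
  proof (induction rule: jet_polys.induct)
    case (const a)
    then show ?case using flow_poly_in_primitive_polys[OF flow_poly.const] by blast
  qed (auto intro: V primitive_polys_add primitive_polys_mult)
  have jet: "jet (\<lambda>r. F r (flow r x)) r = V (flow r x) (\<lambda>i. prim i r (flow r x))" for x
  proof
    fix i
    show "jet (\<lambda>r. F r (flow r x)) r i = V (flow r x) (\<lambda>i. prim i r (flow r x)) i"
      using der[of _ x] by (auto simp: jet_def V_def along_flow_def split: nat.split simp del: funpow.simps)
  qed
  have vanish: "p (V y w) = 0" if "y < equilibrium r" for y w
  proof (rule primitive_poly_vanishes[OF param_range(1)[OF r] param_range(2)[OF r] _ h _ that])
    show "(prim i r has_real_derivative exp y ^ i / speed r y ^ Suc i) (at y)" if "y < equilibrium r" for i y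
      using prim_derivative_y[OF r that] unfolding real_integrand_def .
    show "uncountable {y. y < equilibrium r \<and> p (V y (\<lambda>i. prim i r y)) = 0}"
    proof
      assume "countable {y. y < equilibrium r \<and> p (V y (\<lambda>i. prim i r y)) = 0}"
      then have "countable (prim 0 r ` {y. y < equilibrium r \<and> p (V y (\<lambda>i. prim i r y)) = 0})"
        by (rule countable_image)
      moreover have "{x. p (jet (\<lambda>r. F r (flow r x)) r) = 0} \<subseteq>
        prim 0 r ` {y. y < equilibrium r \<and> p (V y (\<lambda>i. prim i r y)) = 0}"
      proof
        fix x assume "x \<in> {x. p (jet (\<lambda>r. F r (flow r x)) r) = 0}"
        then have "flow r x \<in> {y. y < equilibrium r \<and> p (V y (\<lambda>i. prim i r y)) = 0}"
          using flow_less[OF r] by (simp add: jet)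
        then show "x \<in> prim 0 r ` {y. y < equilibrium r \<and> p (V y (\<lambda>i. prim i r y)) = 0}"
          using prim_flow[OF r, of x] by (metis imageI)
      qed
      ultimately show False using unc countable_subset by blast
    qed
  qed
  obtain K where K: "\<And>v w. (\<And>i. i < K \<Longrightarrow> v i = w i) \<Longrightarrow> p v = p w"
    using jet_polys_finite_dependence[OF p] by blast
  have zero: "p u = 0" if u: "u 0 = r" "u 1 = F r y" and y: "y < equilibrium r" for u y
  proof -
    have "\<exists>w. \<forall>k<n. \<kappa> k * c r y * w (Suc k) + R k r y w = u (Suc (Suc k))" for n
    proof (induction n)
      case (Suc n)
      then obtain w where w: "\<forall>k<n. \<kappa> k * c r y * w (Suc k) + R k r y w = u (Suc (Suc k))" by blast
      define w' where "w' = w(Suc n := (u (Suc (Suc n)) - R n r y w) / (\<kappa> n * c r y))"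
      have "R k r y w' = R k r y w" if "k \<le> n" for k
        using R[of k] by (rule flow_poly_cong) (use that in \<open>auto simp: w'_def\<close>)
      then have "\<forall>k<Suc n. \<kappa> k * c r y * w' (Suc k) + R k r y w' = u (Suc (Suc k))"
        using w \<kappa>[of n] nondegenerate[OF r y] by (auto simp: w'_def less_Suc_eq)
      then show ?case by blast
    qed simp
    then obtain w where w: "\<forall>k<K. \<kappa> k * c r y * w (Suc k) + R k r y w = u (Suc (Suc k))" by blast
    have "u i = V y w i" if "i < K" for i
      using u w that by (auto simp: V_def split: nat.split)
    then show ?thesis using K vanish[OF y] by metis
  qed
  have "\<exists>g. \<forall>t. p (v(1 := t)) = poly g t"
    using p
  proof (induction rule: jet_polys.induct)
    case (const a)
    show ?case by (rule exI[of _ "[:a:]"]) simp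
  next
    case (var i)
    show ?case
      by (cases "i = 1") (auto intro: exI[of _ "[:0, 1:]"] exI[of _ "[:v i:]"])
  next
    case (add p q)
    then show ?case by (metis poly_add)
  next
    case (mult p q)
    then show ?case by (metis poly_mult)
  qed
  then obtain g where g: "\<And>t. p (v(1 := t)) = poly g t" by blast
  have "F r ` {..<equilibrium r} \<subseteq> {t. poly g t = 0}"
    using zero[of "v(1 := _)"] v by (auto simp flip: g)
  then have "g = 0"
    using poly_roots_finite[of g] nonconstant[OF r] finite_subset by blast
  then show ?thesis
    using g[of "v 1"] by simp
qed

theorem countable_DA: "countable {x. differentially_algebraic_on (\<lambda>r. F r (flow r x)) param_range}"
proof (rule countable_DA_if_jets_independent[OF open_param_range _ smooth])
  show "(1/4 :: real) \<in> param_range" by (simp add: param_range_def)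
  then show "\<forall>v. v 0 = 1/4 \<longrightarrow> p v = 0"
    if "p \<in> jet_polys" "uncountable {x. p (jet (\<lambda>r. F r (flow r x)) (1/4)) = 0}" for p
    using jets_independent that by blast
qed

end

lemma flow_observable_first: "flow_observable (\<lambda>r y. y) speed (\<lambda>_ _. 0)"
proof
  show "infinite ((\<lambda>y. y) ` {..<equilibrium r})" for r
    by (simp add: infinite_Iio)
  show "speed r y \<noteq> 0" if "r \<in> param_range" "y < equilibrium r" for r y
    using speed_pos_below[OF that] by simp
  show "((\<lambda>r. flow r x) has_real_derivative speed r (flow r x) * prim 1 r (flow r x) + 0) (at r)"
    if "r \<in> param_range" for r x
    using flow_derivative_r[OF that] by simp
qed (auto intro: flow_poly_intros)

lemma flow_observable_second:
  "flow_observable (\<lambda>r y. r * exp y) (\<lambda>r y. r * exp y * speed r y) (\<lambda>_ y. exp y)"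
proof
  show "infinite ((\<lambda>y. r * exp y) ` {..<equilibrium r})" if "r \<in> param_range" for r
    using param_range(1)[OF that] by (subst finite_image_iff) (auto simp: inj_on_def infinite_Iio)
  show "r * exp y * speed r y \<noteq> 0" if "r \<in> param_range" "y < equilibrium r" for r y
    using speed_pos_below[OF that] param_range(1)[OF that(1)] by simp
  show "((\<lambda>r. r * exp (flow r x)) has_real_derivative
      r * exp (flow r x) * speed r (flow r x) * prim 1 r (flow r x) + exp (flow r x)) (at r)"
    if "r \<in> param_range" for r x
    using flow_derivative_r[OF that, of x] by (auto intro!: derivative_eq_intros simp: algebra_simps)
qed (auto intro!: flow_poly_intros)

section \<open>Identification of the maximal solutions\<close>

lemma ivp_solution_flow:
  assumes "r \<in> param_range"
  shows "ivp_solution 0 r UNIV (flow r) (\<lambda>t. r * exp (flow r t))"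
  unfolding ivp_solution_def
proof (intro conjI ballI)
  fix t
  show "(flow r has_real_derivative r * exp (flow r t) - flow r t) (at t)"
    using flow_derivative_x[OF assms] by (simp add: speed_def)
  show "((\<lambda>t. r * exp (flow r t)) has_real_derivative
      r * exp (flow r t) * (r * exp (flow r t) - flow r t)) (at t)"
    using flow_derivative_x[OF assms, of t]
    by (auto intro!: derivative_eq_intros simp: speed_def)
qed (use flow_0[OF assms] in auto)

text \<open>
The first integral \<open>v * exp (- u)\<close> reduces the system to the scalar equation. Uniqueness for that
is Gronwall's argument applied to the square of the difference \<open>d\<close> to the flow. Backwards in time,
monotonicity of \<open>exp\<close> already gives the sign; forwards, a bound for \<open>u\<close> on the compact interval is
needed.
\<close>

lemma ivp_solution_unique:
  assumes r: "r \<in> param_range" and sol: "ivp_solution 0 r J u v" and t: "t \<in> J"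
  shows "u t = flow r t" "v t = r * exp (flow r t)"
proof -
  have J: "open J" "is_interval J" "0 \<in> J" "u 0 = 0" "v 0 = r"
    and u: "\<And>t. t \<in> J \<Longrightarrow> (u has_real_derivative v t - u t) (at t)"
    and v: "\<And>t. t \<in> J \<Longrightarrow> (v has_real_derivative v t * (v t - u t)) (at t)"
    using sol by (auto simp: ivp_solution_def)
  have v_eq: "v t = r * exp (u t)" if "t \<in> J" for t
  proof -
    have "\<exists>a. \<forall>t\<in>J. v t * exp (- u t) = a"
    proof (rule has_field_derivative_zero_constant)
      show "convex J" using J(2) by (rule is_interval_convex)
      fix t assume "t \<in> J"
      then have "((\<lambda>t. v t * exp (- u t)) has_real_derivative 0) (at t)"
        using u v by (auto intro!: derivative_eq_intros simp: algebra_simps)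
      then show "((\<lambda>t. v t * exp (- u t)) has_real_derivative 0) (at t within J)"
        by (rule has_field_derivative_at_within)
    qed
    then obtain a where a: "\<And>t. t \<in> J \<Longrightarrow> v t * exp (- u t) = a" by blast
    have "a = r" using a[OF J(3)] J by simp
    then show ?thesis using a[OF that] by (simp add: exp_minus field_simps)
  qed
  define d where "d s = u s - flow r s" for s
  have d0: "d 0 = 0" using J flow_0[OF r] by (simp add: d_def)
  define E where "E s = exp (u s) - exp (flow r s)" for s
  have d': "(d has_real_derivative r * E s - d s) (at s)" if "s \<in> J" for s
    unfolding d_def[abs_def] E_def using u[OF that] flow_derivative_x[OF r, of s] v_eq[OF that]
    by (auto intro!: derivative_eq_intros simp: speed_def algebra_simps)
  have sub: "closed_segment 0 t \<subseteq> J"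
    using J t by (meson closed_segment_subset is_interval_convex)
  have "d t ^ 2 = 0"
  proof (cases "0 \<le> t")
    case True
    then have seg: "{0..t} \<subseteq> J" using sub by (simp add: closed_segment_eq_real_ivl)
    have "continuous_on {0..t} u"
      using u seg by (intro continuous_at_imp_continuous_on ballI) (blast intro: DERIV_isCont)
    then have "bdd_above (u ` {0..t})"
      by (intro bounded_imp_bdd_above compact_imp_bounded compact_continuous_image) auto
    then obtain C0 where C0: "\<And>s. s \<in> {0..t} \<Longrightarrow> u s \<le> C0"
      unfolding bdd_above_def by blast
    define C where "C = max C0 1"
    have C: "u s \<le> C" "flow r s \<le> C" if "s \<in> {0..t}" for s
      using C0[OF that] flow_less[OF r, of s] equilibrium_less_1[OF r] by (auto simp: C_def)
    have dE: "d s * E s \<le> exp C * d s ^ 2" if s: "s \<in> {0..t}" for s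
    proof -
      have le: "(a - b) * (exp a - exp b) \<le> exp C * (a - b) ^ 2" if "b \<le> a" "a \<le> C" for a b :: real
      proof -
        have "exp a * (1 + (b - a)) \<le> exp a * exp (b - a)"
          by (intro mult_left_mono exp_ge_add_one_self) auto
        then have "exp a - exp b \<le> exp a * (a - b)"
          by (simp add: algebra_simps flip: exp_add)
        also have "\<dots> \<le> exp C * (a - b)"
          using that by (intro mult_right_mono) auto
        finally have "(a - b) * (exp a - exp b) \<le> (a - b) * (exp C * (a - b))"
          using that by (intro mult_left_mono) auto
        then show ?thesis by (simp add: power2_eq_square algebra_simps)
      qed
      have sym: "(a - b) * (exp a - exp b) = (b - a) * (exp b - exp a)" for a b :: real
        by (simp add: algebra_simps)
      show ?thesis
        using le[of "flow r s" "u s"] le[of "u s" "flow r s"] C[OF s] sym[of "u s" "flow r s"]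
        by (cases "flow r s \<le> u s") (auto simp: d_def E_def power2_commute)
    qed
    define K where "K = 2 * r * exp C"
    have "d t ^ 2 * exp (- K * t) \<le> d 0 ^ 2 * exp (- K * 0)"
    proof (rule DERIV_nonpos_imp_nonincreasing[OF True])
      fix s assume "0 \<le> s" "s \<le> t"
      then have s: "s \<in> {0..t}" by simp
      have "((\<lambda>s. d s ^ 2 * exp (- K * s)) has_real_derivative
        (2 * (r * (d s * E s)) - 2 * d s ^ 2 - K * d s ^ 2) * exp (- K * s)) (at s)"
        using d'[of s] s seg
        by (auto intro!: derivative_eq_intros simp: algebra_simps power2_eq_square)
      moreover have "2 * (r * (d s * E s)) - 2 * d s ^ 2 - K * d s ^ 2 \<le> 0"
      proof -
        have "r * (d s * E s) \<le> r * (exp C * d s ^ 2)"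
          using param_range(1)[OF r] by (intro mult_left_mono dE s) auto
        moreover have "K * d s ^ 2 = 2 * (r * (exp C * d s ^ 2))"
          by (simp add: K_def)
        ultimately show ?thesis
          using zero_le_power2[of "d s"] by linarith
      qed
      ultimately show "\<exists>l. ((\<lambda>s. d s ^ 2 * exp (- K * s)) has_real_derivative l) (at s) \<and> l \<le> 0"
        by (meson mult_nonpos_nonneg exp_ge_zero)
    qed
    then show ?thesis
      using d0 by (simp add: mult_le_0_iff)
  next
    case False
    then have t0: "t \<le> 0" by simp
    then have seg: "{t..0} \<subseteq> J"
      using sub by (auto simp: closed_segment_eq_real_ivl split: if_splits)
    have "d t ^ 2 * exp (2 * t) \<le> d 0 ^ 2 * exp (2 * 0)"
    proof (rule DERIV_nonneg_imp_nondecreasing[OF t0])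
      fix s assume "t \<le> s" "s \<le> 0"
      then have s: "s \<in> J" using seg by auto
      have "((\<lambda>s. d s ^ 2 * exp (2 * s)) has_real_derivative
        (2 * r * (d s * E s)) * exp (2 * s)) (at s)"
        using d'[OF s]
        by (auto intro!: derivative_eq_intros simp: algebra_simps power2_eq_square)
      moreover have "0 \<le> d s * E s"
        unfolding d_def E_def by (cases "flow r s \<le> u s") (auto intro: mult_nonneg_nonneg mult_nonpos_nonpos)
      ultimately show "\<exists>l. ((\<lambda>s. d s ^ 2 * exp (2 * s)) has_real_derivative l) (at s) \<and> 0 \<le> l"
        using param_range(1)[OF r] by (meson mult_nonneg_nonneg exp_ge_zero less_imp_le zero_le_numeral)
    qed
    then show ?thesis
      using d0 by (simp add: mult_le_0_iff)
  qed
  then show "u t = flow r t" by (simp add: d_def)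
  then show "v t = r * exp (flow r t)" using v_eq[OF t] by simp
qed

lemma maximal_ivp_solution_flow:
  assumes r: "r \<in> param_range" and max: "maximal_ivp_solution 0 r J u v"
  shows "J = UNIV" "u t = flow r t" "v t = r * exp (flow r t)"
proof -
  have sol: "ivp_solution 0 r J u v"
    using max by (simp add: maximal_ivp_solution_def)
  show J: "J = UNIV"
    using max ivp_solution_flow[OF r] ivp_solution_unique[OF r sol]
    unfolding maximal_ivp_solution_def by (metis subset_UNIV)
  show "u t = flow r t" "v t = r * exp (flow r t)"
    using ivp_solution_unique[OF r sol, of t] J by auto
qed

section \<open>Failure of differential algebraicity for generic times\<close>

lemma differentially_algebraic_on_restrict:
  fixes f g :: "real \<Rightarrow> real"
  assumes DA: "differentially_algebraic_on f S" and "open U" "U \<subseteq> S" "\<And>r. r \<in> U \<Longrightarrow> f r = g r"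
  shows "differentially_algebraic_on g U"
proof -
  have "\<forall>r\<in>U. (deriv ^^ k) f r = (deriv ^^ k) g r" for k
  proof (induction k)
    case (Suc k)
    then have "\<forall>\<^sub>F s in nhds r. (deriv ^^ k) f s = (deriv ^^ k) g s" if "r \<in> U" for r
      using that assms(2) by (metis (mono_tags, lifting) eventually_nhds)
    then show ?case by (auto intro: deriv_cong_ev)
  qed (use assms in auto)
  then have "(\<lambda>k. (deriv ^^ k) f r) = (\<lambda>k. (deriv ^^ k) g r)" if "r \<in> U" for r
    using that by blast
  then show ?thesis
    using DA assms(3) unfolding differentially_algebraic_on_def by (metis subsetD)
qed

theorem theorem9:
  fixes I :: "real \<Rightarrow> real \<Rightarrow> real set"
    and y\<^sub>1 y\<^sub>2 :: "real \<Rightarrow> real \<Rightarrow> real \<Rightarrow> real"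
  assumes "\<And>r\<^sub>1 r\<^sub>2. maximal_ivp_solution r\<^sub>1 r\<^sub>2 (I r\<^sub>1 r\<^sub>2) (y\<^sub>1 r\<^sub>1 r\<^sub>2) (y\<^sub>2 r\<^sub>1 r\<^sub>2)"
  shows "generic_in UNIV
    {x. \<not> differentially_algebraic_on (\<lambda>r\<^sub>2. y\<^sub>1 0 r\<^sub>2 x) {r\<^sub>2. x \<in> I 0 r\<^sub>2} \<and>
        \<not> differentially_algebraic_on (\<lambda>r\<^sub>2. y\<^sub>2 0 r\<^sub>2 x) {r\<^sub>2. x \<in> I 0 r\<^sub>2}}"
proof (rule generic_in_UNIV_if_countable_compl)
  let ?A = "{x. differentially_algebraic_on (\<lambda>r. flow r x) param_range}"
  let ?B = "{x. differentially_algebraic_on (\<lambda>r. r * exp (flow r x)) param_range}"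
  have sub: "param_range \<subseteq> {r. x \<in> I 0 r}" for x
    using maximal_ivp_solution_flow(1)[OF _ assms] by auto
  have "x \<in> ?A" if "differentially_algebraic_on (\<lambda>r. y\<^sub>1 0 r x) {r. x \<in> I 0 r}" for x
    using differentially_algebraic_on_restrict[OF that open_param_range sub]
      maximal_ivp_solution_flow(2)[OF _ assms] by simp
  moreover have "x \<in> ?B" if "differentially_algebraic_on (\<lambda>r. y\<^sub>2 0 r x) {r. x \<in> I 0 r}" for x
    using differentially_algebraic_on_restrict[OF that open_param_range sub]
      maximal_ivp_solution_flow(3)[OF _ assms] by simp
  ultimately have "- {x. \<not> differentially_algebraic_on (\<lambda>r\<^sub>2. y\<^sub>1 0 r\<^sub>2 x) {r\<^sub>2. x \<in> I 0 r\<^sub>2} \<and>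
        \<not> differentially_algebraic_on (\<lambda>r\<^sub>2. y\<^sub>2 0 r\<^sub>2 x) {r\<^sub>2. x \<in> I 0 r\<^sub>2}} \<subseteq> ?A \<union> ?B"
    by blast
  moreover have "countable (?A \<union> ?B)"
    using flow_observable.countable_DA[OF flow_observable_first]
      flow_observable.countable_DA[OF flow_observable_second] by simp
  ultimately show "countable (- {x. \<not> differentially_algebraic_on (\<lambda>r\<^sub>2. y\<^sub>1 0 r\<^sub>2 x) {r\<^sub>2. x \<in> I 0 r\<^sub>2} \<and>
        \<not> differentially_algebraic_on (\<lambda>r\<^sub>2. y\<^sub>2 0 r\<^sub>2 x) {r\<^sub>2. x \<in> I 0 r\<^sub>2}})"
    by (rule countable_subset)
qed

end
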